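(* Let $\mathcal M$ be an o-minimal structure in a language $\mathcal L$ with universe $M$, and $\mathcal N$ an expansion of $\mathcal M$ such that every open definable set is $\mathcal L$-definable and $\mathcal N$ admits a dimension function $\dim$ compatible with $\mathcal M$. Let $G=\langle G,\cdot,1\rangle$ be a strongly large definable group with $G\subseteq M^n$ and $\dim G=k$. Then there are - $\mathcal L$-definable sets $X\subseteq M^m$ and $Z\subseteq X^2$ with $\dim(X^2\setminus Z)<2k$, - a definable injective map $h:X\to G$ with $\dim(G\setminus h(X))<k$, and - an $\mathcal L$-definable map $F:X^2\to X$ such that $h(x)\cdot h(y)=h(F(x,y))$ for every $(x,y)\in Z$.
   Context: "Definable" means definable in $\mathcal N$ with parameters; "$\mathcal L$-definable" means definable in $\mathcal M$ with parameters. A dimension function compatible with $\mathcal M$ is a map $\dim$ from definable sets to $\{-\infty\}\cup\mathbb N$ such that for all definable $X,Y\subseteq M^n$, $a\in M$: (D1) $\dim\{a\}=0$, $\dim M=1$, $\dim X=-\infty$ iff $X=\emptyset$; (D2) $\dim(X\cup Y)=\max\{\dim X,\dim Y\}$; (D3) for a definable family $\{X_t\}_{t\in I}$ of pairwise disjoint sets: (a) each $\{t\in I:\dim X_t=d\}$ is definable; (b) if all $X_t$ have dimension $k$ then $\dim\bigcup_t X_t=\dim I+k$; (D4) definable bijections preserve $\dim$; (D5) on $\mathcal L$-definable sets $\dim$ is the o-minimal dimension; (D6) every definable $f:M^n\to M$ agrees with an $\mathcal L$-definable $F:M^n\to M$ outside a definable set of dimension $<n$. $cl$ denotes topological closure;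 a definable set $X$ is strongly large if $\dim X=\dim cl(X)$; a definable group is strongly large if its universe is. *)

theory Defs
  imports "HOL-Library.Extended_Real" "HOL-Algebra.Group"
begin

text \<open>Points of M^n are lists of length n over the universe type 'm.
  A "structure" on M (with parameters) is given by its collection of definable
  sets, as a predicate on sets of tuples (van den Dries' notion of a structure).\<close>

definition Mn :: "nat \<Rightarrow> 'm list set" where
  "Mn n = {x. length x = n}"

definition is_structure :: "('m::linorder list set \<Rightarrow> bool) \<Rightarrow> bool" where
  "is_structure D \<longleftrightarrow>
     (\<forall>X. D X \<longrightarrow> (\<exists>n. X \<subseteq> Mn n)) \<and>
     (\<forall>n. D (Mn n)) \<and>
     (\<forall>n X Y. D X \<and> D Y \<and> X \<subseteq> Mn n \<and> Y \<subseteq> Mn n \<longrightarrow> D (X \<union> Y) \<and> D (X - Y)) \<and>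
     (\<forall>X. D X \<longrightarrow> D {x @ [a] | x a. x \<in> X} \<and> D {[a] @ x | x a. x \<in> X}) \<and>
     (\<forall>n i j. i < n \<and> j < n \<longrightarrow> D {x \<in> Mn n. x ! i = x ! j}) \<and>
     (\<forall>n X. D X \<and> X \<subseteq> Mn (Suc n) \<longrightarrow> D (butlast ` X)) \<and>
     (\<forall>a. D {[a]}) \<and>
     D {[x, y] | x y. x < y}"

definition is_interval :: "'m::linorder set \<Rightarrow> bool" where
  "is_interval I \<longleftrightarrow> (\<exists>a b. I = {a<..<b}) \<or> (\<exists>a. I = {a<..}) \<or> (\<exists>b. I = {..<b}) \<or> I = UNIV"

definition o_minimal :: "('m::linorder list set \<Rightarrow> bool) \<Rightarrow> bool" where
  "o_minimal D \<longleftrightarrow> is_structure D \<and>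
     (\<forall>X. D X \<and> X \<subseteq> Mn 1 \<longrightarrow>
        (\<exists>P F. finite P \<and> finite F \<and> (\<forall>I\<in>F. is_interval I) \<and>
               X = (\<lambda>x. [x]) ` (P \<union> \<Union>F)))"

definition expansion :: "('m::linorder list set \<Rightarrow> bool) \<Rightarrow> ('m list set \<Rightarrow> bool) \<Rightarrow> bool" where
  "expansion DL DN \<longleftrightarrow> is_structure DN \<and> (\<forall>X. DL X \<longrightarrow> DN X)"

definition box :: "nat \<Rightarrow> 'm::linorder list \<Rightarrow> 'm list \<Rightarrow> 'm list set" where
  "box n a b = {y \<in> Mn n. \<forall>i<n. a ! i < y ! i \<and> y ! i < b ! i}"

definition open_n :: "nat \<Rightarrow> 'm::linorder list set \<Rightarrow> bool" where
  "open_n n U \<longleftrightarrow> U \<subseteq> Mn n \<and>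
     (\<forall>x\<in>U. \<exists>a b. length a = n \<and> length b = n \<and> x \<in> box n a b \<and> box n a b \<subseteq> U)"

definition cl :: "nat \<Rightarrow> 'm::linorder list set \<Rightarrow> 'm list set" where
  "cl n X = {x \<in> Mn n. \<forall>a b. length a = n \<and> length b = n \<and> x \<in> box n a b \<longrightarrow> box n a b \<inter> X \<noteq> {}}"

definition nonempty_interior :: "nat \<Rightarrow> 'm::linorder list set \<Rightarrow> bool" where
  "nonempty_interior n X \<longleftrightarrow> (\<exists>U. U \<noteq> {} \<and> open_n n U \<and> U \<subseteq> X)"

text \<open>o-minimal dimension: the largest d such that some coordinate projection
  of X onto M^d has nonempty interior; -\<infinity> for the empty set.\<close>

definition odim :: "'m::linorder list set \<Rightarrow> ereal" where
  "odim X = Sup {ereal (real (card s)) | s n. X \<subseteq> Mn n \<and> s \<subseteq> {..<n} \<and>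
                   nonempty_interior (card s) ((\<lambda>x. nths x s) ` X)}"

definition dimension_function ::
  "('m::linorder list set \<Rightarrow> bool) \<Rightarrow> ('m list set \<Rightarrow> bool) \<Rightarrow> ('m list set \<Rightarrow> ereal) \<Rightarrow> bool" where
  "dimension_function DL DN dimf \<longleftrightarrow>
   \<comment> \<open>values in {-\<infinity>} \<union> \<nat>\<close>
   (\<forall>X. DN X \<longrightarrow> dimf X = -\<infinity> \<or> (\<exists>d::nat. dimf X = ereal (real d))) \<and>
   \<comment> \<open>(D1)\<close>
   (\<forall>a. dimf {[a]} = 0) \<and> dimf (Mn 1) = 1 \<and>
   (\<forall>X. DN X \<longrightarrow> (dimf X = -\<infinity> \<longleftrightarrow> X = {})) \<and>
   \<comment> \<open>(D2)\<close>
   (\<forall>n X Y. DN X \<and> DN Y \<and> X \<subseteq> Mn n \<and> Y \<subseteq> Mn n \<longrightarrow> dimf (X \<union> Y) = max (dimf X) (dimf Y)) \<and>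
   \<comment> \<open>(D3): family X_t = {x. t @ x \<in> S}, t \<in> I\<close>
   (\<forall>p n S I. DN S \<and> S \<subseteq> Mn (p + n) \<and> DN I \<and> I \<subseteq> Mn p \<and>
      (\<forall>t\<in>I. \<forall>t'\<in>I. t \<noteq> t' \<longrightarrow> {x. t @ x \<in> S} \<inter> {x. t' @ x \<in> S} = {}) \<longrightarrow>
      (\<forall>d. DN {t \<in> I. dimf {x. t @ x \<in> S} = d}) \<and>
      (\<forall>k::nat. (\<forall>t\<in>I. dimf {x. t @ x \<in> S} = ereal (real k)) \<longrightarrow>
          dimf (\<Union>t\<in>I. {x. t @ x \<in> S}) = dimf I + ereal (real k))) \<and>
   \<comment> \<open>(D4)\<close>
   (\<forall>n m X Y f. DN X \<and> DN Y \<and> X \<subseteq> Mn n \<and> Y \<subseteq> Mn m \<and> bij_betw f X Y \<and>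
      DN {x @ f x | x. x \<in> X} \<longrightarrow> dimf X = dimf Y) \<and>
   \<comment> \<open>(D5)\<close>
   (\<forall>X. DL X \<longrightarrow> dimf X = odim X) \<and>
   \<comment> \<open>(D6)\<close>
   (\<forall>n (f :: 'm list \<Rightarrow> 'm). DN {x @ [f x] | x. x \<in> Mn n} \<longrightarrow>
      (\<exists>F E. DL {x @ [F x] | x. x \<in> Mn n} \<and> DN E \<and> E \<subseteq> Mn n \<and> dimf E < ereal (real n) \<and>
             (\<forall>x \<in> Mn n - E. f x = F x)))"

definition strongly_large :: "('m::linorder list set \<Rightarrow> ereal) \<Rightarrow> nat \<Rightarrow> 'm list set \<Rightarrow> bool" where
  "strongly_large dimf n X \<longleftrightarrow> dimf X = dimf (cl n X)"

definition definable_group :: "('m::linorder list set \<Rightarrow> bool) \<Rightarrow> nat \<Rightarrow> ('m list, 'b) monoid_scheme \<Rightarrow> bool" where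
  "definable_group DN n G \<longleftrightarrow> group G \<and> carrier G \<subseteq> Mn n \<and> DN (carrier G) \<and>
     DN {x @ y @ (x \<otimes>\<^bsub>G\<^esub> y) | x y. x \<in> carrier G \<and> y \<in> carrier G}"

definition sq :: "'m list set \<Rightarrow> 'm list set" where
  "sq X = {x @ y | x y. x \<in> X \<and> y \<in> X}"

end

theory Submission
  imports Defs
begin

text \<open>
  Call a definable set small if its dimension is below the expected one. The engine on the o-minimal
  side is additivity of dimension: a definable subset of \<open>M\<^sup>p \<times> M\<^sup>q\<close> with full-dimensional fibres over a
  non-small base has full dimension, hence contains a box. This replaces the monotonicity theorem and
  gives generic uniform finiteness and a decomposition of \<open>cl(G)\<close>, up to a small set, into
  finitely many pieces on which a coordinate projection to \<open>M\<^sup>k\<close> is injective. Axiom (D6) then holds for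
  functions on \<open>cl(G)\<close> and \<open>cl(G)\<^sup>2\<close>: there are an o-minimally definable set \<open>X\<close> equal to \<open>G\<close> up to a
  small set, and o-minimally definable \<open>F\<close>, \<open>Q\<close>, \<open>R\<close> that agree with \<open>x y\<close>, \<open>x\<^sup>-\<^sup>1 y\<close>, \<open>x y\<^sup>-\<^sup>1\<close> almost everywhere.

  Points of \<open>X\<close> outside \<open>G\<close> still have to be sent injectively into \<open>G\<close>. After removing from \<open>X\<close> a
  small o-minimally definable set, every remaining \<open>x\<close> satisfies \<open>F(F(x,y),z) = F(x,F(y,z))\<close> for almost all
  \<open>y, z\<close>. Hence \<open>F(x,\<cdot>)\<close> agrees almost everywhere with left translation by a unique \<open>h(x) \<in> G\<close>, and \<open>h\<close> is
  the identity almost everywhere on \<open>G \<inter> X\<close>. Recovering \<open>x\<close> from \<open>R(F(x,y),y)\<close> shows that \<open>h\<close> is injective.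
\<close>

section \<open>Definable predicates and maps\<close>

text \<open>Axiom (D6) speaks only of functions on a full power of \<open>M\<close>, so it says
  nothing about \<open>G\<close> until \<open>G\<close> sits inside an o-minimally definable set of
  dimension \<open>k\<close> that is parametrised by \<open>M\<^sup>k\<close>. Strong largeness
  supplies this set: the complement of the closure is open and definable, hence o-minimally
  definable, and the closure still has dimension \<open>k\<close>. The points of \<open>X\<close>
  outside \<open>G\<close> form a small set that need not be o-minimally definable, so they cannot
  simply be deleted. Conditions on points of \<open>X\<close> are therefore almost-everywhere
  statements over \<open>X\<close>, which stay o-minimally definable; over \<open>G\<close>, which
  differs from \<open>X\<close> by small sets, the same statements can be translated by group
  elements. Continuity-type facts also come from smallness. Interval endpoints (c, d) are treated as
  points of \<open>M\<^sup>2\<close>, and endpoints that work at a generic t can be chosen so as to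
  work on a box around t. Uniform finiteness over \<open>M\<^sup>k\<close> and decomposition of
  subsets of \<open>M\<^sup>k\<close> into connected sets are proved by one induction on
  \<open>k\<close>, as for cell decomposition but only up to small sets.\<close>

locale def_structure =
  fixes D :: "('m::{dense_linorder, no_top, no_bot}) list set \<Rightarrow> bool"
  assumes str: "is_structure D"
begin

lemma D_arity: "D X \<Longrightarrow> \<exists>n. X \<subseteq> Mn n"
  using str by (simp add: is_structure_def)

lemma D_Mn: "D (Mn n)"
  using str by (simp add: is_structure_def)

lemma D_Un: "D X \<Longrightarrow> D Y \<Longrightarrow> X \<subseteq> Mn n \<Longrightarrow> Y \<subseteq> Mn n \<Longrightarrow> D (X \<union> Y)"
  using str[unfolded is_structure_def, THEN conjunct2, THEN conjunct2, THEN conjunct1] by blast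

lemma D_Diff: "D X \<Longrightarrow> D Y \<Longrightarrow> X \<subseteq> Mn n \<Longrightarrow> Y \<subseteq> Mn n \<Longrightarrow> D (X - Y)"
  using str[unfolded is_structure_def, THEN conjunct2, THEN conjunct2, THEN conjunct1] by blast

lemma D_cons: "D X \<Longrightarrow> D {[a] @ x | x a. x \<in> X}"
  using str unfolding is_structure_def by blast

lemma D_diag: "i < n \<Longrightarrow> j < n \<Longrightarrow> D {x \<in> Mn n. x ! i = x ! j}"
  using str unfolding is_structure_def by blast

lemma D_butlast: "D X \<Longrightarrow> X \<subseteq> Mn (Suc n) \<Longrightarrow> D (butlast ` X)"
  using str unfolding is_structure_def by blast

lemma D_point: "D {[a]}"
  using str unfolding is_structure_def by blast

lemma D_less: "D {[x, y] | x y. x < y}"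
  using str unfolding is_structure_def by blast

text \<open>Definability is phrased for predicates, of which only the values on \<open>Mn n\<close>
  matter, so that it can be derived by rules following the shape of a formula.\<close>

definition dpred :: "nat \<Rightarrow> ('m list \<Rightarrow> bool) \<Rightarrow> bool" where
  "dpred n P \<longleftrightarrow> D {x \<in> Mn n. P x}"

definition dmap :: "nat \<Rightarrow> ('m list \<Rightarrow> 'm list) \<Rightarrow> bool" where
  "dmap n f \<longleftrightarrow> (\<exists>m. \<forall>x\<in>Mn n. f x \<in> Mn m) \<and> D {x @ f x | x. x \<in> Mn n}"

lemma dpred_cong:
  assumes "\<And>x. x \<in> Mn n \<Longrightarrow> P x = Q x" shows "dpred n P = dpred n Q"
proof -
  have "{x \<in> Mn n. P x} = {x \<in> Mn n. Q x}" using assms by blast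
  then show ?thesis by (simp add: dpred_def)
qed

lemma dpred_congI: "dpred n Q \<Longrightarrow> (\<And>x. x \<in> Mn n \<Longrightarrow> P x = Q x) \<Longrightarrow> dpred n P"
  using dpred_cong by blast

lemma dpred_not: "dpred n P \<Longrightarrow> dpred n (\<lambda>x. \<not> P x)"
proof -
  assume a: "dpred n P"
  have "{x \<in> Mn n. \<not> P x} = Mn n - {x \<in> Mn n. P x}" by blast
  then show ?thesis using D_Diff[OF D_Mn, of "{x \<in> Mn n. P x}" n] a by (auto simp: dpred_def)
qed

lemma dpred_disj: "dpred n P \<Longrightarrow> dpred n Q \<Longrightarrow> dpred n (\<lambda>x. P x \<or> Q x)"
proof -
  assume a: "dpred n P" "dpred n Q"
  have "{x \<in> Mn n. P x \<or> Q x} = {x \<in> Mn n. P x} \<union> {x \<in> Mn n. Q x}" by blast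
  then show ?thesis using D_Un[of "{x \<in> Mn n. P x}" "{x \<in> Mn n. Q x}" n] a by (auto simp: dpred_def)
qed

lemma dpred_conj: "dpred n P \<Longrightarrow> dpred n Q \<Longrightarrow> dpred n (\<lambda>x. P x \<and> Q x)"
  using dpred_not[OF dpred_disj[OF dpred_not dpred_not], of n P Q] by simp

lemma dpred_imp: "dpred n P \<Longrightarrow> dpred n Q \<Longrightarrow> dpred n (\<lambda>x. P x \<longrightarrow> Q x)"
  unfolding imp_conv_disj by (intro dpred_disj dpred_not)

lemma dpred_const: "dpred n (\<lambda>x. c)"
proof -
  have "dpred n (\<lambda>x. True)" by (simp add: dpred_def D_Mn)
  then show ?thesis using dpred_not[of n "\<lambda>x. True"] by (cases c) auto
qed

lemma dpred_all_finite:
  "finite I \<Longrightarrow> (\<And>i. i \<in> I \<Longrightarrow> dpred n (P i)) \<Longrightarrow> dpred n (\<lambda>x. \<forall>i\<in>I. P i x)"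
proof (induction I rule: finite_induct)
  case empty then show ?case by (simp add: dpred_const)
next
  case (insert i I) then show ?case by (simp add: dpred_conj)
qed

lemma dpred_ex_finite:
  "finite I \<Longrightarrow> (\<And>i. i \<in> I \<Longrightarrow> dpred n (P i)) \<Longrightarrow> dpred n (\<lambda>x. \<exists>i\<in>I. P i x)"
  using dpred_not[OF dpred_all_finite, of I n "\<lambda>i x. \<not> P i x"] by (simp add: dpred_not)

lemma dpred_all_less:
  "(\<And>i::nat. i < m \<Longrightarrow> dpred n (P i)) \<Longrightarrow> dpred n (\<lambda>x. \<forall>i<m. P i x)"
  using dpred_all_finite[of "{..<m}" n P] by (simp add: Ball_def)

lemma D_dpred: "D X \<Longrightarrow> dpred n (\<lambda>x. x \<in> X)"
proof -
  assume X: "D X"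
  obtain m where m: "X \<subseteq> Mn m" using D_arity X by blast
  show ?thesis
  proof (cases "m = n")
    case True
    then have "{x \<in> Mn n. x \<in> X} = X" using m by blast
    then show ?thesis using X by (simp add: dpred_def)
  next
    case False
    then have "\<And>x. x \<in> Mn n \<Longrightarrow> (x \<in> X) = False" using m by (auto simp: Mn_def)
    then show ?thesis using dpred_cong[of n "\<lambda>x. x \<in> X" "\<lambda>x. False"] dpred_const by simp
  qed
qed

lemma cylinder_left: "D X \<Longrightarrow> X \<subseteq> Mn n \<Longrightarrow> dpred (m + n) (\<lambda>x. drop m x \<in> X)"
proof (induction m)
  case 0
  have "{x \<in> Mn n. x \<in> X} = X" using 0 by (auto simp: Mn_def)
  then show ?case using 0 by (simp add: dpred_def)
next
  case (Suc m)
  have "{x \<in> Mn (Suc m + n). drop (Suc m) x \<in> X} = {[a] @ x | x a. x \<in> {x \<in> Mn (m + n). drop m x \<in> X}}" (is "?L = ?R")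
  proof
    show "?L \<subseteq> ?R"
    proof
      fix x assume x: "x \<in> ?L"
      then have "x = [hd x] @ tl x" by (cases x) (auto simp: Mn_def)
      moreover have "tl x \<in> {x \<in> Mn (m + n). drop m x \<in> X}"
        using x by (auto simp: Mn_def drop_Suc)
      ultimately show "x \<in> ?R" by blast
    qed
  qed (auto simp: Mn_def)
  then show ?case using D_cons[of "{x \<in> Mn (m + n). drop m x \<in> X}"] Suc unfolding dpred_def by metis
qed

lemma D_take: "D X \<Longrightarrow> X \<subseteq> Mn (n + m) \<Longrightarrow> D (take n ` X)"
proof (induction m arbitrary: X)
  case 0
  have "take n ` X = X" using 0 by (force simp: Mn_def)
  then show ?case using 0 by simp
next
  case (Suc m)
  have "take n ` X = take n ` (butlast ` X)" unfolding image_image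
    by (rule image_cong) (use Suc.prems in \<open>auto simp: Mn_def butlast_conv_take min_def\<close>)
  moreover have "D (butlast ` X)" using D_butlast Suc.prems by simp
  moreover have "butlast ` X \<subseteq> Mn (n + m)" using Suc.prems by (auto simp: Mn_def)
  ultimately show ?case using Suc.IH by simp
qed

text \<open>Free variables occupy the first \<open>n\<close> coordinates and the quantified block
  the next \<open>m\<close>, so the quantifier is the projection \<open>take n\<close>.\<close>

lemma dpred_ex:
  assumes "dpred (n + m) (\<lambda>z. P (take n z) (drop n z))"
  shows "dpred n (\<lambda>x. \<exists>y\<in>Mn m. P x y)"
proof -
  have "{x \<in> Mn n. \<exists>y\<in>Mn m. P x y} = take n ` {z \<in> Mn (n + m). P (take n z) (drop n z)}" (is "?L = ?R")
  proof
    show "?L \<subseteq> ?R"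
    proof
      fix x assume "x \<in> ?L"
      then obtain y where "x \<in> Mn n" "y \<in> Mn m" "P x y" by blast
      then show "x \<in> ?R" by (intro image_eqI[of _ _ "x @ y"]) (auto simp: Mn_def)
    qed
  next
    show "?R \<subseteq> ?L"
    proof
      fix x assume "x \<in> ?R"
      then obtain z where "z \<in> Mn (n + m)" "P (take n z) (drop n z)" "x = take n z" by blast
      then show "x \<in> ?L" by (auto simp: Mn_def intro!: exI[of _ "drop n z"])
    qed
  qed
  moreover have "D \<dots>" using assms by (intro D_take[where m=m]) (auto simp: dpred_def)
  ultimately show ?thesis by (simp add: dpred_def)
qed

lemma dpred_all:
  "dpred (n + m) (\<lambda>z. P (take n z) (drop n z)) \<Longrightarrow> dpred n (\<lambda>x. \<forall>y\<in>Mn m. P x y)"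
  using dpred_not[OF dpred_ex[OF dpred_not]] by fastforce

lemma Mn_1: "y \<in> Mn (Suc 0) \<longleftrightarrow> (\<exists>v. y = [v])"
  by (auto simp: Mn_def length_Suc_conv)

lemma dpred_ex1:
  assumes "dpred (Suc n) (\<lambda>z. P (take n z) (z ! n))"
  shows "dpred n (\<lambda>x. \<exists>v. P x v)"
proof -
  have "dpred (n + 1) (\<lambda>z. P (take n z) (hd (drop n z)))"
    using assms unfolding Suc_eq_plus1 by (rule dpred_congI) (auto simp: Mn_def hd_drop_conv_nth)
  from dpred_ex[of n 1 "\<lambda>x y. P x (hd y)", OF this] show ?thesis
    by (rule dpred_congI) (force simp: Mn_1 Bex_def)
qed

lemma dpred_all1:
  "dpred (Suc n) (\<lambda>z. P (take n z) (z ! n)) \<Longrightarrow> dpred n (\<lambda>x. \<forall>v. P x v)"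
  using dpred_not[OF dpred_ex1[OF dpred_not]] by fastforce

section \<open>Coordinate selections\<close>

definition coord :: "nat \<Rightarrow> ('m list \<Rightarrow> 'm list) \<Rightarrow> bool" where
  "coord n f \<longleftrightarrow> (\<exists>idx. set idx \<subseteq> {..<n} \<and> (\<forall>x\<in>Mn n. f x = map (\<lambda>i. x ! i) idx))"

lemma coord_id: "coord n (\<lambda>x. x)"
  unfolding coord_def by (rule exI[of _ "[0..<n]"]) (auto simp: Mn_def map_nth)

lemma coord_take: "coord n f \<Longrightarrow> coord n (\<lambda>x. take j (f x))"
proof -
  assume "coord n f"
  then obtain idx where "set idx \<subseteq> {..<n}" "\<forall>x\<in>Mn n. f x = map (\<lambda>i. x ! i) idx" by (auto simp: coord_def)
  then show ?thesis unfolding coord_def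
    by (intro exI[of _ "take j idx"]) (auto simp: take_map dest: in_set_takeD)
qed

lemma coord_drop: "coord n f \<Longrightarrow> coord n (\<lambda>x. drop j (f x))"
proof -
  assume "coord n f"
  then obtain idx where "set idx \<subseteq> {..<n}" "\<forall>x\<in>Mn n. f x = map (\<lambda>i. x ! i) idx" by (auto simp: coord_def)
  then show ?thesis unfolding coord_def
    by (intro exI[of _ "drop j idx"]) (auto simp: drop_map dest: in_set_dropD)
qed

lemma coord_nths: "coord n f \<Longrightarrow> coord n (\<lambda>x. nths (f x) s)"
proof -
  assume "coord n f"
  then obtain idx where "set idx \<subseteq> {..<n}" "\<forall>x\<in>Mn n. f x = map (\<lambda>i. x ! i) idx" by (auto simp: coord_def)
  then show ?thesis unfolding coord_def
    by (intro exI[of _ "nths idx s"]) (auto simp: nths_map dest: in_set_nthsD)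
qed

lemma coord_append: "coord n f \<Longrightarrow> coord n g \<Longrightarrow> coord n (\<lambda>x. f x @ g x)"
proof -
  assume "coord n f" "coord n g"
  then obtain idx idx' where "set idx \<subseteq> {..<n}" "\<forall>x\<in>Mn n. f x = map (\<lambda>i. x ! i) idx"
    "set idx' \<subseteq> {..<n}" "\<forall>x\<in>Mn n. g x = map (\<lambda>i. x ! i) idx'" by (auto simp: coord_def)
  then show ?thesis unfolding coord_def
    by (intro exI[of _ "idx @ idx'"]) auto
qed

lemma coord_nth: "i < n \<Longrightarrow> coord n (\<lambda>x. [x ! i])"
  unfolding coord_def by (intro exI[of _ "[i]"]) auto

lemmas coord_intros = coord_id coord_take coord_drop coord_nths coord_append coord_nth

lemma D_coord_graph:
  assumes "set idx \<subseteq> {..<n}"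
  shows "dpred (n + length idx) (\<lambda>z. drop n z = map (\<lambda>i. z ! i) idx)"
proof -
  have "dpred (n + length idx) (\<lambda>z. \<forall>j<length idx. z ! (n + j) = z ! (idx ! j))"
  proof (rule dpred_all_less)
    fix j assume j: "j < length idx"
    then have "idx ! j < n" using assms by (meson lessThan_iff nth_mem subsetD)
    then show "dpred (n + length idx) (\<lambda>z. z ! (n + j) = z ! (idx ! j))"
      unfolding dpred_def using j by (intro D_diag) auto
  qed
  moreover have "(drop n z = map (\<lambda>i. z ! i) idx) = (\<forall>j<length idx. z ! (n + j) = z ! (idx ! j))"
    if "z \<in> Mn (n + length idx)" for z :: "'m list"
    using that unfolding list_eq_iff_nth_eq[of "drop n z"] by (simp add: Mn_def)
  ultimately show ?thesis by (rule dpred_congI)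
qed

text \<open>The axioms of a structure provide new coordinates only at the two ends. Permuted,
  repeated or omitted coordinates are reached by intersecting a cylinder over \<open>X\<close> with
  the graph of the selection, a finite intersection of diagonals, and projecting. The later
  substitution rules rest on this.\<close>

lemma dpred_coord:
  assumes f: "coord n f" and X: "D X"
  shows "dpred n (\<lambda>x. f x \<in> X)"
proof -
  obtain idx where i: "set idx \<subseteq> {..<n}" "\<forall>x\<in>Mn n. f x = map (\<lambda>i. x ! i) idx"
    using f by (auto simp: coord_def)
  obtain m where m: "X \<subseteq> Mn m" using D_arity X by blast
  show ?thesis
  proof (cases "m = length idx")
    case True
    have "dpred (n + m) (\<lambda>z. drop n z \<in> X \<and> drop n z = map (\<lambda>i. z ! i) idx)"
      using cylinder_left[OF X m] D_coord_graph[OF i(1)] True by (intro dpred_conj) auto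
    then have "dpred (n + m) (\<lambda>z. drop n z \<in> X \<and> drop n z = map (\<lambda>i. take n z ! i) idx)"
      by (rule dpred_congI) (use i(1) in \<open>auto simp: Mn_def subset_iff cong: map_cong\<close>)
    from dpred_ex[OF this] show ?thesis
      by (rule dpred_congI) (use i m True in \<open>auto simp: Mn_def\<close>)
  next
    case False
    then have "\<And>x. x \<in> Mn n \<Longrightarrow> (f x \<in> X) = False" using m i by (auto simp: Mn_def)
    then show ?thesis using dpred_cong[of n "\<lambda>x. f x \<in> X" "\<lambda>x. False"] dpred_const by simp
  qed
qed

lemma coord_dmap: "coord n f \<Longrightarrow> dmap n f"
proof -
  assume "coord n f"
  then obtain idx where i: "set idx \<subseteq> {..<n}" "\<forall>x\<in>Mn n. f x = map (\<lambda>i. x ! i) idx"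
    by (auto simp: coord_def)
  have "{x @ f x | x. x \<in> Mn n} = {z \<in> Mn (n + length idx). drop n z = map (\<lambda>i. z ! i) idx}" (is "?L = ?R")
  proof
    show "?L \<subseteq> ?R" using i by (auto simp: Mn_def nth_append subset_iff)
    show "?R \<subseteq> ?L"
    proof
      fix z assume z: "z \<in> ?R"
      then have "z = take n z @ f (take n z)" "take n z \<in> Mn n"
        using i append_take_drop_id[of n z] by (auto simp: Mn_def subset_iff cong: map_cong)
      then show "z \<in> ?L" by blast
    qed
  qed
  then show ?thesis using D_coord_graph[OF i(1)] i(2) unfolding dmap_def dpred_def by (auto simp: Mn_def)
qed

section \<open>Definable maps and substitution\<close>

lemma dmap_arity: "dmap n f \<Longrightarrow> \<exists>m. \<forall>x\<in>Mn n. f x \<in> Mn m"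
  by (simp add: dmap_def)

lemma dmap_D: "dmap n f \<Longrightarrow> D {x @ f x | x. x \<in> Mn n}"
  by (simp add: dmap_def)

lemma graph_iff: "x \<in> Mn n \<Longrightarrow> x @ y \<in> {x @ f x | x. x \<in> Mn n} \<longleftrightarrow> y = f x"
  by (auto simp: Mn_def)

text \<open>\<open>f x \<in> X\<close> holds iff some \<open>y\<close> has \<open>x @ y\<close> in
  the graph and \<open>y \<in> X\<close>. The atoms under this quantifier involve coordinate
  selections only, so the general substitution rule follows from \<open>dpred_coord\<close>.\<close>

lemma dpred_dmap:
  assumes f: "dmap n f" and X: "D X"
  shows "dpred n (\<lambda>x. f x \<in> X)"
proof -
  obtain m where m: "\<And>x. x \<in> Mn n \<Longrightarrow> f x \<in> Mn m" using dmap_arity[OF f] by blast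
  have g: "D {x @ f x | x. x \<in> Mn n}" (is "D ?G") using f by (rule dmap_D)
  have "dpred n (\<lambda>x. \<exists>y\<in>Mn m. x @ y \<in> ?G \<and> y \<in> X)"
    by (rule dpred_ex) (intro dpred_conj dpred_coord[OF _ g] dpred_coord[OF _ X] coord_intros)
  then show ?thesis
    by (rule dpred_congI) (use m in \<open>auto simp: graph_iff simp del: mem_Collect_eq\<close>)
qed

lemma dpred_comp:
  assumes "dpred m P" "dmap n f" "\<And>x. x \<in> Mn n \<Longrightarrow> f x \<in> Mn m"
  shows "dpred n (\<lambda>x. P (f x))"
  using dpred_dmap[OF assms(2), of "{x \<in> Mn m. P x}"] assms(1,3)
    dpred_cong[of n "\<lambda>x. f x \<in> {x \<in> Mn m. P x}" "\<lambda>x. P (f x)"] by (auto simp: dpred_def)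

lemma dmapI:
  assumes m: "\<And>x. x \<in> Mn n \<Longrightarrow> f x \<in> Mn m"
    and R: "dpred (n + m) (\<lambda>z. R (take n z) (drop n z))"
    and e: "\<And>x y. x \<in> Mn n \<Longrightarrow> y \<in> Mn m \<Longrightarrow> y = f x \<longleftrightarrow> R x y"
  shows "dmap n f"
proof -
  have "{x @ f x | x. x \<in> Mn n} = {z \<in> Mn (n + m). R (take n z) (drop n z)}" (is "?L = ?R")
  proof
    show "?L \<subseteq> ?R"
    proof
      fix z assume "z \<in> ?L"
      then obtain x where x: "x \<in> Mn n" "z = x @ f x" by blast
      then show "z \<in> ?R" using e[OF x(1) m[OF x(1)]] m[OF x(1)] by (auto simp: Mn_def)
    qed
    show "?R \<subseteq> ?L"
    proof
      fix z assume z: "z \<in> ?R"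
      then have "take n z \<in> Mn n" "drop n z \<in> Mn m" by (auto simp: Mn_def)
      then have "drop n z = f (take n z)" "take n z \<in> Mn n" using z e by auto
      then show "z \<in> ?L" using append_take_drop_id[of n z] by (smt (verit) mem_Collect_eq)
    qed
  qed
  then show ?thesis using R m unfolding dmap_def dpred_def by auto
qed

lemma dmap_graph_dpred: 
  assumes "D {x @ f x | x. x \<in> Mn n}" "coord N a" "coord N b" "\<And>x. x \<in> Mn N \<Longrightarrow> a x \<in> Mn n"
  shows "dpred N (\<lambda>x. b x = f (a x))"
  using dpred_coord[OF coord_append[OF assms(2,3)] assms(1)] assms(4)
    dpred_cong[of N "\<lambda>x. a x @ b x \<in> {x @ f x | x. x \<in> Mn n}" "\<lambda>x. b x = f (a x)"]
  by (simp add: graph_iff del: mem_Collect_eq)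

lemma dmap_append:
  assumes "dmap n f" "dmap n g" shows "dmap n (\<lambda>x. f x @ g x)"
proof -
  obtain m where m: "\<And>x. x \<in> Mn n \<Longrightarrow> f x \<in> Mn m" using dmap_arity[OF assms(1)] by blast
  obtain m' where m': "\<And>x. x \<in> Mn n \<Longrightarrow> g x \<in> Mn m'" using dmap_arity[OF assms(2)] by blast
  note Gf = dmap_D[OF assms(1)] and Gg = dmap_D[OF assms(2)]
  show ?thesis
  proof (rule dmapI[where m = "m + m'" and R = "\<lambda>x y. take m y = f x \<and> drop m y = g x"])
    show "dpred (n + (m + m')) (\<lambda>z. take m (drop n z) = f (take n z) \<and> drop m (drop n z) = g (take n z))"
      by (intro dpred_conj dmap_graph_dpred[OF Gf] dmap_graph_dpred[OF Gg] coord_take coord_drop coord_id)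
        (auto simp: Mn_def)
    fix x y :: "'m list" assume x: "x \<in> Mn n" "y \<in> Mn (m + m')"
    show "y = f x @ g x \<longleftrightarrow> take m y = f x \<and> drop m y = g x"
      using m[OF x(1)] by (metis (mono_tags) Mn_def append_take_drop_id append_eq_conv_conj mem_Collect_eq)
  qed (use m m' in \<open>auto simp: Mn_def\<close>)
qed

lemma dmap_comp:
  assumes "dmap m g" "dmap n f" "\<And>x. x \<in> Mn n \<Longrightarrow> f x \<in> Mn m"
  shows "dmap n (\<lambda>x. g (f x))"
proof -
  note Gf = dmap_D[OF assms(2)] and Gg = dmap_D[OF assms(1)]
  obtain p where p: "\<And>x. x \<in> Mn m \<Longrightarrow> g x \<in> Mn p" using dmap_arity[OF assms(1)] by blast
  show ?thesis
  proof (rule dmapI[where m = p and R = "\<lambda>x z. \<exists>y\<in>Mn m. y = f x \<and> z = g y"])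
    show "dpred (n + p) (\<lambda>z. \<exists>y\<in>Mn m. y = f (take n z) \<and> drop n z = g y)"
      by (rule dpred_ex, intro dpred_conj dmap_graph_dpred[OF Gf] dmap_graph_dpred[OF Gg] coord_take coord_drop coord_id)
        (auto simp: Mn_def)
  qed (use assms(3) p in auto)
qed

lemma dmap_id: "dmap n (\<lambda>x. x)" by (intro coord_dmap coord_id)

lemma dmap_take: "dmap n f \<Longrightarrow> dmap n (\<lambda>x. take j (f x))"
proof -
  assume f: "dmap n f"
  then obtain m where "\<And>x. x \<in> Mn n \<Longrightarrow> f x \<in> Mn m" using dmap_arity by blast
  then show ?thesis using dmap_comp[OF coord_dmap[OF coord_take[OF coord_id]] f] by blast
qed

lemma dmap_drop: "dmap n f \<Longrightarrow> dmap n (\<lambda>x. drop j (f x))"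
proof -
  assume f: "dmap n f"
  then obtain m where "\<And>x. x \<in> Mn n \<Longrightarrow> f x \<in> Mn m" using dmap_arity by blast
  then show ?thesis using dmap_comp[OF coord_dmap[OF coord_drop[OF coord_id]] f] by blast
qed

lemma dmap_nths: "dmap n f \<Longrightarrow> dmap n (\<lambda>x. nths (f x) s)"
proof -
  assume f: "dmap n f"
  then obtain m where "\<And>x. x \<in> Mn n \<Longrightarrow> f x \<in> Mn m" using dmap_arity by blast
  then show ?thesis using dmap_comp[OF coord_dmap[OF coord_nths[OF coord_id]] f] by blast
qed

lemma dpred_nth_eq: "i < n \<Longrightarrow> dpred n (\<lambda>x. x ! i = a)"
  using dpred_coord[OF coord_nth D_point, of i n a] by simp

lemma D_singleton: "D {c}"
proof -
  have "dpred (length c) (\<lambda>x. \<forall>i<length c. x ! i = c ! i)"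
    by (intro dpred_all_less dpred_nth_eq)
  moreover have "{x \<in> Mn (length c). \<forall>i<length c. x ! i = c ! i} = {c}"
    by (auto simp: Mn_def list_eq_iff_nth_eq)
  ultimately show ?thesis by (simp add: dpred_def)
qed

lemma dmap_const: "dmap n (\<lambda>x. c)"
proof (rule dmapI[where m = "length c" and R = "\<lambda>x y. y \<in> {c}"])
  show "dpred (n + length c) (\<lambda>z. drop n z \<in> {c})"
    by (intro dpred_coord D_singleton coord_intros)
qed (auto simp: Mn_def)

text \<open>An index past the end yields an unspecified value that depends only on the excess, so
  \<open>x ! i\<close> is then constant on tuples of one length. This frees \<open>dmap_nth\<close>
  from a bound on the index.\<close>

lemma nth_overflow: "length xs \<le> i \<Longrightarrow> xs ! i = [] ! (i - length xs)"
  by (induction xs arbitrary: i) (auto simp: nth_Cons')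

lemma dmap_nth: "dmap n f \<Longrightarrow> dmap n (\<lambda>x. [f x ! i])"
proof -
  assume f: "dmap n f"
  then obtain m where m: "\<And>x. x \<in> Mn n \<Longrightarrow> f x \<in> Mn m" by (meson dmap_arity)
  have "dmap m (\<lambda>x. [x ! i])"
  proof (cases "i < m")
    case True then show ?thesis by (intro coord_dmap coord_nth)
  next
    case False
    have "x ! i = [] ! (i - m)" if "x \<in> Mn m" for x :: "'m list"
      using False nth_overflow[of x i] that by (simp add: Mn_def)
    then have "(\<lambda>x. x @ [x ! i]) ` Mn m = (\<lambda>x. x @ [[] ! (i - m)]) ` (Mn m :: 'm list set)"
      by (intro image_cong) auto
    then have "{x @ [x ! i] | x. x \<in> Mn m} = {x @ [[] ! (i - m)] | x. x \<in> (Mn m :: 'm list set)}"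
      by (simp only: setcompr_eq_image Collect_mem_eq)
    then show ?thesis using dmap_const[of m "[[] ! (i - m)]"] by (auto simp: dmap_def Mn_def)
  qed
  from dmap_comp[OF this f] m show ?thesis by simp
qed

lemma dmap_cons: "dmap n (\<lambda>x. [f x]) \<Longrightarrow> dmap n g \<Longrightarrow> dmap n (\<lambda>x. f x # g x)"
  using dmap_append[of n "\<lambda>x. [f x]" g] by simp

text \<open>The second cons keeps this introduction rule from matching a singleton list, on which
  \<open>dmap_cons\<close> would reproduce its own goal.\<close>

lemma dmap_cons2: "dmap n (\<lambda>x. [f x]) \<Longrightarrow> dmap n (\<lambda>x. g x # h x) \<Longrightarrow> dmap n (\<lambda>x. f x # g x # h x)"
  by (rule dmap_cons)

lemma dpred_less: "dmap n (\<lambda>x. [f x]) \<Longrightarrow> dmap n (\<lambda>x. [g x]) \<Longrightarrow> dpred n (\<lambda>x. f x < g x)"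
  using dpred_dmap[OF dmap_cons D_less, of n f "\<lambda>x. [g x]"] by simp

lemma dpred_le: "dmap n (\<lambda>x. [f x]) \<Longrightarrow> dmap n (\<lambda>x. [g x]) \<Longrightarrow> dpred n (\<lambda>x. f x \<le> g x)"
  using dpred_not[OF dpred_less, of n g f] by (simp add: not_less)

lemma dpred_eq1: "dmap n (\<lambda>x. [f x]) \<Longrightarrow> dmap n (\<lambda>x. [g x]) \<Longrightarrow> dpred n (\<lambda>x. f x = g x)"
  using dpred_conj[OF dpred_le dpred_le, of n f g g f] by (simp add: eq_iff)

lemma dpred_eq: "dmap n f \<Longrightarrow> dmap n g \<Longrightarrow> dpred n (\<lambda>x. f x = g x)"
proof -
  assume fg: "dmap n f" "dmap n g"
  then obtain m m' where m: "\<And>x. x \<in> Mn n \<Longrightarrow> f x \<in> Mn m" "\<And>x. x \<in> Mn n \<Longrightarrow> g x \<in> Mn m'"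
    using dmap_arity by meson
  have "dpred n (\<lambda>x. m = m' \<and> (\<forall>i<m. f x ! i = g x ! i))"
    by (intro dpred_conj dpred_const dpred_all_less dpred_eq1 dmap_nth fg)
  moreover have "(f x = g x) = (m = m' \<and> (\<forall>i<m. f x ! i = g x ! i))" if "x \<in> Mn n" for x
    using m[OF that] unfolding list_eq_iff_nth_eq[of "f x"] by (simp add: Mn_def)
  ultimately show ?thesis by (rule dpred_congI)
qed

lemma dpred_Mn: "dmap n f \<Longrightarrow> dpred n (\<lambda>x. f x \<in> Mn m)"
  by (intro dpred_dmap D_Mn)

lemma dpred_iff: "dpred n P \<Longrightarrow> dpred n Q \<Longrightarrow> dpred n (\<lambda>x. P x \<longleftrightarrow> Q x)"
  using dpred_conj[OF dpred_imp dpred_imp, of n P Q Q P] by (simp add: iff_conv_conj_imp)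

lemma dpred_box:
  "dmap n f \<Longrightarrow> dmap n a \<Longrightarrow> dmap n b \<Longrightarrow> dpred n (\<lambda>x. f x \<in> box m (a x) (b x))"
  unfolding box_def mem_Collect_eq by (intro dpred_conj dpred_Mn dpred_all_less dpred_less dmap_nth)

lemma dmap_if:
  assumes P: "dpred n P" and fg: "dmap n f" "dmap n g" and m: "\<And>x. x \<in> Mn n \<Longrightarrow> length (f x) = length (g x)"
  shows "dmap n (\<lambda>x. if P x then f x else g x)"
proof -
  obtain m where f: "\<And>x. x \<in> Mn n \<Longrightarrow> f x \<in> Mn m" using fg(1) by (meson dmap_arity)
  show ?thesis
  proof (rule dmapI[where m = m and R = "\<lambda>x y. (P x \<and> y = f x) \<or> (\<not> P x \<and> y = g x)"])
    show "dpred (n + m) (\<lambda>z. P (take n z) \<and> drop n z = f (take n z) \<or> \<not> P (take n z) \<and> drop n z = g (take n z))"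
      by (intro dpred_disj dpred_conj dpred_not dpred_comp[OF P] dpred_eq dmap_comp[OF fg(1)] dmap_comp[OF fg(2)] dmap_take dmap_drop dmap_id)
        (auto simp: Mn_def)
  qed (use f assms(4) in \<open>auto simp: Mn_def\<close>)
qed

lemma dmap_if1:
  "dpred n P \<Longrightarrow> dmap n (\<lambda>x. [f x]) \<Longrightarrow> dmap n (\<lambda>x. [g x]) \<Longrightarrow> dmap n (\<lambda>x. [if P x then f x else g x])"
  using dmap_if[of n P "\<lambda>x. [f x]" "\<lambda>x. [g x]"] by (simp add: if_distrib[of "\<lambda>v. [v]"] if_distribR cong: if_cong)

lemma D_image: "D X \<Longrightarrow> X \<subseteq> Mn n \<Longrightarrow> dmap n f \<Longrightarrow> D (f ` X)"
proof -
  assume X: "D X" "X \<subseteq> Mn n" and f: "dmap n f"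
  then obtain m where m: "\<And>x. x \<in> Mn n \<Longrightarrow> f x \<in> Mn m" by (meson dmap_arity)
  have "dpred m (\<lambda>y. \<exists>x\<in>Mn n. x \<in> X \<and> y = f x)"
    by (rule dpred_ex, intro dpred_conj dpred_dmap[OF _ X(1)] dpred_eq dmap_comp[OF f] dmap_drop dmap_take dmap_id) (auto simp: Mn_def)
  moreover have "{y \<in> Mn m. \<exists>x\<in>Mn n. x \<in> X \<and> y = f x} = f ` X" using X m by auto
  ultimately show ?thesis by (simp add: dpred_def)
qed

lemma D_graph: "D X \<Longrightarrow> X \<subseteq> Mn n \<Longrightarrow> dmap n f \<Longrightarrow> D {x @ f x | x. x \<in> X}"
  using D_image[of X n "\<lambda>x. x @ f x"] dmap_append[OF dmap_id, of n f] by (simp add: setcompr_eq_image)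

lemma D_empty: "D {}"
  using dpred_const[of 0 False] by (simp add: dpred_def)

lemma D_Collect: "dpred n P \<Longrightarrow> (\<And>x. P x \<Longrightarrow> x \<in> Mn n) \<Longrightarrow> D {x. P x}"
  unfolding dpred_def by (smt (verit) Collect_cong)

lemma D_Collect': "D X \<Longrightarrow> X \<subseteq> Mn n \<Longrightarrow> dpred n P \<Longrightarrow> D {x \<in> X. P x}"
  by (rule D_Collect[of n]) (auto intro!: dpred_conj D_dpred)

lemma D_Union_finite: "finite I \<Longrightarrow> (\<And>i. i \<in> I \<Longrightarrow> D (X i) \<and> X i \<subseteq> Mn n) \<Longrightarrow> D (\<Union>i\<in>I. X i)"
proof (induction I rule: finite_induct)
  case empty then show ?case by (simp add: D_empty)
next
  case (insert i I)
  then show ?case using D_Un[of "X i" "\<Union>i\<in>I. X i" n] by auto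
qed

lemmas dpred_logic = dpred_conj dpred_disj dpred_not dpred_imp dpred_iff dpred_const
lemmas dpred_quant = dpred_ex dpred_all dpred_ex1 dpred_all1
lemmas dpred_atoms = dpred_less dpred_le dpred_eq dpred_eq1 dpred_Mn dpred_box
lemmas dmap_basic = dmap_id dmap_take dmap_drop dmap_nths dmap_append dmap_nth dmap_cons2 dmap_const

end

section \<open>Dimension and fibres\<close>

lemma box_sub_Mn: "box n a b \<subseteq> Mn n" by (auto simp: box_def)

lemma open_box: "a \<in> Mn n \<Longrightarrow> b \<in> Mn n \<Longrightarrow> open_n n (box n a b)"
  unfolding open_n_def by (auto simp: box_def Mn_def)

lemma box_nonempty_iff:
  fixes a b :: "('m::dense_linorder) list"
  shows "box n a b \<noteq> {} \<longleftrightarrow> (\<forall>i<n. a ! i < b ! i)"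
proof
  assume "box n a b \<noteq> {}"
  then show "\<forall>i<n. a ! i < b ! i" by (auto simp: box_def intro: less_trans)
next
  assume a: "\<forall>i<n. a ! i < b ! i"
  have "\<exists>c. \<forall>i<n. a ! i < c i \<and> c i < b ! i"
    by (rule choice[of "\<lambda>i c. i < n \<longrightarrow> a ! i < c \<and> c < b ! i"]) (use a dense in blast)
  then obtain c where "\<forall>i<n. a ! i < c i \<and> c i < b ! i" by blast
  then have "map c [0..<n] \<in> box n a b" by (auto simp: box_def Mn_def)
  then show "box n a b \<noteq> {}" by blast
qed

text \<open>Open sets are replaced by pairs of corner points, which turns nonempty interior into a
  first-order condition.\<close>

lemma nonempty_interior_iff:
  "nonempty_interior n X \<longleftrightarrow> (\<exists>a\<in>Mn n. \<exists>b\<in>Mn n. box n a b \<noteq> {} \<and> box n a b \<subseteq> X)"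
proof
  assume "nonempty_interior n X"
  then obtain U x where U: "open_n n U" "U \<subseteq> X" "x \<in> U" by (auto simp: nonempty_interior_def)
  then obtain a b where "length a = n" "length b = n" "x \<in> box n a b" "box n a b \<subseteq> U"
    unfolding open_n_def by blast
  then show "\<exists>a\<in>Mn n. \<exists>b\<in>Mn n. box n a b \<noteq> {} \<and> box n a b \<subseteq> X"
    using U by (intro bexI[of _ a] bexI[of _ b]) (auto simp: Mn_def)
next
  assume "\<exists>a\<in>Mn n. \<exists>b\<in>Mn n. box n a b \<noteq> {} \<and> box n a b \<subseteq> X"
  then show "nonempty_interior n X" unfolding nonempty_interior_def using open_box by blast
qed

lemma nonempty_interior_mono: "nonempty_interior n X \<Longrightarrow> X \<subseteq> Y \<Longrightarrow> nonempty_interior n Y"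
  unfolding nonempty_interior_def by blast

lemma length_nths_card: "s \<subseteq> {..<length x} \<Longrightarrow> length (nths x s) = card s"
  by (simp add: length_nths, rule arg_cong[where f = card]) auto

text \<open>Dimension is handled through strict upper bounds because each of them says that finitely
  many projections have empty interior, which \<open>L_dpred_small\<close> can express. A nonempty
  set has just one arity, so the arity bound inside \<open>odim\<close> can be fixed to
  \<open>n\<close>.\<close>

lemma odim_less_iff:
  assumes X: "X \<subseteq> Mn n"
  shows "odim X < ereal (real d) \<longleftrightarrow>
    (\<forall>s\<subseteq>{..<n}. d \<le> card s \<longrightarrow> \<not> nonempty_interior (card s) ((\<lambda>x. nths x s) ` X))"
    (is "_ \<longleftrightarrow> ?R")
proof
  assume l: "odim X < ereal (real d)"
  show ?R
  proof (intro allI impI notI)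
    fix s assume s: "s \<subseteq> {..<n}" "d \<le> card s" "nonempty_interior (card s) ((\<lambda>x. nths x s) ` X)"
    then have "ereal (real (card s)) \<le> odim X"
      unfolding odim_def using X by (intro Sup_upper) blast
    then show False using l s(2)
      by (metis ereal_less_eq(3) leD le_less_trans of_nat_le_iff order.trans)
  qed
next
  assume r: ?R
  have b: "card s < d" if "X \<subseteq> Mn n'" "s \<subseteq> {..<n'}" "nonempty_interior (card s) ((\<lambda>x. nths x s) ` X)" for s n'
  proof -
    have "X \<noteq> {}" using that(3) by (auto simp: nonempty_interior_def)
    then have "n' = n" using X that(1) by (auto simp: Mn_def)
    then show ?thesis using r that(2,3) by (meson not_le)
  qed
  show "odim X < ereal (real d)"
  proof (cases d)
    case 0
    then have "{ereal (real (card s)) | s n. X \<subseteq> Mn n \<and> s \<subseteq> {..<n} \<and>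
                   nonempty_interior (card s) ((\<lambda>x. nths x s) ` X)} = {}" using b by blast
    then have "odim X = -\<infinity>" unfolding odim_def by (simp only: Sup_empty bot_ereal_def)
    then show ?thesis by simp
  next
    case (Suc e)
    then have "odim X \<le> ereal (real e)"
      unfolding odim_def using b by (intro Sup_least) (fastforce simp: less_Suc_eq_le)
    then show ?thesis using Suc by (metis ereal_less(2) le_less_trans less_ereal.simps(1) lessI of_nat_less_iff)
  qed
qed

lemma nths_all_Mn: "x \<in> Mn n \<Longrightarrow> nths x {..<n} = x"
  by (intro nths_all) (auto simp: Mn_def)

lemma odim_less_full:
  assumes X: "X \<subseteq> Mn n"
  shows "odim X < ereal (real n) \<longleftrightarrow> \<not> nonempty_interior n X"
proof -
  have i: "(\<lambda>x. nths x {..<n}) ` X = X" using X nths_all_Mn by (force simp: subset_iff image_def)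
  have "s = {..<n}" if "s \<subseteq> {..<n}" "n \<le> card s" for s
    using that card_seteq[of "{..<n}" s] by simp
  then have "odim X < ereal (real n) \<longleftrightarrow> \<not> nonempty_interior (card {..<n}) ((\<lambda>x. nths x {..<n}) ` X)"
    unfolding odim_less_iff[OF X] by (metis card_lessThan order_refl)
  then show ?thesis unfolding i by simp
qed

lemma odim_less_Suc: "X \<subseteq> Mn n \<Longrightarrow> odim X < ereal (real (Suc n))"
  unfolding odim_less_iff by (metis card_lessThan card_mono finite_lessThan not_less_eq_eq)

definition fiber :: "'a list set \<Rightarrow> 'a list \<Rightarrow> 'a list set" where
  "fiber S t = {x. t @ x \<in> S}"

lemma fiber_sub_Mn: "S \<subseteq> Mn (p + n) \<Longrightarrow> t \<in> Mn p \<Longrightarrow> fiber S t \<subseteq> Mn n"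
  by (force simp: fiber_def Mn_def)

context def_structure begin

lemma dpred_comp2:
  assumes P: "dpred (p + n) (\<lambda>z. P (take p z) (drop p z))" and fg: "dmap q f" "dmap q g"
    and f: "\<And>x. x \<in> Mn q \<Longrightarrow> f x \<in> Mn p" and g: "\<And>x. x \<in> Mn q \<Longrightarrow> g x \<in> Mn n"
  shows "dpred q (\<lambda>x. P (f x) (g x))"
proof (rule dpred_congI)
  show "dpred q (\<lambda>x. P (take p (f x @ g x)) (drop p (f x @ g x)))"
    by (rule dpred_comp[OF P dmap_append[OF fg]]) (use f g in \<open>auto simp: Mn_def\<close>)
qed (use f in \<open>auto simp: Mn_def\<close>)

end

section \<open>The dimension axioms and small sets\<close>

locale tame_pair = L: def_structure DL + N: def_structure DN
  for DL DN :: "('m::{dense_linorder, no_top, no_bot}) list set \<Rightarrow> bool" +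
  fixes dimf :: "'m list set \<Rightarrow> ereal"
  assumes omin: "o_minimal DL"
    and expan: "expansion DL DN"
    and open_DL: "\<And>p U. DN U \<Longrightarrow> open_n p U \<Longrightarrow> DL U"
    and dimfun: "dimension_function DL DN dimf"
begin

lemma DL_DN: "DL X \<Longrightarrow> DN X"
  using expan by (simp add: expansion_def)

lemma dpred_LN: "L.dpred n P \<Longrightarrow> N.dpred n P"
  by (simp add: L.dpred_def N.dpred_def DL_DN)

lemma dmap_LN: "L.dmap n f \<Longrightarrow> N.dmap n f"
  by (simp add: L.dmap_def N.dmap_def DL_DN)

lemma dim_values: "DN X \<Longrightarrow> dimf X = -\<infinity> \<or> (\<exists>d::nat. dimf X = ereal (real d))"
  using dimfun unfolding dimension_function_def by (elim conjE) blast

lemma dim_point: "dimf {[a]} = 0"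
  using dimfun unfolding dimension_function_def by (elim conjE) blast

lemma dim_empty_iff: "DN X \<Longrightarrow> dimf X = -\<infinity> \<longleftrightarrow> X = {}"
  using dimfun unfolding dimension_function_def by (elim conjE) blast

lemma dim_Un: "DN X \<Longrightarrow> DN Y \<Longrightarrow> X \<subseteq> Mn n \<Longrightarrow> Y \<subseteq> Mn n \<Longrightarrow> dimf (X \<union> Y) = max (dimf X) (dimf Y)"
  using dimfun unfolding dimension_function_def by (elim conjE) blast

lemma dim_family:
  assumes "DN S" "S \<subseteq> Mn (p + n)" "DN I" "I \<subseteq> Mn p"
    "\<And>t t'. t \<in> I \<Longrightarrow> t' \<in> I \<Longrightarrow> t \<noteq> t' \<Longrightarrow> {x. t @ x \<in> S} \<inter> {x. t' @ x \<in> S} = {}"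
  shows "DN {t \<in> I. dimf {x. t @ x \<in> S} = d}"
    "(\<And>t. t \<in> I \<Longrightarrow> dimf {x. t @ x \<in> S} = ereal (real k)) \<Longrightarrow>
       dimf (\<Union>t\<in>I. {x. t @ x \<in> S}) = dimf I + ereal (real k)"
proof -
  have *: "\<forall>p n S I. DN S \<and> S \<subseteq> Mn (p + n) \<and> DN I \<and> I \<subseteq> Mn p \<and>
      (\<forall>t\<in>I. \<forall>t'\<in>I. t \<noteq> t' \<longrightarrow> {x. t @ x \<in> S} \<inter> {x. t' @ x \<in> S} = {}) \<longrightarrow>
      (\<forall>d. DN {t \<in> I. dimf {x. t @ x \<in> S} = d}) \<and>
      (\<forall>k::nat. (\<forall>t\<in>I. dimf {x. t @ x \<in> S} = ereal (real k)) \<longrightarrow>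
          dimf (\<Union>t\<in>I. {x. t @ x \<in> S}) = dimf I + ereal (real k))"
    using dimfun unfolding dimension_function_def by (elim conjE) assumption
  have **: "(\<forall>d. DN {t \<in> I. dimf {x. t @ x \<in> S} = d}) \<and>
      (\<forall>k::nat. (\<forall>t\<in>I. dimf {x. t @ x \<in> S} = ereal (real k)) \<longrightarrow>
          dimf (\<Union>t\<in>I. {x. t @ x \<in> S}) = dimf I + ereal (real k))"
    by (rule *[rule_format]) (use assms in auto)
  show "DN {t \<in> I. dimf {x. t @ x \<in> S} = d}" using ** by blast
  show "(\<And>t. t \<in> I \<Longrightarrow> dimf {x. t @ x \<in> S} = ereal (real k)) \<Longrightarrow>
       dimf (\<Union>t\<in>I. {x. t @ x \<in> S}) = dimf I + ereal (real k)" using ** by blast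
qed

lemma dim_bij:
  assumes "DN X" "DN Y" "X \<subseteq> Mn n" "Y \<subseteq> Mn m" "bij_betw f X Y" "DN {x @ f x | x. x \<in> X}"
  shows "dimf X = dimf Y"
proof -
  have *: "\<forall>n m X Y f. DN X \<and> DN Y \<and> X \<subseteq> Mn n \<and> Y \<subseteq> Mn m \<and> bij_betw f X Y \<and>
      DN {x @ f x | x. x \<in> X} \<longrightarrow> dimf X = dimf Y"
    using dimfun unfolding dimension_function_def by (elim conjE) assumption
  show ?thesis by (rule *[rule_format, of X Y n m f]) (use assms in auto)
qed

lemma dim_DL: "DL X \<Longrightarrow> dimf X = odim X"
proof -
  have "\<forall>X. DL X \<longrightarrow> dimf X = odim X"
    using dimfun unfolding dimension_function_def by (elim conjE) assumption
  then show "DL X \<Longrightarrow> dimf X = odim X" by simp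
qed

lemma dim_approx:
  assumes "N.dmap n (\<lambda>x. [f x])"
  shows "\<exists>F E. L.dmap n (\<lambda>x. [F x]) \<and> DN E \<and> E \<subseteq> Mn n \<and> dimf E < ereal (real n) \<and>
             (\<forall>x \<in> Mn n - E. f x = F x)"
proof -
  have *: "\<forall>n (f :: 'm list \<Rightarrow> 'm). DN {x @ [f x] | x. x \<in> Mn n} \<longrightarrow>
      (\<exists>F E. DL {x @ [F x] | x. x \<in> Mn n} \<and> DN E \<and> E \<subseteq> Mn n \<and> dimf E < ereal (real n) \<and>
             (\<forall>x \<in> Mn n - E. f x = F x))"
    using dimfun unfolding dimension_function_def by (elim conjE) assumption
  obtain F E where "DL {x @ [F x] | x. x \<in> Mn n}" "DN E" "E \<subseteq> Mn n" "dimf E < ereal (real n)"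
             "\<forall>x \<in> Mn n - E. f x = F x"
    using *[rule_format, OF N.dmap_D[OF assms]] by blast
  moreover have "\<exists>m. \<forall>x\<in>Mn n. [F x] \<in> Mn m"
    by (rule exI[of _ 1]) (simp add: Mn_def)
  ultimately show ?thesis unfolding L.dmap_def by blast
qed

text \<open>A strict bound treats the empty set, of dimension minus infinity, on a par with all
  others: for definable sets \<open>small 0\<close> means empty and \<open>small (Suc d)\<close>
  means dimension at most \<open>d\<close>.\<close>

definition small :: "nat \<Rightarrow> 'm list set \<Rightarrow> bool" where
  "small d X \<longleftrightarrow> dimf X < ereal (real d)"

lemma small_empty: "small d {}"
  using dim_empty_iff[OF N.D_empty] by (simp add: small_def)

lemma small_0_iff: "DN X \<Longrightarrow> small 0 X \<longleftrightarrow> X = {}"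
proof -
  assume X: "DN X"
  have "dimf X < 0 \<longleftrightarrow> dimf X = -\<infinity>" using dim_values[OF X] by auto
  then show ?thesis using dim_empty_iff[OF X] by (simp add: small_def zero_ereal_def)
qed

lemma small_weaken: "small d X \<Longrightarrow> d \<le> e \<Longrightarrow> small e X"
  unfolding small_def by (metis ereal_less_eq(3) less_le_trans of_nat_le_iff)

lemma small_iff_dim: "DN X \<Longrightarrow> small d X \<longleftrightarrow> dimf X = -\<infinity> \<or> (\<exists>e\<in>{..<d}. dimf X = ereal (real e))"
  using dim_values[of X] by (auto simp: small_def)

lemma not_small_iff_dim: "DN X \<Longrightarrow> \<not> small d X \<longleftrightarrow> (\<exists>e\<ge>d. dimf X = ereal (real e))"
  using dim_values[of X] by (auto simp: small_def not_less)

lemma dim_mono: "DN X \<Longrightarrow> DN Y \<Longrightarrow> X \<subseteq> Y \<Longrightarrow> Y \<subseteq> Mn n \<Longrightarrow> dimf X \<le> dimf Y"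
  using dim_Un[of X Y n] by (metis Un_absorb1 max.cobounded1 subset_trans)

lemma small_subset: "small d Y \<Longrightarrow> DN X \<Longrightarrow> DN Y \<Longrightarrow> X \<subseteq> Y \<Longrightarrow> Y \<subseteq> Mn n \<Longrightarrow> small d X"
  using dim_mono[of X Y n] unfolding small_def by (rule le_less_trans)

lemma small_Un: "small d X \<Longrightarrow> small d Y \<Longrightarrow> DN X \<Longrightarrow> DN Y \<Longrightarrow> X \<subseteq> Mn n \<Longrightarrow> Y \<subseteq> Mn n \<Longrightarrow> small d (X \<union> Y)"
  using dim_Un[of X Y n] by (simp add: small_def)

lemma small_Union_finite:
  "finite I \<Longrightarrow> (\<And>i. i \<in> I \<Longrightarrow> DN (X i) \<and> X i \<subseteq> Mn n \<and> small d (X i)) \<Longrightarrow> small d (\<Union>i\<in>I. X i)"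
proof (induction I rule: finite_induct)
  case empty then show ?case by (simp add: small_empty)
next
  case (insert i I)
  have "DN (\<Union>i\<in>I. X i)" using insert by (intro N.D_Union_finite[where n=n]) auto
  then show ?case using insert small_Un[of d "X i" "\<Union>i\<in>I. X i" n] by auto
qed

lemma small_Collect_disj:
  assumes "small d {x \<in> Mn n. P x}" "small d {x \<in> Mn n. Q x}" "N.dpred n P" "N.dpred n Q"
  shows "small d {x \<in> Mn n. P x \<or> Q x}"
proof -
  have "{x \<in> Mn n. P x \<or> Q x} = {x \<in> Mn n. P x} \<union> {x \<in> Mn n. Q x}" by blast
  then show ?thesis using small_Un[of d "{x \<in> Mn n. P x}" "{x \<in> Mn n. Q x}" n] assms
    by (auto simp: N.dpred_def)
qed

lemma small_Collect_mono:
  assumes "small d {x \<in> Mn n. Q x}" "N.dpred n P" "N.dpred n Q" "\<And>x. x \<in> Mn n \<Longrightarrow> P x \<Longrightarrow> Q x"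
  shows "small d {x \<in> Mn n. P x}"
  by (rule small_subset[OF assms(1), where n=n]) (use assms in \<open>auto simp: N.dpred_def\<close>)

lemma small_full_iff: "DL X \<Longrightarrow> X \<subseteq> Mn n \<Longrightarrow> small n X \<longleftrightarrow> \<not> nonempty_interior n X"
  using odim_less_full[of X n] by (simp add: small_def dim_DL)

lemma small_Suc_arity: "DN X \<Longrightarrow> X \<subseteq> Mn n \<Longrightarrow> small (Suc n) X"
  using small_subset[of "Suc n" "Mn n" X n] odim_less_Suc[of "Mn n" n]
  by (auto simp: small_def dim_DL L.D_Mn N.D_Mn)

lemma N_fiber: "DN S \<Longrightarrow> S \<subseteq> Mn (p + n) \<Longrightarrow> t \<in> Mn p \<Longrightarrow> DN (fiber S t)"
proof -
  assume S: "DN S" "S \<subseteq> Mn (p + n)" "t \<in> Mn p"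
  have "N.dpred n (\<lambda>x. t @ x \<in> S)"
    by (intro N.dpred_dmap[OF _ S(1)] N.dmap_append N.dmap_const N.dmap_id)
  then show ?thesis unfolding fiber_def
    by (rule N.D_Collect) (use S in \<open>force simp: Mn_def\<close>)
qed

text \<open>Axiom (D3) covers only families of pairwise disjoint sets. \<open>S'\<close> records the
  parameter twice, so its fibre over \<open>t\<close> is the slice of \<open>S\<close> above
  \<open>t\<close>. Slices are disjoint, and by (D4) they have the dimensions of the original
  fibres.\<close>

lemma N_fiber_dim:
  assumes S: "DN S" "S \<subseteq> Mn (p + n)" and I: "DN I" "I \<subseteq> Mn p"
  shows "DN {t \<in> I. dimf (fiber S t) = d}"
    and "(\<And>t. t \<in> I \<Longrightarrow> dimf (fiber S t) = ereal (real k)) \<Longrightarrow>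
       dimf {z \<in> S. take p z \<in> I} = dimf I + ereal (real k)"
proof -
  define S' where "S' = {z \<in> Mn (p + (p + n)). take p z = take p (drop p z) \<and> drop p z \<in> S}"
  have DS': "DN S'"
    unfolding S'_def N.dpred_def[symmetric]
    by (intro N.dpred_conj N.dpred_eq N.dpred_dmap[OF _ S(1)] N.dmap_basic)
  have fib: "{x. t @ x \<in> S'} = {z \<in> S. take p z = t}" if "t \<in> Mn p" for t
    using that S(2) unfolding S'_def by (auto simp: Mn_def)
  have dm: "dimf {z \<in> S. take p z = t} = dimf (fiber S t)" if t: "t \<in> Mn p" for t
  proof -
    have "DN {x @ (t @ x) | x. x \<in> fiber S t}"
      using N_fiber[OF S t] fiber_sub_Mn[OF S(2) t] by (rule N.D_graph[of _ n "\<lambda>x. t @ x"]) (intro N.dmap_append N.dmap_const N.dmap_id)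
    moreover have "bij_betw (\<lambda>x. t @ x) (fiber S t) {z \<in> S. take p z = t}"
    proof (rule bij_betwI[where g = "drop p"])
      show "drop p \<in> {z \<in> S. take p z = t} \<rightarrow> fiber S t"
        by (auto simp: fiber_def)
      show "\<And>y. y \<in> {z \<in> S. take p z = t} \<Longrightarrow> t @ drop p y = y"
        by (metis (mono_tags, lifting) append_take_drop_id mem_Collect_eq)
    qed (use t in \<open>auto simp: fiber_def Mn_def\<close>)
    moreover have "DN {z \<in> S. take p z = t}"
      by (rule N.D_Collect'[OF S]) (intro N.dpred_eq N.dmap_basic)
    moreover have "{z \<in> S. take p z = t} \<subseteq> Mn (p + n)" using S(2) by blast
    ultimately show ?thesis
      using dim_bij[of "fiber S t" "{z \<in> S. take p z = t}" n "p + n" "\<lambda>x. t @ x"]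
        N_fiber[OF S t] fiber_sub_Mn[OF S(2) t] by simp
  qed
  have dj: "{x. t @ x \<in> S'} \<inter> {x. t' @ x \<in> S'} = {}" if "t \<in> I" "t' \<in> I" "t \<noteq> t'" for t t'
    using that fib[of t] fib[of t'] I(2) by (auto simp: subset_iff)
  have S'2: "S' \<subseteq> Mn (p + (p + n))" by (auto simp: S'_def)
  have eq: "dimf {x. t @ x \<in> S'} = dimf (fiber S t)" if "t \<in> I" for t
    using that I(2) fib dm by (metis subset_iff)
  have "{t \<in> I. dimf {x. t @ x \<in> S'} = d} = {t \<in> I. dimf (fiber S t) = d}"
    using eq by auto
  then show "DN {t \<in> I. dimf (fiber S t) = d}"
    using dim_family(1)[OF DS' S'2 I dj, of d] by simp
  assume k: "\<And>t. t \<in> I \<Longrightarrow> dimf (fiber S t) = ereal (real k)"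
  have "(\<Union>t\<in>I. {x. t @ x \<in> S'}) = {z \<in> S. take p z \<in> I}"
    using fib I(2) by (auto simp: subset_iff)
  then show "dimf {z \<in> S. take p z \<in> I} = dimf I + ereal (real k)"
    using dim_family(2)[OF DS' S'2 I dj, of k] k eq by simp
qed

lemma dpred_fiber_small:
  assumes S: "DN S" "S \<subseteq> Mn (p + n)"
  shows "N.dpred p (\<lambda>t. small b (fiber S t))"
proof -
  have "N.dpred p (\<lambda>t. dimf (fiber S t) = d)" for d
    unfolding N.dpred_def by (rule N_fiber_dim(1)[OF S N.D_Mn order_refl])
  then have "N.dpred p (\<lambda>t. dimf (fiber S t) = -\<infinity> \<or> (\<exists>e\<in>{..<b}. dimf (fiber S t) = ereal (real e)))"
    by (intro N.dpred_disj N.dpred_ex_finite) auto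
  then show ?thesis by (rule N.dpred_congI) (simp add: small_iff_dim N_fiber[OF S])
qed

lemma fiber_Collect:
  "t \<in> Mn p \<Longrightarrow> fiber {z \<in> Mn (p + n). P (take p z) (drop p z)} t = {x \<in> Mn n. P t x}"
  by (auto simp: fiber_def Mn_def)

lemma N_dpred_small:
  assumes "N.dpred (p + n) (\<lambda>z. P (take p z) (drop p z))"
  shows "N.dpred p (\<lambda>t. small b {x \<in> Mn n. P t x})"
  using dpred_fiber_small[of "{z \<in> Mn (p + n). P (take p z) (drop p z)}" p n b] assms
  by (auto simp: N.dpred_def fiber_Collect cong: conj_cong)

text \<open>Axiom (D3) would give definability in the expansion only. For an o-minimally definable
  family, (D5) replaces \<open>dimf\<close> by \<open>odim\<close>, and a bound on
  \<open>odim\<close> says that no projection to at least \<open>b\<close> coordinates contains a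
  nonempty box. That is a formula \<open>Q s\<close> for each of the finitely many coordinate sets
  \<open>s\<close>.\<close>

lemma L_dpred_small:
  assumes "L.dpred (p + n) (\<lambda>z. P (take p z) (drop p z))"
  shows "L.dpred p (\<lambda>t. small b {x \<in> Mn n. P t x})"
proof -
  have fibL: "DL {x \<in> Mn n. P t x}" if t: "t \<in> Mn p" for t
  proof -
    have "L.dpred n (\<lambda>x. P (take p (t @ x)) (drop p (t @ x)))"
      by (rule L.dpred_comp[OF assms, of n "\<lambda>x. t @ x"]) (use t in \<open>auto simp: Mn_def intro!: L.dmap_basic\<close>)
    then show ?thesis using t by (simp add: L.dpred_def Mn_def)
  qed
  define Q where "Q s t \<longleftrightarrow> (\<exists>a\<in>Mn (card s). \<exists>b\<in>Mn (card s). (\<forall>i<card s. a ! i < b ! i) \<and>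
      (\<forall>y\<in>Mn (card s). y \<in> box (card s) a b \<longrightarrow> (\<exists>x\<in>Mn n. P t x \<and> y = nths x s)))" for s t
  have "L.dpred p (Q s)" for s unfolding Q_def
    by (intro L.dpred_quant L.dpred_logic L.dpred_all_less L.dpred_atoms L.dmap_basic L.dpred_comp2[OF assms])
      (auto simp: Mn_def)
  then have "L.dpred p (\<lambda>t. \<forall>s\<in>{s. s \<subseteq> {..<n} \<and> b \<le> card s}. \<not> Q s t)"
    by (intro L.dpred_all_finite L.dpred_not) auto
  then show ?thesis
  proof (rule L.dpred_congI)
    fix t :: "'m list" assume t: "t \<in> Mn p"
    have "nonempty_interior (card s) ((\<lambda>x. nths x s) ` {x \<in> Mn n. P t x}) \<longleftrightarrow> Q s t" for s
    proof -
      have "box (card s) u v \<subseteq> (\<lambda>x. nths x s) ` {x \<in> Mn n. P t x} \<longleftrightarrow>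
          (\<forall>y\<in>Mn (card s). y \<in> box (card s) u v \<longrightarrow> (\<exists>x\<in>Mn n. P t x \<and> y = nths x s))" for u v
        using box_sub_Mn[of "card s" u v] by blast
      then show ?thesis unfolding nonempty_interior_iff Q_def box_nonempty_iff by simp
    qed
    then show "small b {x \<in> Mn n. P t x} = (\<forall>s\<in>{s. s \<subseteq> {..<n} \<and> b \<le> card s}. \<not> Q s t)"
      unfolding small_def dim_DL[OF fibL[OF t]] using odim_less_iff[of "{x \<in> Mn n. P t x}" n b] by auto
  qed
qed

lemma fiber_dim_le: "DN S \<Longrightarrow> S \<subseteq> Mn (p + n) \<Longrightarrow> t \<in> Mn p \<Longrightarrow> dimf (fiber S t) = ereal (real d) \<Longrightarrow> d \<le> n"
  using small_Suc_arity[OF N_fiber[of S p n t] fiber_sub_Mn[of S p n t]] by (simp add: small_def)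

text \<open>The parameters with non-small fibres split into finitely many definable sets
  \<open>J d\<close> according to fibre dimension. One of them is not small, and additivity on the
  part of \<open>S\<close> above it gives the bound.\<close>

lemma fubini_lower:
  assumes S: "DN S" "S \<subseteq> Mn (p + n)" and I: "\<not> small a {t \<in> Mn p. \<not> small b (fiber S t)}"
  shows "\<not> small (a + b) S"
proof
  assume sm: "small (a + b) S"
  define J where "J d = {t \<in> Mn p. dimf (fiber S t) = ereal (real d)}" for d
  have DJ: "DN (J d)" "J d \<subseteq> Mn p" for d
    using N_fiber_dim(1)[OF S N.D_Mn order_refl] by (auto simp: J_def)
  have "{t \<in> Mn p. \<not> small b (fiber S t)} = (\<Union>d\<in>{b..n}. J d)"
    unfolding J_def using fiber_dim_le[OF S] not_small_iff_dim[OF N_fiber[OF S]] by fastforce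
  then obtain d where d: "b \<le> d" "\<not> small a (J d)"
    using I small_Union_finite[of "{b..n}" J p a] DJ by auto
  then obtain e where e: "a \<le> e" "dimf (J d) = ereal (real e)"
    using not_small_iff_dim[OF DJ(1)] by blast
  have "dimf {z \<in> S. take p z \<in> J d} = ereal (real e) + ereal (real d)"
    using N_fiber_dim(2)[OF S DJ] e(2) by (simp add: J_def)
  moreover have "DN {z \<in> S. take p z \<in> J d}"
    by (intro N.D_Collect'[OF S] N.dpred_dmap[OF _ DJ(1)] N.dmap_basic)
  then have "small (a + b) {z \<in> S. take p z \<in> J d}"
    by (intro small_subset[OF sm]) (use S in auto)
  ultimately show False using d(1) e(1) by (simp add: small_def)
qed

text \<open>The hypotheses with \<open>Suc\<close> say that the base has dimension at most
  \<open>a\<close> and the fibres at most \<open>b\<close>. Parameters with fibre dimension below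
  \<open>b\<close> contribute less than \<open>a + b\<close> for that reason, those with fibre
  dimension \<open>b\<close> because they form a set of dimension below \<open>a\<close>.\<close>

lemma fubini_upper:
  assumes S: "DN S" "S \<subseteq> Mn (p + n)"
    and base: "small (Suc a) {t \<in> Mn p. fiber S t \<noteq> {}}"
    and fib: "\<And>t. t \<in> Mn p \<Longrightarrow> small (Suc b) (fiber S t)"
    and I: "small a {t \<in> Mn p. \<not> small b (fiber S t)}"
  shows "small (a + b) S"
proof -
  define J where "J d = {t \<in> Mn p. dimf (fiber S t) = ereal (real d)}" for d
  have DJ: "DN (J d)" "J d \<subseteq> Mn p" for d
    using N_fiber_dim(1)[OF S N.D_Mn order_refl] by (auto simp: J_def)
  have Db: "DN {t \<in> Mn p. fiber S t \<noteq> {}}"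
    using N.dpred_not[OF dpred_fiber_small[OF S, of 0]] small_0_iff[OF N_fiber[OF S]]
    by (simp add: N.dpred_def cong: conj_cong)
  have DI: "DN {t \<in> Mn p. \<not> small b (fiber S t)}"
    using N.dpred_not[OF dpred_fiber_small[OF S]] by (simp add: N.dpred_def)
  have "{z \<in> S. take p z \<in> J d} \<subseteq> Mn (p + n) \<and> DN {z \<in> S. take p z \<in> J d} \<and> small (a + b) {z \<in> S. take p z \<in> J d}"
    if d: "d \<le> b" for d
  proof (intro conjI)
    show "{z \<in> S. take p z \<in> J d} \<subseteq> Mn (p + n)" using S by blast
    show "DN {z \<in> S. take p z \<in> J d}"
      by (intro N.D_Collect'[OF S] N.dpred_dmap[OF _ DJ(1)] N.dmap_basic)
    have eq: "dimf {z \<in> S. take p z \<in> J d} = dimf (J d) + ereal (real d)"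
      using N_fiber_dim(2)[OF S DJ] by (simp add: J_def)
    have sd: "small (if d = b then a else Suc a) (J d)"
    proof (cases "d = b")
      case True
      have "J d \<subseteq> {t \<in> Mn p. \<not> small b (fiber S t)}" using True by (auto simp: J_def small_def)
      then show ?thesis using True small_subset[OF I DJ(1) DI, of d p] by auto
    next
      case False
      have "J d \<subseteq> {t \<in> Mn p. fiber S t \<noteq> {}}" using small_empty[of 0] by (auto simp: J_def small_def)
      then show ?thesis using False small_subset[OF base DJ(1) Db, of d p] by auto
    qed
    show "small (a + b) {z \<in> S. take p z \<in> J d}"
      using sd d dim_values[OF DJ(1), of d] unfolding small_def eq by (auto split: if_splits)
  qed
  then have "small (a + b) (\<Union>d\<in>{..b}. {z \<in> S. take p z \<in> J d})"
    by (intro small_Union_finite[where n = "p + n"]) auto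
  moreover have "S \<subseteq> (\<Union>d\<in>{..b}. {z \<in> S. take p z \<in> J d})"
  proof
    fix z assume z: "z \<in> S"
    then have t: "take p z \<in> Mn p" and ne: "fiber S (take p z) \<noteq> {}" using S(2)
      by (auto simp: Mn_def fiber_def intro!: exI[of _ "drop p z"])
    then obtain d where d: "dimf (fiber S (take p z)) = ereal (real d)"
      using dim_values[OF N_fiber[OF S t]] dim_empty_iff[OF N_fiber[OF S t]] by blast
    then have "d \<le> b" using fib[OF t] by (simp add: small_def)
    then show "z \<in> (\<Union>d\<in>{..b}. {z \<in> S. take p z \<in> J d})" using z d t by (auto simp: J_def)
  qed
  then have "S = (\<Union>d\<in>{..b}. {z \<in> S. take p z \<in> J d})" by blast
  ultimately show ?thesis by simp
qed

lemma small_inj: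
  assumes "DN X" "X \<subseteq> Mn n" "N.dmap n f" "inj_on f X" "f ` X \<subseteq> Y" "small d Y" "DN Y" "Y \<subseteq> Mn m"
  shows "small d X"
proof -
  have "dimf X = dimf (f ` X)"
    by (rule dim_bij[of X "f ` X" n m f]) (use assms N.D_image N.D_graph in \<open>auto simp: bij_betw_def\<close>)
  moreover have "small d (f ` X)"
    by (rule small_subset[of d Y _ m]) (use assms N.D_image in auto)
  ultimately show ?thesis by (simp add: small_def)
qed

lemma small_singleton: "small 1 {x}"
proof -
  have "dimf {x} = dimf {[a]}" for a :: 'm
    by (rule dim_bij[of "{x}" "{[a]}" "length x" 1 "\<lambda>x. [a]"])
      (auto simp: Mn_def bij_betw_def intro: N.D_singleton)
  then show ?thesis by (simp add: small_def dim_point)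
qed

lemma small_finite: "finite X \<Longrightarrow> X \<subseteq> Mn n \<Longrightarrow> small 1 X"
  using small_Union_finite[of X "\<lambda>x. {x}" n 1] N.D_singleton small_singleton by auto

text \<open>A box in the product splits into a box of parameters and a box of points, so one and the
  same box of points lies in the fibres over a whole box of parameters.\<close>

lemma box_in_product:
  assumes S: "DL S" "S \<subseteq> Mn (p + n)" and I: "\<not> small p {t \<in> Mn p. \<not> small n (fiber S t)}"
  shows "\<exists>a\<in>Mn p. \<exists>b\<in>Mn p. \<exists>c\<in>Mn n. \<exists>d\<in>Mn n. box p a b \<noteq> {} \<and> box n c d \<noteq> {} \<and>
    (\<forall>t\<in>box p a b. \<forall>x\<in>box n c d. t @ x \<in> S)"
proof -
  have "\<not> small (p + n) S" using fubini_lower[OF DL_DN[OF S(1)] S(2) I] .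
  then have "nonempty_interior (p + n) S" using small_full_iff[OF S] by simp
  then obtain u v where u: "u \<in> Mn (p + n)" "v \<in> Mn (p + n)" "box (p + n) u v \<noteq> {}" "box (p + n) u v \<subseteq> S"
    unfolding nonempty_interior_iff by blast
  have app: "t @ x \<in> box (p + n) u v" if "t \<in> box p (take p u) (take p v)" "x \<in> box n (drop p u) (drop p v)" for t x
    using that u(1,2) by (auto simp: box_def Mn_def nth_append) (metis add_diff_inverse_nat nat_add_left_cancel_less)+
  show ?thesis
    apply (rule bexI[of _ "take p u"], rule bexI[of _ "take p v"], rule bexI[of _ "drop p u"], rule bexI[of _ "drop p v"])
    using u app by (auto simp: box_nonempty_iff Mn_def subset_iff)
qed

end

section \<open>Neighbourhoods and one-variable o-minimality\<close>

text \<open>A neighbourhood quantifier in first-order form: it ranges over corners of boxes, so by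
  \<open>dpred_near\<close> it preserves definability in either structure.\<close>

definition near :: "nat \<Rightarrow> ('m::linorder) list \<Rightarrow> ('m list \<Rightarrow> bool) \<Rightarrow> bool" where
  "near n t P \<longleftrightarrow> (\<exists>a\<in>Mn n. \<exists>b\<in>Mn n. t \<in> box n a b \<and> (\<forall>t'\<in>Mn n. t' \<in> box n a b \<longrightarrow> P t'))"

lemma near_self: "near n t P \<Longrightarrow> P t"
  unfolding near_def using box_sub_Mn by blast

lemma near_mono: "near n t P \<Longrightarrow> (\<And>t'. t' \<in> Mn n \<Longrightarrow> P t' \<Longrightarrow> Q t') \<Longrightarrow> near n t Q"
  unfolding near_def by blast

lemma near_conj:
  assumes "near n t P" "near n t Q" shows "near n t (\<lambda>t'. P t' \<and> Q t')"
proof -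
  obtain a b where ab: "a \<in> Mn n" "b \<in> Mn n" "t \<in> box n a b" "\<And>t'. t' \<in> box n a b \<Longrightarrow> P t'"
    using assms(1) box_sub_Mn unfolding near_def by blast
  obtain c d where cd: "c \<in> Mn n" "d \<in> Mn n" "t \<in> box n c d" "\<And>t'. t' \<in> box n c d \<Longrightarrow> Q t'"
    using assms(2) box_sub_Mn unfolding near_def by blast
  have "box n (map (\<lambda>i. max (a ! i) (c ! i)) [0..<n]) (map (\<lambda>i. min (b ! i) (d ! i)) [0..<n]) = box n a b \<inter> box n c d"
    by (auto simp: box_def)
  then show ?thesis unfolding near_def using ab cd
    by (intro bexI[of _ "map (\<lambda>i. max (a ! i) (c ! i)) [0..<n]"] bexI[of _ "map (\<lambda>i. min (b ! i) (d ! i)) [0..<n]"])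
      (auto simp: Mn_def)
qed

lemma near_True:
  fixes t :: "('m::{no_top, no_bot, linorder}) list"
  assumes "t \<in> Mn n" shows "near n t (\<lambda>_. True)"
proof -
  have "\<exists>l. \<forall>i. l i < t ! i" "\<exists>u. \<forall>i. t ! i < u i"
    by (rule choice, use lt_ex in blast) (rule choice, use gt_ex in blast)
  then obtain l u where "\<forall>i. l i < t ! i" "\<forall>i. t ! i < u i" by blast
  then show ?thesis unfolding near_def using assms
    by (intro bexI[of _ "map l [0..<n]"] bexI[of _ "map u [0..<n]"]) (auto simp: Mn_def box_def)
qed

lemma near_ball_finite:
  fixes t :: "('m::{no_top, no_bot, linorder}) list"
  assumes "finite I" "t \<in> Mn n" "\<And>i. i \<in> I \<Longrightarrow> near n t (P i)"
  shows "near n t (\<lambda>t'. \<forall>i\<in>I. P i t')"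
  using assms(1,3)
proof (induction I rule: finite_induct)
  case empty then show ?case using near_True[OF assms(2)] by simp
next
  case (insert i I)
  then have "near n t (\<lambda>t'. P i t' \<and> (\<forall>i\<in>I. P i t'))" by (intro near_conj) auto
  then show ?case by simp
qed

lemma near_in_box: "a \<in> Mn n \<Longrightarrow> b \<in> Mn n \<Longrightarrow> t \<in> box n a b \<Longrightarrow> near n t (\<lambda>t'. t' \<in> box n a b)"
  unfolding near_def by blast

lemma near_obtain_box:
  assumes "near n t P"
  obtains a b where "a \<in> Mn n" "b \<in> Mn n" "t \<in> box n a b" "\<And>t'. t' \<in> box n a b \<Longrightarrow> P t'"
  using assms box_sub_Mn unfolding near_def by blast

lemma open_n_near: "open_n n U \<longleftrightarrow> U \<subseteq> Mn n \<and> (\<forall>t\<in>U. near n t (\<lambda>t'. t' \<in> U))"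
proof -
  have "(\<exists>a b. length a = n \<and> length b = n \<and> x \<in> box n a b \<and> box n a b \<subseteq> U) \<longleftrightarrow> near n x (\<lambda>t'. t' \<in> U)" for x
  proof -
    have "box n a b \<subseteq> U \<longleftrightarrow> (\<forall>t'\<in>Mn n. t' \<in> box n a b \<longrightarrow> t' \<in> U)" for a b
      using box_sub_Mn[of n a b] by blast
    then show ?thesis unfolding near_def Mn_def by auto
  qed
  then show ?thesis unfolding open_n_def by simp
qed

context def_structure begin

lemma dpred_near:
  assumes P: "dpred (q + n) (\<lambda>z. P (take q z) (drop q z))" and f: "dmap q f"
  shows "dpred q (\<lambda>x. near n (f x) (P x))"
  unfolding near_def
  by (intro dpred_quant dpred_logic dpred_atoms dmap_comp[OF f] dmap_basic dpred_comp2[OF P]) (auto simp: Mn_def)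

lemma dpred_scalar_comp:
  assumes P: "dpred (Suc p) (\<lambda>z. P (take p z) (z ! p))" and fg: "dmap q f" "dmap q (\<lambda>x. [g x])"
    and f: "\<And>x. x \<in> Mn q \<Longrightarrow> f x \<in> Mn p"
  shows "dpred q (\<lambda>x. P (f x) (g x))"
proof (rule dpred_congI)
  show "dpred q (\<lambda>x. P (take p (f x @ [g x])) ((f x @ [g x]) ! p))"
    by (rule dpred_comp[OF P dmap_append[OF fg]]) (use f in \<open>auto simp: Mn_def\<close>)
qed (use f in \<open>auto simp: Mn_def nth_append\<close>)

lemma dpred_scalar1: "dpred 1 (\<lambda>z. P (z ! 0)) \<Longrightarrow> dmap q (\<lambda>x. [g x]) \<Longrightarrow> dpred q (\<lambda>x. P (g x))"
  using dpred_comp[of 1 "\<lambda>z. P (z ! 0)" q "\<lambda>x. [g x]"] by (simp add: Mn_def)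

end

context tame_pair begin

section \<open>O-minimality in one variable: finite sets, suprema, boundary points\<close>

lemma o_minimal_decomp:
  assumes "L.dpred 1 (\<lambda>z. P (z ! 0))"
  shows "\<exists>Q F. finite Q \<and> finite F \<and> (\<forall>I\<in>F. is_interval I) \<and> {v. P v} = Q \<union> \<Union>F"
proof -
  have "DL {z \<in> Mn 1. P (z ! 0)}" using assms by (simp add: L.dpred_def)
  moreover have "{z \<in> Mn 1. P (z ! 0)} \<subseteq> Mn 1" by blast
  ultimately obtain Q F where QF: "finite Q" "finite F" "\<forall>I\<in>F. is_interval I" "{z \<in> Mn 1. P (z ! 0)} = (\<lambda>x. [x]) ` (Q \<union> \<Union>F)"
    using omin unfolding o_minimal_def by meson
  have "P v \<longleftrightarrow> [v] \<in> {z \<in> Mn 1. P (z ! 0)}" for v by (simp add: Mn_def)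
  then have "{v. P v} = Q \<union> \<Union>F" unfolding QF(4) by auto
  then show ?thesis using QF by blast
qed

lemma interval_sub:
  fixes I :: "'m set"
  assumes "is_interval I" "x \<in> I" shows "\<exists>c d. c < d \<and> (\<forall>v. c < v \<and> v < d \<longrightarrow> v \<in> I)"
proof -
  obtain y z where yz: "y < x" "x < z" using lt_ex gt_ex by blast
  consider a b where "I = {a<..<b}" | a where "I = {a<..}" | b where "I = {..<b}" | "I = UNIV"
    using assms(1) by (auto simp: is_interval_def)
  then show ?thesis
  proof cases
    case 1 then show ?thesis using assms(2) by (intro exI[of _ a] exI[of _ b]) auto
  next
    case 2 then show ?thesis using assms(2) yz by (intro exI[of _ x] exI[of _ z]) auto
  next
    case 3 then show ?thesis using assms(2) yz by (intro exI[of _ y] exI[of _ x]) auto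
  next
    case 4 then show ?thesis using assms(2) yz by (intro exI[of _ y] exI[of _ x]) auto
  qed
qed

lemma infinite_has_interval:
  assumes "L.dpred 1 (\<lambda>z. P (z ! 0))" "infinite {v. P v}"
  shows "\<exists>c d. c < d \<and> (\<forall>v. c < v \<and> v < d \<longrightarrow> P v)"
proof -
  obtain Q F where QF: "finite Q" "finite F" "\<forall>I\<in>F. is_interval I" "{v. P v} = Q \<union> \<Union>F"
    using o_minimal_decomp[OF assms(1)] by blast
  then have "\<Union>F \<noteq> {}" using assms(2) by (metis sup_bot_right)
  then obtain I x where I: "I \<in> F" "x \<in> I" by blast
  then obtain c d where "c < d" "\<forall>v. c < v \<and> v < d \<longrightarrow> v \<in> I" using interval_sub QF(3) by blast
  moreover have "I \<subseteq> {v. P v}" using I QF(4) by blast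
  ultimately show ?thesis by blast
qed

lemma infinite_interval: "(c::'m) < d \<Longrightarrow> infinite {v. c < v \<and> v < d}"
  using infinite_Ioo[of c d] by (simp add: greaterThanLessThan_def greaterThan_def lessThan_def Int_def)

lemma box_1: "box (Suc 0) [c] [d] = (\<lambda>v. [v]) ` {v. c < v \<and> v < d}"
  unfolding box_def by (auto simp: L.Mn_1)

lemma small_1_iff:
  assumes "L.dpred 1 (\<lambda>z. P (z ! 0))"
  shows "small 1 {z \<in> Mn 1. P (z ! 0)} \<longleftrightarrow> finite {v. P v}"
proof -
  have e: "{z \<in> Mn 1. P (z ! 0)} = (\<lambda>v. [v]) ` {v. P v}" by (auto simp: L.Mn_1)
  show ?thesis
  proof
    assume "finite {v. P v}"
    then show "small 1 {z \<in> Mn 1. P (z ! 0)}" unfolding e by (intro small_finite[where n=1]) (auto simp: Mn_def)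
  next
    assume s: "small 1 {z \<in> Mn 1. P (z ! 0)}"
    show "finite {v. P v}"
    proof (rule ccontr)
      assume "infinite {v. P v}"
      then obtain c d where cd: "c < d" "\<forall>v. c < v \<and> v < d \<longrightarrow> P v" using infinite_has_interval[OF assms] by blast
      have "nonempty_interior 1 {z \<in> Mn 1. P (z ! 0)}"
        unfolding nonempty_interior_iff e
        by (rule bexI[of _ "[c]"], rule bexI[of _ "[d]"]) (use cd dense[OF cd(1)] in \<open>auto simp: box_1 Mn_def\<close>)
      then show False using s small_full_iff[of "{z \<in> Mn 1. P (z ! 0)}" 1] assms by (auto simp: L.dpred_def)
    qed
  qed
qed

text \<open>The order of \<open>M\<close> need not be complete, but a definable initial segment
  bounded above is a finite union of points and intervals. The largest of these points and right
  endpoints serves as its supremum.\<close>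

lemma initial_segment_sup:
  assumes C: "L.dpred 1 (\<lambda>z. C (z ! 0))" and down: "\<And>c c'. C c \<Longrightarrow> c' < c \<Longrightarrow> C c'"
    and ne: "C x" and u: "\<not> C u"
  shows "\<exists>s. (\<forall>c<s. C c) \<and> (\<forall>c>s. \<not> C c)"
proof -
  obtain Q F where QF: "finite Q" "finite F" "\<forall>I\<in>F. is_interval I" "{v. C v} = Q \<union> \<Union>F"
    using o_minimal_decomp[OF C] by blast
  have bd: "v < u" if "C v" for v using that u down by (metis linorder_neqE)
  have "\<exists>e. I \<noteq> {} \<longrightarrow> (\<forall>v\<in>I. v \<le> e) \<and> (\<forall>c<e. C c)" if I: "I \<in> F" for I
  proof (cases "I = {}")
    case False
    then obtain y where y: "y \<in> I" by blast
    have IC: "\<And>v. v \<in> I \<Longrightarrow> C v" using I QF(4) by blast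
    \<comment> \<open>Beyond the bound \<open>u\<close>, hence outside \<open>I\<close>; this
      excludes intervals that are unbounded above.\<close>
    obtain z where z: "max u y < z" using gt_ex by blast
    have zI: "z \<notin> I" using bd[OF IC, of z] z by auto
    consider a b where "I = {a<..<b}" | a where "I = {a<..}" | b where "I = {..<b}" | "I = UNIV"
      using QF(3) I by (auto simp: is_interval_def)
    then show ?thesis
    proof cases
      case 1
      have "C c" if "c < b" for c
      proof -
        have "max c a < b" using 1 y that by auto
        then obtain w where "max c a < w" "w < b" using dense by blast
        then show ?thesis using 1 IC[of w] down by auto
      qed
      then show ?thesis using 1 by (intro exI[of _ b]) auto
    next
      case 2 then show ?thesis using y z zI by auto
    next
      case 3 then show ?thesis using IC by (intro exI[of _ b]) auto
    next
      case 4 then show ?thesis using zI by simp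
    qed
  qed auto
  then obtain e where e: "\<And>I. I \<in> F \<Longrightarrow> I \<noteq> {} \<Longrightarrow> (\<forall>v\<in>I. v \<le> e I) \<and> (\<forall>c<e I. C c)" by metis
  define E where "E = Q \<union> e ` {I \<in> F. I \<noteq> {}}"
  have fE: "finite E" using QF by (auto simp: E_def)
  have i: "\<exists>w\<in>E. v \<le> w" if "C v" for v
  proof -
    have "v \<in> Q \<union> \<Union>F" using that QF(4) by blast
    then show ?thesis using e unfolding E_def by blast
  qed
  have ii: "C c" if "w \<in> E" "c < w" for w c
  proof -
    have "w \<in> Q \<Longrightarrow> C w" using QF(4) by blast
    then show ?thesis using that e down unfolding E_def by blast
  qed
  have "E \<noteq> {}" using i[OF ne] by blast
  then have "Max E \<in> E" using fE by simp
  then have "\<forall>c<Max E. C c" using ii by blast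
  moreover have "\<not> C c" if "c > Max E" for c
    using i[of c] that fE by (meson Max_ge leD order_trans)
  ultimately show ?thesis by blast
qed

definition bdry :: "('m \<Rightarrow> bool) \<Rightarrow> 'm \<Rightarrow> bool" where
  "bdry P v \<longleftrightarrow> (\<forall>c d. c < v \<and> v < d \<longrightarrow> (\<exists>x. c < x \<and> x < d \<and> P x) \<and> (\<exists>x. c < x \<and> x < d \<and> \<not> P x))"

lemma L_dpred_bdry:
  assumes P: "L.dpred (Suc p) (\<lambda>z. P (take p z) (z ! p))"
  shows "L.dpred (Suc p) (\<lambda>z. bdry (P (take p z)) (z ! p))"
  unfolding bdry_def
  by (intro L.dpred_quant L.dpred_logic L.dpred_atoms L.dmap_basic L.dpred_scalar_comp[OF P]) (auto simp: Mn_def)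

lemma L_dpred_bdry1:
  assumes P: "L.dpred 1 (\<lambda>z. P (z ! 0))"
  shows "L.dpred 1 (\<lambda>z. bdry P (z ! 0))"
  using L_dpred_bdry[of 0 "\<lambda>_. P"] assms by simp

text \<open>An infinite definable set of boundary points contains an interval. Inside it
  \<open>P\<close> or its negation holds infinitely often, hence on a subinterval, whose points are
  not boundary points.\<close>

lemma bdry_finite:
  assumes P: "L.dpred 1 (\<lambda>z. P (z ! 0))"
  shows "finite {v. bdry P v}"
proof (rule ccontr)
  assume "infinite {v. bdry P v}"
  then obtain c d where cd: "c < d" "\<And>v. c < v \<Longrightarrow> v < d \<Longrightarrow> bdry P v"
    using infinite_has_interval[OF L_dpred_bdry1[OF P]] by blast
  have e: "{v. c < v \<and> v < d} = {v. c < v \<and> v < d \<and> P v} \<union> {v. c < v \<and> v < d \<and> \<not> P v}" by blast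
  have "infinite {v. c < v \<and> v < d \<and> P v} \<or> infinite {v. c < v \<and> v < d \<and> \<not> P v}"
    using infinite_interval[OF cd(1)] unfolding e finite_Un by blast
  moreover have "L.dpred 1 (\<lambda>z. c < z ! 0 \<and> z ! 0 < d \<and> P (z ! 0))" "L.dpred 1 (\<lambda>z. c < z ! 0 \<and> z ! 0 < d \<and> \<not> P (z ! 0))"
    by (intro L.dpred_logic L.dpred_atoms L.dmap_basic P)+
  ultimately consider a b where "a < b" "\<And>v. a < v \<Longrightarrow> v < b \<Longrightarrow> c < v \<and> v < d \<and> P v"
    | a b where "a < b" "\<And>v. a < v \<Longrightarrow> v < b \<Longrightarrow> c < v \<and> v < d \<and> \<not> P v"
    using infinite_has_interval[of "\<lambda>v. c < v \<and> v < d \<and> P v"] infinite_has_interval[of "\<lambda>v. c < v \<and> v < d \<and> \<not> P v"] by blast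
  then show False
  proof cases
    case 1
    then obtain v where v: "a < v" "v < b" using dense by blast
    then have "bdry P v" using 1 cd by blast
    then show False using 1 v unfolding bdry_def by blast
  next
    case 2
    then obtain v where v: "a < v" "v < b" using dense by blast
    then have "bdry P v" using 2 cd by blast
    then show False using 2 v unfolding bdry_def by blast
  qed
qed

lemma bdry_neg: "bdry (\<lambda>v. \<not> P v) = bdry P"
  unfolding bdry_def by auto

text \<open>A definable form of connectedness of intervals: the boundary point is the supremum of
  the initial stretch from \<open>x\<close> on which \<open>P\<close> holds throughout.\<close>

lemma bdry_between_aux:
  assumes P: "L.dpred 1 (\<lambda>z. P (z ! 0))" and xy: "x < y" "P x" "\<not> P y"
  shows "\<exists>b. x \<le> b \<and> b \<le> y \<and> bdry P b"
proof -
  define C where "C c \<longleftrightarrow> (\<forall>z. x \<le> z \<and> z \<le> c \<longrightarrow> P z)" for c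
  have "L.dpred 1 (\<lambda>z. C (z ! 0))" unfolding C_def
    by (intro L.dpred_quant L.dpred_logic L.dpred_atoms L.dmap_basic L.dpred_scalar1[OF P])
  moreover have "C x" using xy by (auto simp: C_def)
  moreover have "\<not> C y" using xy by (auto simp: C_def intro!: exI[of _ y])
  moreover have "C c'" if "C c" "c' < c" for c c' using that by (auto simp: C_def)
  ultimately obtain s where s: "\<And>c. c < s \<Longrightarrow> C c" "\<And>c. c > s \<Longrightarrow> \<not> C c"
    using initial_segment_sup[of C x y] by blast
  have xs: "x \<le> s" using s(2)[of x] \<open>C x\<close> by (meson not_le)
  have sy: "s \<le> y" using s(1)[of y] \<open>\<not> C y\<close> by (meson not_le)
  have "bdry P s" unfolding bdry_def
  proof (intro allI impI)
    fix c d assume cd: "c < s \<and> s < d"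
    have "\<exists>w. c < w \<and> w < d \<and> P w"
    proof (cases "x = s")
      case True then show ?thesis using cd xy by blast
    next
      case False
      then have "max c x < s" using cd xs by auto
      then obtain w where w: "max c x < w" "w < s" using dense by blast
      then have "P w" using s(1)[of w] by (auto simp: C_def)
      then show ?thesis using w cd by (meson less_trans max_less_iff_conj)
    qed
    moreover have "\<exists>w. c < w \<and> w < d \<and> \<not> P w"
    proof -
      obtain e where e: "s < e" "e < d" using cd dense by blast
      then obtain z where z: "x \<le> z" "z \<le> e" "\<not> P z" using s(2)[of e] by (auto simp: C_def)
      have "s \<le> z"
      proof (rule ccontr)
        assume "\<not> s \<le> z"
        then have "C z" using s(1) by simp
        then show False using z by (auto simp: C_def)
      qed
      then show ?thesis using z e cd by (meson le_less_trans less_le_trans)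
    qed
    ultimately show "(\<exists>x>c. x < d \<and> P x) \<and> (\<exists>x>c. x < d \<and> \<not> P x)" by blast
  qed
  then show ?thesis using xs sy by blast
qed

lemma bdry_between:
  assumes P: "L.dpred 1 (\<lambda>z. P (z ! 0))" and xy: "x < y" "P x \<noteq> P y"
  shows "\<exists>b. x \<le> b \<and> b \<le> y \<and> bdry P b"
proof (cases "P x")
  case True then show ?thesis using bdry_between_aux[OF P xy(1)] xy by blast
next
  case False
  have "L.dpred 1 (\<lambda>z. \<not> P (z ! 0))" using P by (rule L.dpred_not)
  from bdry_between_aux[OF this xy(1)] show ?thesis using False xy by (simp add: bdry_neg)
qed

lemma L_fiber1:
  assumes P: "L.dpred (Suc p) (\<lambda>z. P (take p z) (z ! p))" and t: "t \<in> Mn p"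
  shows "L.dpred 1 (\<lambda>z. P t (z ! 0))"
  by (rule L.dpred_scalar_comp[OF P, of 1 "\<lambda>_. t" "\<lambda>z. z ! 0"]) (use t in \<open>auto intro!: L.dmap_basic\<close>)

text \<open>Finiteness is not a first-order condition in general. Here it agrees with
  \<open>small 1\<close>, since an infinite definable set of scalars contains an interval.\<close>

lemma L_dpred_finite:
  assumes P: "L.dpred (Suc p) (\<lambda>z. P (take p z) (z ! p))"
  shows "L.dpred p (\<lambda>t. finite {v. P t v})"
proof -
  have "L.dpred (p + 1) (\<lambda>z. P (take p z) (drop p z ! 0))"
    using P by (rule_tac L.dpred_congI[where Q = "\<lambda>z. P (take p z) (z ! p)"]) (auto simp: Mn_def)
  from L_dpred_small[OF this, of 1] show ?thesis
    by (rule L.dpred_congI) (use small_1_iff[OF L_fiber1[OF P]] in simp)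
qed

text \<open>A box inside the exceptional set would itself be a neighbourhood witnessing the contrary.\<close>

lemma generic_near:
  assumes W: "L.dpred (k + j) (\<lambda>z. W (take k z) (drop k z))"
  shows "small k {t \<in> Mn k. \<not> small j {x \<in> Mn j. W t x \<and> \<not> near k t (\<lambda>t'. W t' x)}}"
proof (rule ccontr)
  assume ns: "\<not> ?thesis"
  define S where "S = {z \<in> Mn (k + j). W (take k z) (drop k z) \<and> \<not> near k (take k z) (\<lambda>t'. W t' (drop k z))}"
  have "L.dpred (k + j) (\<lambda>z. W (take k z) (drop k z) \<and> \<not> near k (take k z) (\<lambda>t'. W t' (drop k z)))"
    by (intro L.dpred_logic W L.dpred_near L.dpred_comp2[OF W] L.dmap_basic) (auto simp: Mn_def)
  then have S: "DL S" "S \<subseteq> Mn (k + j)" by (auto simp: S_def L.dpred_def)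
  have "fiber S t = {x \<in> Mn j. W t x \<and> \<not> near k t (\<lambda>t'. W t' x)}" if "t \<in> Mn k" for t
    unfolding S_def using fiber_Collect[OF that, of j "\<lambda>t x. W t x \<and> \<not> near k t (\<lambda>t'. W t' x)"] .
  then have "{t \<in> Mn k. \<not> small j (fiber S t)} = {t \<in> Mn k. \<not> small j {x \<in> Mn j. W t x \<and> \<not> near k t (\<lambda>t'. W t' x)}}" by auto
  then obtain a b c d where B: "a\<in>Mn k" "b\<in>Mn k" "box k a b \<noteq> {}" "box j c d \<noteq> {}"
    "\<And>t x. t\<in>box k a b \<Longrightarrow> x\<in>box j c d \<Longrightarrow> t @ x \<in> S"
    using box_in_product[OF S] ns by metis
  then obtain t x where tx: "t \<in> box k a b" "x \<in> box j c d" by blast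
  have h: "W t' x \<and> \<not> near k t' (\<lambda>t'. W t' x)" if "t' \<in> box k a b" for t'
    using B(5)[OF that tx(2)] that by (auto simp: S_def box_def Mn_def)
  have "near k t (\<lambda>t'. W t' x)"
    using near_in_box[OF B(1,2) tx(1)] by (rule near_mono) (use h in blast)
  then show False using h[OF tx(1)] by blast
qed

lemma nonsmall_box: "a \<in> Mn n \<Longrightarrow> b \<in> Mn n \<Longrightarrow> box n a b \<noteq> {} \<Longrightarrow> \<not> small n (box n a b)"
proof -
  assume ab: "a \<in> Mn n" "b \<in> Mn n" "box n a b \<noteq> {}"
  have "L.dpred n (\<lambda>x. x \<in> box n a b)" by (intro L.dpred_atoms L.dmap_basic)
  then have "DL (box n a b)" by (rule L.D_Collect[of _ "\<lambda>x. x \<in> box n a b", simplified]) (auto simp: box_def)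
  then show ?thesis using ab small_full_iff[OF _ box_sub_Mn] unfolding nonempty_interior_iff by blast
qed

end

section \<open>Families of finite sets\<close>

lemma near_prod:
  assumes "near k t (\<lambda>t'. \<forall>v. c < v \<and> v < d \<longrightarrow> P (t' @ [v]))" "c < v" "v < d"
  shows "near (Suc k) (t @ [v]) P"
proof -
  obtain a b where ab: "a \<in> Mn k" "b \<in> Mn k" "t \<in> box k a b" "\<And>t' v. t' \<in> box k a b \<Longrightarrow> c < v \<Longrightarrow> v < d \<Longrightarrow> P (t' @ [v])"
    using near_obtain_box[OF assms(1)] by metis
  have "P z" if "z \<in> Mn (Suc k)" "z \<in> box (Suc k) (a @ [c]) (b @ [d])" for z
  proof -
    have z: "z = take k z @ [z ! k]" using that(1) take_Suc_conv_app_nth[of k z] by (simp add: Mn_def)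
    have "take k z \<in> box k a b" using that ab(1,2) by (auto simp: box_def Mn_def nth_append less_Suc_eq)
    moreover have "c < z ! k" "z ! k < d" using that ab(1,2) by (auto simp: box_def Mn_def nth_append)
    ultimately show ?thesis using ab(4) z by metis
  qed
  moreover have "t @ [v] \<in> box (Suc k) (a @ [c]) (b @ [d])"
    using ab assms by (auto simp: box_def Mn_def nth_append)
  ultimately show ?thesis unfolding near_def using ab(1,2)
    by (intro bexI[of _ "a @ [c]"] bexI[of _ "b @ [d]"]) (auto simp: Mn_def)
qed

lemma near_split:
  assumes "near (Suc k) z P" "z \<in> Mn (Suc k)"
  shows "\<exists>c d. c < z ! k \<and> z ! k < d \<and> near k (take k z) (\<lambda>t'. \<forall>v. c < v \<and> v < d \<longrightarrow> P (t' @ [v]))"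
proof -
  obtain a b where ab: "a \<in> Mn (Suc k)" "b \<in> Mn (Suc k)" "z \<in> box (Suc k) a b" "\<And>t'. t' \<in> box (Suc k) a b \<Longrightarrow> P t'"
    using near_obtain_box[OF assms(1)] by metis
  have "near k (take k z) (\<lambda>t'. t' \<in> box k (take k a) (take k b))"
    by (rule near_in_box) (use ab assms(2) in \<open>auto simp: box_def Mn_def\<close>)
  then have "near k (take k z) (\<lambda>t'. \<forall>v. a ! k < v \<and> v < b ! k \<longrightarrow> P (t' @ [v]))"
    by (rule near_mono) (use ab in \<open>auto simp: box_def Mn_def nth_append less_Suc_eq\<close>)
  then show ?thesis using ab(3) by (intro exI[of _ "a ! k"] exI[of _ "b ! k"]) (auto simp: box_def)
qed

text \<open>For each pair \<open>b < b'\<close> a separating point \<open>m (b, b')\<close> is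
  chosen; the interval of \<open>b\<close> ends no later, and that of \<open>b'\<close> begins no
  earlier. The resulting intervals are disjoint and will isolate the branches of a finite
  family.\<close>

lemma finite_gaps:
  fixes B :: "('m::{dense_linorder, no_top, no_bot}) set"
  assumes "finite B"
  shows "\<exists>c d. (\<forall>b\<in>B. c b < b \<and> b < d b) \<and> (\<forall>b\<in>B. \<forall>b'\<in>B. b < b' \<longrightarrow> d b \<le> c b')"
proof -
  have "\<exists>m. \<forall>p::'m\<times>'m. fst p < snd p \<longrightarrow> fst p < m p \<and> m p < snd p"
    by (rule choice) (use dense in blast)
  then obtain m where m0: "\<forall>p::'m\<times>'m. fst p < snd p \<longrightarrow> fst p < m p \<and> m p < snd p" by blast
  have m: "b < m (b, b') \<and> m (b, b') < b'" if "b < b'" for b b'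
    using spec[OF m0, of "(b, b')"] that by simp
  have "\<exists>l. \<forall>b::'m. l b < b" "\<exists>u. \<forall>b::'m. b < u b"
    by (rule choice, use lt_ex in blast) (rule choice, use gt_ex in blast)
  then obtain l u where lu: "\<And>b::'m. l b < b" "\<And>b::'m. b < u b" by blast
  define c where "c b = Max (insert (l b) {m (b', b) | b'. b' \<in> B \<and> b' < b})" for b
  define d where "d b = Min (insert (u b) {m (b, b') | b'. b' \<in> B \<and> b < b'})" for b
  have fin: "finite {m (b', b) | b'. b' \<in> B \<and> b' < b}" "finite {m (b, b') | b'. b' \<in> B \<and> b < b'}" for b
    using assms by simp_all
  have "c b < b" "b < d b" for b
    unfolding c_def d_def using fin[of b] lu[of b] m by auto
  moreover have "d b \<le> c b'" if "b \<in> B" "b' \<in> B" "b < b'" for b b'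
  proof -
    have "d b \<le> m (b, b')" unfolding d_def using fin(2)[of b] that by (intro Min_le) auto
    also have "\<dots> \<le> c b'" unfolding c_def using fin(1)[of b'] that by (intro Max_ge) auto
    finally show ?thesis .
  qed
  ultimately show ?thesis by blast
qed

lemma finite_isolate:
  fixes B :: "('m::linorder) set"
  assumes "finite B" "c0 < b" "b < d0"
  shows "\<exists>c d. c0 \<le> c \<and> c < b \<and> b < d \<and> d \<le> d0 \<and> (\<forall>v\<in>B. c < v \<and> v < d \<longrightarrow> v = b)"
proof -
  define c where "c = Max (insert c0 {v \<in> B. v < b})"
  define d where "d = Min (insert d0 {v \<in> B. b < v})"
  have c: "c0 \<le> c" "c < b" "\<And>v. v \<in> B \<Longrightarrow> v < b \<Longrightarrow> v \<le> c" unfolding c_def using assms by auto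
  have d: "d \<le> d0" "b < d" "\<And>v. v \<in> B \<Longrightarrow> b < v \<Longrightarrow> d \<le> v" unfolding d_def using assms by auto
  have "v = b" if "v \<in> B" "c < v" "v < d" for v
    using c(3)[OF that(1)] d(3)[OF that(1)] that(2,3) by (metis leD linorder_neqE)
  then show ?thesis using c d by blast
qed

text \<open>Cardinalities of fibres are expressed through this recursion because every step of it preserves definability.\<close>

primrec rank_ge :: "('a \<Rightarrow> 'm \<Rightarrow> bool) \<Rightarrow> nat \<Rightarrow> 'a \<Rightarrow> ('m::linorder) \<Rightarrow> bool" where
  "rank_ge A 0 t v = True"
| "rank_ge A (Suc j) t v = (\<exists>w. w < v \<and> A t w \<and> rank_ge A j t w)"

lemma rank_ge_iff:
  assumes fin: "finite {v. A t v}"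
  shows "rank_ge A j t v \<longleftrightarrow> j \<le> card {w. A t w \<and> w < v}"
proof (induction j arbitrary: v)
  case (Suc j)
  have f: "finite {w. A t w \<and> w < v}" for v using fin by (rule rev_finite_subset) auto
  show ?case
  proof
    assume "rank_ge A (Suc j) t v"
    then obtain w where w: "w < v" "A t w" "j \<le> card {x. A t x \<and> x < w}" using Suc by auto
    have "insert w {x. A t x \<and> x < w} \<subseteq> {w. A t w \<and> w < v}" using w by auto
    from card_mono[OF f this] show "Suc j \<le> card {w. A t w \<and> w < v}" using w f by simp
  next
    assume c: "Suc j \<le> card {w. A t w \<and> w < v}"
    define w where "w = Max {w. A t w \<and> w < v}"
    have ne: "{w. A t w \<and> w < v} \<noteq> {}" using c by (metis card.empty not_less_eq_eq zero_le)
    have w: "w \<in> {w. A t w \<and> w < v}" unfolding w_def using Max_in[OF f ne] .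
    have "x \<le> w" if "A t x" "x < v" for x unfolding w_def using that f by (intro Max_ge) auto
    then have "{w. A t w \<and> w < v} = insert w {x. A t x \<and> x < w}" using w by force
    then have "j \<le> card {x. A t x \<and> x < w}" using c f by simp
    then show "rank_ge A (Suc j) t v" using w Suc by auto
  qed
qed simp

lemma card_ge_iff_rank:
  assumes fin: "finite {v. A t v}"
  shows "Suc j \<le> card {v. A t v} \<longleftrightarrow> (\<exists>v. A t v \<and> rank_ge A j t v)"
proof
  assume c: "Suc j \<le> card {v. A t v}"
  define w where "w = Max {v. A t v}"
  have ne: "{v. A t v} \<noteq> {}" using c by (metis card.empty not_less_eq_eq zero_le)
  have w: "A t w" unfolding w_def using Max_in[OF fin ne] by simp
  have "x \<le> w" if "A t x" for x unfolding w_def using that fin by (intro Max_ge) auto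
  then have "{v. A t v} = insert w {x. A t x \<and> x < w}" using w by force
  moreover have "finite {x. A t x \<and> x < w}" using fin by (rule rev_finite_subset) auto
  ultimately have "j \<le> card {x. A t x \<and> x < w}" using c by simp
  then show "\<exists>v. A t v \<and> rank_ge A j t v" using rank_ge_iff[of A t, OF fin] w by blast
next
  assume "\<exists>v. A t v \<and> rank_ge A j t v"
  then obtain v where v: "A t v" "j \<le> card {w. A t w \<and> w < v}" using rank_ge_iff[of A t, OF fin] by blast
  have "finite {x. A t x \<and> x < v}" using fin by (rule rev_finite_subset) auto
  then have "Suc (card {w. A t w \<and> w < v}) = card (insert v {w. A t w \<and> w < v})" by simp
  also have "\<dots> \<le> card {v. A t v}" using v by (intro card_mono[OF fin]) auto
  finally show "Suc j \<le> card {v. A t v}" using v(2) by simp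
qed

section \<open>Local behaviour of a family of finite sets\<close>

definition empty_near :: "nat \<Rightarrow> (('m::linorder) list \<Rightarrow> 'm \<Rightarrow> bool) \<Rightarrow> 'm list \<Rightarrow> 'm \<Rightarrow> bool" where
  "empty_near k A t b \<longleftrightarrow> (\<exists>c d. c < b \<and> b < d \<and> near k t (\<lambda>t'. \<forall>v. c < v \<and> v < d \<longrightarrow> \<not> A t' v))"

text \<open>Near \<open>t\<close> and inside arbitrarily thin strips around \<open>b\<close>, the
  family is the graph of a single function. Letting the strip shrink to \<open>b\<close> builds
  continuity of that function at \<open>t\<close> into the definition.\<close>

definition branch_near :: "nat \<Rightarrow> (('m::linorder) list \<Rightarrow> 'm \<Rightarrow> bool) \<Rightarrow> 'm list \<Rightarrow> 'm \<Rightarrow> bool" where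
  "branch_near k A t b \<longleftrightarrow> (\<forall>c0 d0. c0 < b \<and> b < d0 \<longrightarrow> (\<exists>c d. c0 < c \<and> c < b \<and> b < d \<and> d < d0 \<and>
     near k t (\<lambda>t'. \<exists>v. c < v \<and> v < d \<and> A t' v \<and> (\<forall>w. c < w \<and> w < d \<and> A t' w \<longrightarrow> w = v))))"

definition normal_at :: "nat \<Rightarrow> (('m::linorder) list \<Rightarrow> 'm \<Rightarrow> bool) \<Rightarrow> 'm list \<Rightarrow> 'm \<Rightarrow> bool" where
  "normal_at k A t b \<longleftrightarrow> empty_near k A t b \<or> branch_near k A t b"

text \<open>The two bounds, valid uniformly near \<open>t\<close>, stand in for normality at minus
  and plus infinity: no branch may escape or come in from there.\<close>

definition good_at :: "nat \<Rightarrow> (('m::linorder) list \<Rightarrow> 'm \<Rightarrow> bool) \<Rightarrow> 'm list \<Rightarrow> bool" where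
  "good_at k A t \<longleftrightarrow> (\<forall>b. normal_at k A t b) \<and> (\<exists>c. near k t (\<lambda>t'. \<forall>v. A t' v \<longrightarrow> c < v)) \<and>
     (\<exists>c. near k t (\<lambda>t'. \<forall>v. A t' v \<longrightarrow> v < c))"

context tame_pair begin

text \<open>Fubini over lines: for definable fibres in one variable, non-small means
  infinite.\<close>

lemma small_Suc_iff:
  assumes P: "L.dpred (Suc k) (\<lambda>z. P (take k z) (z ! k))"
  shows "small (Suc k) {z \<in> Mn (Suc k). P (take k z) (z ! k)} \<longleftrightarrow> small k {t \<in> Mn k. infinite {v. P t v}}"
proof -
  define S where "S = {z \<in> Mn (k + 1). P (take k z) (z ! k)}"
  have S: "DN S" "S \<subseteq> Mn (k + 1)" using dpred_LN[OF P] by (auto simp: S_def N.dpred_def)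
  have fib: "fiber S t = {z \<in> Mn 1. P t (z ! 0)}" if "t \<in> Mn k" for t
    using that by (auto simp: S_def fiber_def Mn_def nth_append)
  have "small 1 (fiber S t) \<longleftrightarrow> finite {v. P t v}" if "t \<in> Mn k" for t
    unfolding fib[OF that] by (rule small_1_iff[OF L_fiber1[OF P that]])
  then have e: "{t \<in> Mn k. \<not> small 1 (fiber S t)} = {t \<in> Mn k. infinite {v. P t v}}" by auto
  have Db: "DN {t \<in> Mn k. fiber S t \<noteq> {}}"
    using N.dpred_not[OF dpred_fiber_small[OF S, of 0]] small_0_iff[OF N_fiber[OF S]]
    by (simp add: N.dpred_def cong: conj_cong)
  have "small (k + 1) S \<longleftrightarrow> small k {t \<in> Mn k. \<not> small 1 (fiber S t)}"
  proof
    show "small (k + 1) S \<Longrightarrow> small k {t \<in> Mn k. \<not> small 1 (fiber S t)}"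
      using fubini_lower[OF S, of k 1] by blast
    assume "small k {t \<in> Mn k. \<not> small 1 (fiber S t)}"
    then show "small (k + 1) S"
      using small_Suc_arity[OF Db] small_Suc_arity[OF N_fiber[OF S] fiber_sub_Mn[OF S(2)]]
      by (intro fubini_upper[OF S]) auto
  qed
  then show ?thesis using e by (simp add: S_def)
qed

lemma nonsmall_subset: "\<not> small d X \<Longrightarrow> DN X \<Longrightarrow> DN Y \<Longrightarrow> X \<subseteq> Y \<Longrightarrow> Y \<subseteq> Mn n \<Longrightarrow> \<not> small d Y"
  using small_subset by blast

lemma D_box: "DL (box n a b)"
  using L.D_Collect[of n "\<lambda>x. x \<in> box n a b"] L.dpred_box[OF L.dmap_id L.dmap_const L.dmap_const, of n n a b] box_sub_Mn
  by auto

text \<open>A small exceptional set cannot contain the box of candidates. Applied with interval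
  endpoints as candidates, this yields a concrete interval that keeps its property on a
  neighbourhood of \<open>t\<close>.\<close>

lemma generic_near_point:
  assumes W: "L.dpred (k + j) (\<lambda>z. W (take k z) (drop k z))" and t: "t \<in> Mn k"
    and s: "small j {x \<in> Mn j. W t x \<and> \<not> near k t (\<lambda>t'. W t' x)}"
    and cd: "c \<in> Mn j" "d \<in> Mn j" "box j c d \<noteq> {}" "\<And>x. x \<in> box j c d \<Longrightarrow> W t x"
  shows "\<exists>x\<in>box j c d. near k t (\<lambda>t'. W t' x)"
proof (rule ccontr)
  assume n: "\<not> ?thesis"
  have "L.dpred j (\<lambda>x. W t x \<and> \<not> near k t (\<lambda>t'. W t' x))"
    by (intro L.dpred_logic L.dpred_near L.dpred_comp2[OF W] L.dmap_basic) (use t in \<open>auto simp: Mn_def\<close>)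
  then have D: "DL {x \<in> Mn j. W t x \<and> \<not> near k t (\<lambda>t'. W t' x)}" by (simp add: L.dpred_def)
  have "box j c d \<subseteq> {x \<in> Mn j. W t x \<and> \<not> near k t (\<lambda>t'. W t' x)}" using n cd(4) box_sub_Mn by blast
  from nonsmall_subset[OF nonsmall_box[OF cd(1-3)] DL_DN[OF D_box] DL_DN[OF D] this] s show False by auto
qed

text \<open>The case \<open>j = 0\<close> of \<open>generic_near\<close>: \<open>Mn 0\<close> is a
  single point, and a set that is not \<open>small 0\<close> is nonempty.\<close>

lemma generic_locally_true:
  assumes P: "L.dpred k P"
  shows "small k {t \<in> Mn k. P t \<and> \<not> near k t P}"
proof -
  have W: "L.dpred (k + 0) (\<lambda>z. P (take k z))"
    by (rule L.dpred_congI[where Q = P]) (use P in \<open>auto simp: Mn_def\<close>)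
  have "DN {x \<in> Mn 0. c}" for c using N.dpred_const by (auto simp: N.dpred_def)
  then have "\<not> small 0 {x \<in> Mn 0. P t \<and> \<not> near k t P} \<longleftrightarrow> P t \<and> \<not> near k t P" for t
    using small_0_iff[of "{x \<in> Mn 0. P t \<and> \<not> near k t P}"] by (auto simp: Mn_def)
  with generic_near[of k 0 "\<lambda>t x. P t", OF W] show ?thesis by simp
qed

context
  fixes k :: nat and A :: "'m list \<Rightarrow> 'm \<Rightarrow> bool"
  assumes A: "L.dpred (Suc k) (\<lambda>z. A (take k z) (z ! k))"
    and fin: "\<And>t. t \<in> Mn k \<Longrightarrow> finite {v. A t v}"
begin

lemma L_dpred_normal: "L.dpred (Suc k) (\<lambda>z. normal_at k A (take k z) (z ! k))"
  unfolding normal_at_def empty_near_def branch_near_def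
  by (intro L.dpred_quant L.dpred_logic L.dpred_atoms L.dmap_basic L.dpred_near L.dpred_scalar_comp[OF A]) (auto simp: Mn_def)

lemma L_dpred_good: "L.dpred k (good_at k A)"
  unfolding good_at_def
  by (intro L.dpred_quant L.dpred_logic L.dpred_atoms L.dmap_basic L.dpred_near L.dpred_scalar_comp[OF A] L_dpred_normal) (auto simp: Mn_def)

lemma L_dpred_rank: "L.dpred (Suc k) (\<lambda>z. rank_ge A j (take k z) (z ! k))"
proof (induction j)
  case 0 then show ?case by (simp add: L.dpred_const)
next
  case (Suc j)
  show ?case unfolding rank_ge.simps
    by (intro L.dpred_quant L.dpred_logic L.dpred_atoms L.dmap_basic L.dpred_scalar_comp[OF A] L.dpred_scalar_comp[OF Suc]) (auto simp: Mn_def)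
qed

lemma L_dpred_card_ge: "L.dpred k (\<lambda>t. j \<le> card {v. A t v})"
proof (cases j)
  case 0 then show ?thesis by (simp add: L.dpred_const)
next
  case (Suc i)
  have "L.dpred k (\<lambda>t. \<exists>v. A t v \<and> rank_ge A i t v)"
    by (intro L.dpred_quant L.dpred_logic A L_dpred_rank)
  then show ?thesis unfolding Suc by (rule L.dpred_congI) (rule card_ge_iff_rank[OF fin])
qed

lemma L_dpred_card_eq: "L.dpred k (\<lambda>t. card {v. A t v} = j)"
  by (rule L.dpred_congI[where Q = "\<lambda>t. j \<le> card {v. A t v} \<and> \<not> Suc j \<le> card {v. A t v}"])
    (auto intro!: L.dpred_conj L.dpred_not[OF L_dpred_card_ge] L_dpred_card_ge)

lemma L_dpred_rank_eq: "L.dpred (Suc k) (\<lambda>z. card {w. A (take k z) w \<and> w < z ! k} = j)"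
proof (rule L.dpred_congI)
  show "L.dpred (Suc k) (\<lambda>z. rank_ge A j (take k z) (z ! k) \<and> \<not> rank_ge A (Suc j) (take k z) (z ! k))"
    by (intro L.dpred_logic L_dpred_rank)
  fix z :: "'m list" assume "z \<in> Mn (Suc k)"
  then have "take k z \<in> Mn k" by (simp add: Mn_def)
  then show "(card {w. A (take k z) w \<and> w < z ! k} = j) = (rank_ge A j (take k z) (z ! k) \<and> \<not> rank_ge A (Suc j) (take k z) (z ! k))"
    unfolding rank_ge_iff[of A "take k z", OF fin, OF \<open>take k z \<in> Mn k\<close>] by auto
qed

text \<open>Finite fibres make \<open>A\<close> small. If the non-normal points formed a non-small
  set, removing \<open>A\<close> would leave a set containing a box; but a point of a box disjoint
  from \<open>A\<close> satisfies \<open>empty_near\<close>. Fubini over lines then passes to the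
  fibres.\<close>

lemma nonnormal_fibers: "small k {t \<in> Mn k. infinite {b. \<not> normal_at k A t b}}"
proof -
  have N: "L.dpred (Suc k) (\<lambda>z. \<not> normal_at k A (take k z) (z ! k))" by (intro L.dpred_not L_dpred_normal)
  have "small (Suc k) {z \<in> Mn (Suc k). \<not> normal_at k A (take k z) (z ! k)}"
  proof (rule ccontr)
    assume ns: "\<not> ?thesis"
    have "{t \<in> Mn k. infinite {v. A t v}} = {}" using fin by auto
    then have sA: "small (Suc k) {z \<in> Mn (Suc k). A (take k z) (z ! k)}" unfolding small_Suc_iff[OF A] by (simp only: small_empty)
    have NA: "L.dpred (Suc k) (\<lambda>z. \<not> normal_at k A (take k z) (z ! k) \<and> \<not> A (take k z) (z ! k))"
      by (intro L.dpred_logic N A L_dpred_normal)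
    have "\<not> small (Suc k) {z \<in> Mn (Suc k). \<not> normal_at k A (take k z) (z ! k) \<and> \<not> A (take k z) (z ! k)}"
    proof
      assume "small (Suc k) {z \<in> Mn (Suc k). \<not> normal_at k A (take k z) (z ! k) \<and> \<not> A (take k z) (z ! k)}"
      from small_Collect_disj[OF sA this dpred_LN[OF A] dpred_LN[OF NA]]
      have "small (Suc k) {z \<in> Mn (Suc k). \<not> normal_at k A (take k z) (z ! k)}"
        by (rule small_Collect_mono) (auto intro!: dpred_LN L.dpred_disj A NA N)
      then show False using ns by blast
    qed
    then have "nonempty_interior (Suc k) {z \<in> Mn (Suc k). \<not> normal_at k A (take k z) (z ! k) \<and> \<not> A (take k z) (z ! k)}"
      using small_full_iff NA by (auto simp: L.dpred_def)
    then obtain a b z where B: "a \<in> Mn (Suc k)" "b \<in> Mn (Suc k)" "z \<in> box (Suc k) a b"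
      "box (Suc k) a b \<subseteq> {z \<in> Mn (Suc k). \<not> normal_at k A (take k z) (z ! k) \<and> \<not> A (take k z) (z ! k)}"
      unfolding nonempty_interior_iff by blast
    have z: "z \<in> Mn (Suc k)" using B(3) by (simp add: box_def)
    have "near (Suc k) z (\<lambda>z. \<not> A (take k z) (z ! k))"
      using near_in_box[OF B(1-3)] by (rule near_mono) (use B(4) in blast)
    from near_split[OF this z] obtain c d where cd: "c < z ! k" "z ! k < d"
      "near k (take k z) (\<lambda>t'. \<forall>v. c < v \<and> v < d \<longrightarrow> \<not> A (take k (t' @ [v])) ((t' @ [v]) ! k))" by blast
    from cd(3) have "near k (take k z) (\<lambda>t'. \<forall>v. c < v \<and> v < d \<longrightarrow> \<not> A t' v)"
      by (rule near_mono) (auto simp: Mn_def)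
    then have "normal_at k A (take k z) (z ! k)" using cd unfolding normal_at_def empty_near_def by blast
    then show False using B by blast
  qed
  then show ?thesis using small_Suc_iff[OF N] by simp
qed

text \<open>\<open>W t x\<close> says that the interval with endpoints \<open>x\<close> contains
  \<open>\<beta> t\<close> and no other point of \<open>A t\<close>. Endpoints chosen generically
  keep this property near \<open>t\<close>, so \<open>\<beta> t'\<close> stays in the strip without
  any appeal to continuity. Whether \<open>\<beta> t'\<close> belongs to \<open>A t'\<close> is
  constant near \<open>t\<close>, and this decides between a branch and an empty strip.\<close>

lemma normal_if_section:
  assumes b: "L.dmap k (\<lambda>t. [\<beta> t])" and t: "t \<in> Mn k"
    and W_def: "\<And>t x. W t x \<longleftrightarrow> x ! 0 < \<beta> t \<and> \<beta> t < x ! 1 \<and> (\<forall>v. x ! 0 < v \<and> v < x ! 1 \<and> A t v \<longrightarrow> v = \<beta> t)"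
    and W: "L.dpred (k + 2) (\<lambda>z. W (take k z) (drop k z))"
    and s: "small 2 {x \<in> Mn 2. W t x \<and> \<not> near k t (\<lambda>t'. W t' x)}"
    and loc: "near k t (\<lambda>t'. A t' (\<beta> t')) \<or> near k t (\<lambda>t'. \<not> A t' (\<beta> t'))"
  shows "normal_at k A t (\<beta> t)"
proof -
  have 1: "\<exists>c d. c0 < c \<and> c < \<beta> t \<and> \<beta> t < d \<and> d < d0 \<and> near k t (\<lambda>t'. W t' [c, d])"
    if cd0: "c0 < \<beta> t" "\<beta> t < d0" for c0 d0
  proof -
    obtain c1 d1 where cd: "c0 \<le> c1" "c1 < \<beta> t" "\<beta> t < d1" "d1 \<le> d0" "\<forall>v\<in>{v. A t v}. c1 < v \<and> v < d1 \<longrightarrow> v = \<beta> t"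
      using finite_isolate[OF fin[OF t] cd0] by blast
    \<comment> \<open>The admissible endpoint pairs fill a box of \<open>M\<^sup>2\<close>, as
      \<open>generic_near_point\<close> requires.\<close>
    have bx: "x \<in> box 2 [c1, \<beta> t] [\<beta> t, d1] \<longleftrightarrow> (\<exists>c d. x = [c, d] \<and> c1 < c \<and> c < \<beta> t \<and> \<beta> t < d \<and> d < d1)" for x
      by (auto simp: box_def Mn_def numeral_2_eq_2 length_Suc_conv less_Suc_eq)
    have "\<exists>x\<in>box 2 [c1, \<beta> t] [\<beta> t, d1]. near k t (\<lambda>t'. W t' x)"
    proof (rule generic_near_point[OF W t s])
      show "box 2 [c1, \<beta> t] [\<beta> t, d1] \<noteq> {}" unfolding box_nonempty_iff
        using cd by (auto simp: numeral_2_eq_2 less_Suc_eq)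
      show "W t x" if "x \<in> box 2 [c1, \<beta> t] [\<beta> t, d1]" for x
        using that cd unfolding bx W_def by force
    qed (auto simp: Mn_def)
    then obtain c d where "c1 < c" "c < \<beta> t" "\<beta> t < d" "d < d1" "near k t (\<lambda>t'. W t' [c, d])"
      unfolding Bex_def bx by auto
    then show ?thesis using cd(1,4) by (meson le_less_trans less_le_trans)
  qed
  from loc show ?thesis
  proof
    assume l: "near k t (\<lambda>t'. A t' (\<beta> t'))"
    have "branch_near k A t (\<beta> t)" unfolding branch_near_def
    proof (intro allI impI)
      fix c0 d0 assume "c0 < \<beta> t \<and> \<beta> t < d0"
      then obtain c d where cd: "c0 < c" "c < \<beta> t" "\<beta> t < d" "d < d0" "near k t (\<lambda>t'. W t' [c, d])" using 1 by blast
      have "near k t (\<lambda>t'. \<exists>v. c < v \<and> v < d \<and> A t' v \<and> (\<forall>w. c < w \<and> w < d \<and> A t' w \<longrightarrow> w = v))"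
        using near_conj[OF cd(5) l] by (rule near_mono) (auto simp: W_def)
      then show "\<exists>c d. c0 < c \<and> c < \<beta> t \<and> \<beta> t < d \<and> d < d0 \<and>
          near k t (\<lambda>t'. \<exists>v. c < v \<and> v < d \<and> A t' v \<and> (\<forall>w. c < w \<and> w < d \<and> A t' w \<longrightarrow> w = v))"
        using cd by blast
    qed
    then show ?thesis by (simp add: normal_at_def)
  next
    assume l: "near k t (\<lambda>t'. \<not> A t' (\<beta> t'))"
    obtain c0 d0 where "c0 < \<beta> t" "\<beta> t < d0" using lt_ex gt_ex by blast
    then obtain c d where cd: "c0 < c" "c < \<beta> t" "\<beta> t < d" "d < d0" "near k t (\<lambda>t'. W t' [c, d])" using 1 by blast
    have "near k t (\<lambda>t'. \<forall>v. c < v \<and> v < d \<longrightarrow> \<not> A t' v)"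
      using near_conj[OF cd(5) l] by (rule near_mono) (auto simp: W_def)
    then show ?thesis using cd unfolding normal_at_def empty_near_def by blast
  qed
qed

text \<open>Over almost every \<open>t\<close> the non-normal heights are finite in number, so where
  some exist the least one is a definable section \<open>\<beta>\<close>. At a generic parameter
  \<open>normal_if_section\<close> shows this height to be normal, a contradiction.\<close>

lemma nonnormal_small: "small k {t \<in> Mn k. \<exists>b. \<not> normal_at k A t b}"
proof -
  define c0 :: 'm where "c0 = undefined"
  define Q where "Q t \<longleftrightarrow> finite {b. \<not> normal_at k A t b} \<and> (\<exists>b. \<not> normal_at k A t b)" for t
  \<comment> \<open>Made total by the arbitrary value \<open>c0\<close> where there is no least
    non-normal height to choose.\<close>
  define \<beta> where "\<beta> t = (if Q t then Min {b. \<not> normal_at k A t b} else c0)" for t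
  have NN: "L.dpred (Suc k) (\<lambda>z. \<not> normal_at k A (take k z) (z ! k))" by (intro L.dpred_not L_dpred_normal)
  have DQ: "L.dpred k Q" unfolding Q_def
    by (intro L.dpred_quant L.dpred_logic L_dpred_finite[OF NN] L_dpred_normal)
  have \<beta>: "L.dmap k (\<lambda>t. [\<beta> t])"
  proof (rule L.dmapI[where m = 1 and R = "\<lambda>t y. Q t \<and> \<not> normal_at k A t (y ! 0) \<and> (\<forall>b. b < y ! 0 \<longrightarrow> normal_at k A t b) \<or> \<not> Q t \<and> y ! 0 = c0"])
    show "L.dpred (k + 1) (\<lambda>z. Q (take k z) \<and> \<not> normal_at k A (take k z) (drop k z ! 0) \<and> (\<forall>b. b < drop k z ! 0 \<longrightarrow> normal_at k A (take k z) b) \<or> \<not> Q (take k z) \<and> drop k z ! 0 = c0)"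
      by (intro L.dpred_quant L.dpred_logic L.dpred_atoms L.dmap_basic L.dpred_comp[OF DQ] L.dpred_scalar_comp[OF L_dpred_normal]) (auto simp: Mn_def)
    fix t y :: "'m list" assume ty: "t \<in> Mn k" "y \<in> Mn 1"
    then obtain v where v: "y = [v]" by (auto simp: L.Mn_1)
    have "v = Min {b. \<not> normal_at k A t b} \<longleftrightarrow> \<not> normal_at k A t v \<and> (\<forall>b. b < v \<longrightarrow> normal_at k A t b)" if "Q t"
      using that eq_Min_iff[of "{b. \<not> normal_at k A t b}" v] unfolding Q_def by (auto simp: not_less[symmetric])
    then show "(y = [\<beta> t]) = (Q t \<and> \<not> normal_at k A t (y ! 0) \<and> (\<forall>b. b < y ! 0 \<longrightarrow> normal_at k A t b) \<or> \<not> Q t \<and> y ! 0 = c0)"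
      unfolding v \<beta>_def by auto
  qed (auto simp: Mn_def)
  define W where "W t x \<longleftrightarrow> x ! 0 < \<beta> t \<and> \<beta> t < x ! 1 \<and> (\<forall>v. x ! 0 < v \<and> v < x ! 1 \<and> A t v \<longrightarrow> v = \<beta> t)" for t x
  have W: "L.dpred (k + 2) (\<lambda>z. W (take k z) (drop k z))" unfolding W_def
    by (intro L.dpred_quant L.dpred_logic L.dpred_atoms L.dmap_basic L.dpred_scalar_comp[OF A] L.dmap_comp[OF \<beta>]) (auto simp: Mn_def)
  have L1: "L.dpred k (\<lambda>t. A t (\<beta> t))" by (intro L.dpred_scalar_comp[OF A] L.dmap_basic \<beta>)
  have L2: "L.dpred k (\<lambda>t. \<not> A t (\<beta> t))" by (intro L.dpred_not L1)
  \<comment> \<open>\<open>E1\<close> to \<open>E4\<close> are the small sets where the argument can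
    fail: infinitely many non-normal heights, endpoints that do not persist, and membership of
    \<open>\<beta> t\<close> in \<open>A t\<close>, or non-membership, that is not locally
    stable.\<close>
  define E1 where "E1 t \<longleftrightarrow> infinite {b. \<not> normal_at k A t b}" for t
  define E2 where "E2 t \<longleftrightarrow> \<not> small 2 {x \<in> Mn 2. W t x \<and> \<not> near k t (\<lambda>t'. W t' x)}" for t
  define E3 where "E3 t \<longleftrightarrow> A t (\<beta> t) \<and> \<not> near k t (\<lambda>t'. A t' (\<beta> t'))" for t
  define E4 where "E4 t \<longleftrightarrow> \<not> A t (\<beta> t) \<and> \<not> near k t (\<lambda>t'. \<not> A t' (\<beta> t'))" for t
  have D: "L.dpred k E1" "L.dpred k E2" "L.dpred k E3" "L.dpred k E4"
    unfolding E1_def E2_def E3_def E4_def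
    by (intro L.dpred_logic L_dpred_finite[OF NN] L_dpred_small L.dpred_near L1 L2 L.dpred_comp[OF L1] L.dpred_comp2[OF W] L.dmap_basic; (simp add: Mn_def; fail)?)+
  have sm: "small k {t \<in> Mn k. E1 t}" "small k {t \<in> Mn k. E2 t}" "small k {t \<in> Mn k. E3 t}" "small k {t \<in> Mn k. E4 t}"
    unfolding E1_def E2_def E3_def E4_def
    using nonnormal_fibers generic_near[OF W] generic_locally_true[OF L1] generic_locally_true[OF L2] by auto
  have "small k {t \<in> Mn k. E1 t \<or> E2 t \<or> E3 t \<or> E4 t}"
    by (intro small_Collect_disj sm dpred_LN L.dpred_disj D)
  then show ?thesis
  proof (rule small_Collect_mono)
    show "N.dpred k (\<lambda>t. \<exists>b. \<not> normal_at k A t b)" "N.dpred k (\<lambda>t. E1 t \<or> E2 t \<or> E3 t \<or> E4 t)"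
      by (intro dpred_LN L.dpred_disj D L.dpred_quant NN)+
    fix t :: "'m list" assume t: "t \<in> Mn k" and ex: "\<exists>b. \<not> normal_at k A t b"
    show "E1 t \<or> E2 t \<or> E3 t \<or> E4 t"
    proof (rule ccontr)
      assume no: "\<not> (E1 t \<or> E2 t \<or> E3 t \<or> E4 t)"
      then have "Q t" using ex by (auto simp: E1_def Q_def)
      then have "\<not> normal_at k A t (\<beta> t)" unfolding \<beta>_def Q_def
        using Min_in[of "{b. \<not> normal_at k A t b}"] by auto
      moreover have "normal_at k A t (\<beta> t)"
        by (rule normal_if_section[OF \<beta> t W_def W]) (use no in \<open>auto simp: E2_def E3_def E4_def\<close>)
      ultimately show False by blast
    qed
  qed
qed

text \<open>Everything below a lower bound of the finite set \<open>A t\<close> is again a lower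
  bound, so the candidates fill an interval; for generic \<open>t\<close> some candidate remains a
  bound near \<open>t\<close>.\<close>

lemma bounded_below_small: "small k {t \<in> Mn k. \<not> (\<exists>c. near k t (\<lambda>t'. \<forall>v. A t' v \<longrightarrow> c < v))}"
proof -
  define W where "W t x \<longleftrightarrow> (\<forall>v. A t v \<longrightarrow> x ! 0 < v)" for t x
  have W: "L.dpred (k + 1) (\<lambda>z. W (take k z) (drop k z))" unfolding W_def
    by (intro L.dpred_quant L.dpred_logic L.dpred_atoms L.dmap_basic L.dpred_scalar_comp[OF A]) (auto simp: Mn_def)
  from generic_near[OF W] show ?thesis
  proof (rule small_Collect_mono)
    show "N.dpred k (\<lambda>t. \<not> (\<exists>c. near k t (\<lambda>t'. \<forall>v. A t' v \<longrightarrow> c < v)))"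
      by (intro dpred_LN L.dpred_quant L.dpred_logic L.dpred_near L.dpred_atoms L.dmap_basic L.dpred_scalar_comp[OF A]) (auto simp: Mn_def)
    show "N.dpred k (\<lambda>t. \<not> small 1 {x \<in> Mn 1. W t x \<and> \<not> near k t (\<lambda>t'. W t' x)})"
      by (intro dpred_LN L.dpred_logic L_dpred_small L.dpred_near L.dpred_comp2[OF W] L.dmap_basic) (auto simp: Mn_def)
    fix t :: "'m list" assume t: "t \<in> Mn k" and no: "\<not> (\<exists>c. near k t (\<lambda>t'. \<forall>v. A t' v \<longrightarrow> c < v))"
    show "\<not> small 1 {x \<in> Mn 1. W t x \<and> \<not> near k t (\<lambda>t'. W t' x)}"
    proof
      assume s: "small 1 {x \<in> Mn 1. W t x \<and> \<not> near k t (\<lambda>t'. W t' x)}"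
      obtain d where d: "\<forall>v. A t v \<longrightarrow> d \<le> v"
        using fin[OF t] Min_le[OF fin[OF t]] by blast
      obtain c where c: "c < d" using lt_ex by blast
      have "\<exists>x\<in>box 1 [c] [d]. near k t (\<lambda>t'. W t' x)"
        by (rule generic_near_point[OF W t s]) (use c d dense[OF c] in \<open>auto simp: Mn_def box_1 W_def intro: less_le_trans\<close>)
      then show False using no by (auto simp: W_def)
    qed
  qed
qed

lemma bounded_above_small: "small k {t \<in> Mn k. \<not> (\<exists>c. near k t (\<lambda>t'. \<forall>v. A t' v \<longrightarrow> v < c))}"
proof -
  define W where "W t x \<longleftrightarrow> (\<forall>v. A t v \<longrightarrow> v < x ! 0)" for t x
  have W: "L.dpred (k + 1) (\<lambda>z. W (take k z) (drop k z))" unfolding W_def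
    by (intro L.dpred_quant L.dpred_logic L.dpred_atoms L.dmap_basic L.dpred_scalar_comp[OF A]) (auto simp: Mn_def)
  from generic_near[OF W] show ?thesis
  proof (rule small_Collect_mono)
    show "N.dpred k (\<lambda>t. \<not> (\<exists>c. near k t (\<lambda>t'. \<forall>v. A t' v \<longrightarrow> v < c)))"
      by (intro dpred_LN L.dpred_quant L.dpred_logic L.dpred_near L.dpred_atoms L.dmap_basic L.dpred_scalar_comp[OF A]) (auto simp: Mn_def)
    show "N.dpred k (\<lambda>t. \<not> small 1 {x \<in> Mn 1. W t x \<and> \<not> near k t (\<lambda>t'. W t' x)})"
      by (intro dpred_LN L.dpred_logic L_dpred_small L.dpred_near L.dpred_comp2[OF W] L.dmap_basic) (auto simp: Mn_def)
    fix t :: "'m list" assume t: "t \<in> Mn k" and no: "\<not> (\<exists>c. near k t (\<lambda>t'. \<forall>v. A t' v \<longrightarrow> v < c))"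
    show "\<not> small 1 {x \<in> Mn 1. W t x \<and> \<not> near k t (\<lambda>t'. W t' x)}"
    proof
      assume s: "small 1 {x \<in> Mn 1. W t x \<and> \<not> near k t (\<lambda>t'. W t' x)}"
      obtain c where c: "\<forall>v. A t v \<longrightarrow> v \<le> c"
        using fin[OF t] Max_ge[OF fin[OF t]] by blast
      obtain d where d: "c < d" using gt_ex by blast
      have "\<exists>x\<in>box 1 [c] [d]. near k t (\<lambda>t'. W t' x)"
        by (rule generic_near_point[OF W t s]) (use c d dense[OF d] in \<open>auto simp: Mn_def box_1 W_def intro: le_less_trans\<close>)
      then show False using no by (auto simp: W_def)
    qed
  qed
qed

lemma good_generic: "small k {t \<in> Mn k. \<not> good_at k A t}"
proof -
  have D: "L.dpred k (\<lambda>t. \<exists>b. \<not> normal_at k A t b)" 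
    "L.dpred k (\<lambda>t. \<not> (\<exists>c. near k t (\<lambda>t'. \<forall>v. A t' v \<longrightarrow> c < v)))"
    "L.dpred k (\<lambda>t. \<not> (\<exists>c. near k t (\<lambda>t'. \<forall>v. A t' v \<longrightarrow> v < c)))"
    by (intro L.dpred_quant L.dpred_logic L.dpred_near L.dpred_atoms L.dmap_basic L.dpred_scalar_comp[OF A] L_dpred_normal; (simp add: Mn_def; fail)?)+
  have "small k {t \<in> Mn k. (\<exists>b. \<not> normal_at k A t b) \<or> \<not> (\<exists>c. near k t (\<lambda>t'. \<forall>v. A t' v \<longrightarrow> c < v)) \<or>
       \<not> (\<exists>c. near k t (\<lambda>t'. \<forall>v. A t' v \<longrightarrow> v < c))}"
    by (intro small_Collect_disj nonnormal_small bounded_below_small bounded_above_small dpred_LN L.dpred_disj D)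
  then show ?thesis unfolding good_at_def by (simp add: de_Morgan_conj)
qed

text \<open>Disjoint strips around the points of \<open>A t\<close> each contain exactly one point
  of \<open>A t'\<close> for \<open>t'\<close> near \<open>t\<close>. That no further points appear
  outside the strips is shown by sweeping the height upwards from a local lower bound, a continuous
  induction along the line.\<close>

lemma good_card_locally_constant:
  assumes t: "t \<in> Mn k" and g: "good_at k A t"
  shows "near k t (\<lambda>t'. card {v. A t' v} = card {v. A t v})"
proof -
  define B where "B = {v. A t v}"
  have fB: "finite B" using fin[OF t] by (simp add: B_def)
  obtain c0 d0 where g0: "\<And>b. b \<in> B \<Longrightarrow> c0 b < b \<and> b < d0 b" "\<And>b b'. b \<in> B \<Longrightarrow> b' \<in> B \<Longrightarrow> b < b' \<Longrightarrow> d0 b \<le> c0 b'"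
    using finite_gaps[OF fB] by blast
  define one where "one b c d t' \<longleftrightarrow> (\<exists>v. c < v \<and> v < d \<and> A t' v \<and> (\<forall>w. c < w \<and> w < d \<and> A t' w \<longrightarrow> w = v))" for b :: 'm and c d t'
  have "\<exists>p. c0 b < fst p \<and> fst p < b \<and> b < snd p \<and> snd p < d0 b \<and> near k t (one b (fst p) (snd p))" if b: "b \<in> B" for b
  proof -
    have "\<not> empty_near k A t b"
    proof
      assume "empty_near k A t b"
      then obtain c d where "c < b" "b < d" "near k t (\<lambda>t'. \<forall>v. c < v \<and> v < d \<longrightarrow> \<not> A t' v)" by (auto simp: empty_near_def)
      from near_self[OF this(3)] this(1,2) b show False by (auto simp: B_def)
    qed
    then have "branch_near k A t b" using g by (auto simp: good_at_def normal_at_def)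
    then obtain c d where "c0 b < c" "c < b" "b < d" "d < d0 b" "near k t (one b c d)"
      unfolding branch_near_def one_def using g0(1)[OF b] by blast
    then show ?thesis by (intro exI[of _ "(c, d)"]) auto
  qed
  then obtain p where p: "\<And>b. b \<in> B \<Longrightarrow> c0 b < fst (p b) \<and> fst (p b) < b \<and> b < snd (p b) \<and> snd (p b) < d0 b \<and> near k t (one b (fst (p b)) (snd (p b)))"
    by metis
  define c where "c b = fst (p b)" for b
  define d where "d b = snd (p b)" for b
  have cd: "c b < b" "b < d b" "near k t (one b (c b) (d b))" if "b \<in> B" for b
    using p[OF that] by (auto simp: c_def d_def)
  have sep: "d b \<le> c b'" if "b \<in> B" "b' \<in> B" "b < b'" for b b'
    using p[OF that(1)] p[OF that(2)] g0(2)[OF that] by (auto simp: c_def d_def)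
  have lower: "near k t (\<lambda>t'. \<forall>b\<in>B. one b (c b) (d b) t')"
    by (intro near_ball_finite fB t cd)
  \<comment> \<open>The invariant of the sweep: near \<open>t\<close>, every point of the family up
    to height \<open>q\<close> lies in a strip. The neighbourhood may depend on
    \<open>q\<close>.\<close>
  define C where "C q \<longleftrightarrow> near k t (\<lambda>t'. \<forall>v. A t' v \<and> v \<le> q \<longrightarrow> (\<exists>b\<in>B. c b < v \<and> v < d b))" for q
  have DC: "L.dpred 1 (\<lambda>z. C (z ! 0))" unfolding C_def
    by (intro L.dpred_quant L.dpred_logic L.dpred_near L.dpred_ex_finite fB L.dpred_atoms L.dmap_basic L.dpred_scalar_comp[OF A])
      (use t in \<open>auto simp: Mn_def\<close>)
  have Cdown: "C c'" if "C c" "c' < c" for c c'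
    using that(1) unfolding C_def by (rule near_mono) (use that(2) in auto)
  obtain l where l: "near k t (\<lambda>t'. \<forall>v. A t' v \<longrightarrow> l < v)" using g by (auto simp: good_at_def)
  then have Cl: "C l" unfolding C_def by (rule near_mono) auto
  have extend: "C q" if "C p" "near k t (\<lambda>t'. \<forall>v. A t' v \<and> p < v \<and> v \<le> q \<longrightarrow> (\<exists>b\<in>B. c b < v \<and> v < d b))" for p q
    using near_conj[OF that(1)[unfolded C_def] that(2)] unfolding C_def by (rule near_mono) (meson not_le)
  have Call: "C q" for q
  proof (rule ccontr)
    assume "\<not> C q"
    with DC Cdown Cl have "\<exists>s. (\<forall>c<s. C c) \<and> (\<forall>c>s. \<not> C c)" by (rule initial_segment_sup)
    then obtain s where s: "\<And>c. c < s \<Longrightarrow> C c" "\<And>c. s < c \<Longrightarrow> \<not> C c" by blast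
    \<comment> \<open>At the supremum \<open>s\<close> of the sweep, either the family avoids a
      strip around \<open>s\<close>, or \<open>s\<close> belongs to \<open>A t\<close> and its own
      strip covers the nearby heights. Either way the sweep goes past \<open>s\<close>.\<close>
    have "normal_at k A t s" using g by (simp add: good_at_def)
    then consider "empty_near k A t s" | "branch_near k A t s" by (auto simp: normal_at_def)
    then show False
    proof cases
      case 1
      then obtain c1 d1 where e: "c1 < s" "s < d1" "near k t (\<lambda>t'. \<forall>v. c1 < v \<and> v < d1 \<longrightarrow> \<not> A t' v)" by (auto simp: empty_near_def)
      obtain p q where pq: "c1 < p" "p < s" "s < q" "q < d1" using dense[OF e(1)] dense[OF e(2)] by blast
      have "C q" by (rule extend[OF s(1)[OF pq(2)]], rule near_mono[OF e(3)]) (use pq in \<open>auto dest: less_trans le_less_trans\<close>)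
      then show False using s(2) pq by blast
    next
      case 2
      have sB: "s \<in> B"
      proof (rule ccontr)
        assume "s \<notin> B"
        obtain c2 d2 where "c2 < s" "s < d2" using lt_ex gt_ex by blast
        then obtain c1 d1 where e: "c1 < s" "s < d1" "\<forall>v\<in>B. c1 < v \<and> v < d1 \<longrightarrow> v = s"
          using finite_isolate[OF fB] by blast
        then obtain c' d' where "c1 < c'" "d' < d1" "near k t (\<lambda>t'. \<exists>v. c' < v \<and> v < d' \<and> A t' v \<and> (\<forall>w. c' < w \<and> w < d' \<and> A t' w \<longrightarrow> w = v))"
          using 2 unfolding branch_near_def by blast
        from near_self[OF this(3)] this(1,2) obtain v where "c1 < v" "v < d1" "A t v" by (meson less_trans)
        then show False using e \<open>s \<notin> B\<close> by (auto simp: B_def)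
      qed
      obtain p q where pq: "c s < p" "p < s" "s < q" "q < d s"
        using dense[OF cd(1)[OF sB]] dense[OF cd(2)[OF sB]] by blast
      have "C q" by (rule extend[OF s(1)[OF pq(2)]], rule near_mono[OF near_True[OF t]])
        (use pq sB in \<open>auto intro!: bexI[of _ s] intro: less_trans le_less_trans\<close>)
      then show False using s(2) pq by blast
    qed
  qed
  \<comment> \<open>A local upper bound turns the invariant at the single height \<open>u\<close>
    into a statement about all points of \<open>A t'\<close>.\<close>
  obtain u where u: "near k t (\<lambda>t'. \<forall>v. A t' v \<longrightarrow> v < u)" using g by (auto simp: good_at_def)
  have "near k t (\<lambda>t'. (\<forall>b\<in>B. one b (c b) (d b) t') \<and> (\<forall>v. A t' v \<longrightarrow> v < u) \<and> (\<forall>v. A t' v \<and> v \<le> u \<longrightarrow> (\<exists>b\<in>B. c b < v \<and> v < d b)))"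
    using Call[of u] unfolding C_def by (intro near_conj lower u)
  then show ?thesis
  proof (rule near_mono)
    fix t' :: "'m list"
    assume h: "(\<forall>b\<in>B. one b (c b) (d b) t') \<and> (\<forall>v. A t' v \<longrightarrow> v < u) \<and> (\<forall>v. A t' v \<and> v \<le> u \<longrightarrow> (\<exists>b\<in>B. c b < v \<and> v < d b))"
    then obtain f where f: "\<And>b. b \<in> B \<Longrightarrow> c b < f b \<and> f b < d b \<and> A t' (f b) \<and> (\<forall>w. c b < w \<and> w < d b \<and> A t' w \<longrightarrow> w = f b)"
      unfolding one_def by metis
    have "bij_betw f B {v. A t' v}"
    proof (rule bij_betw_imageI)
      have "f b < f b'" if "b \<in> B" "b' \<in> B" "b < b'" for b b'
        using f[OF that(1)] f[OF that(2)] sep[OF that] by (meson less_le_trans less_trans)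
      then show "inj_on f B" by (metis inj_onI linorder_neqE order_less_irrefl)
      show "f ` B = {v. A t' v}"
      proof
        show "f ` B \<subseteq> {v. A t' v}" using f by blast
        show "{v. A t' v} \<subseteq> f ` B"
        proof
          fix v assume "v \<in> {v. A t' v}"
          then have "A t' v" "v \<le> u" using h by (auto intro: less_imp_le)
          then obtain b where "b \<in> B" "c b < v" "v < d b" using h by blast
          then show "v \<in> f ` B" using f \<open>A t' v\<close> by blast
        qed
      qed
    qed
    then show "card {v. A t' v} = card {v. A t v}" using bij_betw_same_card by (metis B_def)
  qed
qed

end

end

section \<open>Uniform finiteness and connected decompositions\<close>

context tame_pair begin

text \<open>\<open>C\<close> is itself open, so relatively clopen means that \<open>S\<close> and
  \<open>C - S\<close> are both open. The purpose is that a locally constant definable function on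
  \<open>C\<close> is constant.\<close>

definition dconn :: "nat \<Rightarrow> 'm list set \<Rightarrow> bool" where
  "dconn k C \<longleftrightarrow> DL C \<and> C \<subseteq> Mn k \<and> (\<forall>t\<in>C. near k t (\<lambda>t'. t' \<in> C)) \<and>
     (\<forall>S. DL S \<and> S \<subseteq> C \<and> (\<forall>t\<in>S. near k t (\<lambda>t'. t' \<in> S)) \<and> (\<forall>t\<in>C - S. near k t (\<lambda>t'. t' \<in> C - S)) \<longrightarrow> S = {} \<or> S = C)"

definition conn_decomp :: "nat \<Rightarrow> bool" where
  "conn_decomp k \<longleftrightarrow> (\<forall>D. DL D \<and> D \<subseteq> Mn k \<longrightarrow>
     (\<exists>\<C>. finite \<C> \<and> (\<forall>C\<in>\<C>. dconn k C \<and> C \<subseteq> D) \<and> small k (D - \<Union>\<C>)))"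

lemma dconnD:
  assumes "dconn k C"
  shows "DL C" "C \<subseteq> Mn k" "\<And>t. t \<in> C \<Longrightarrow> near k t (\<lambda>t'. t' \<in> C)"
  using assms by (auto simp: dconn_def)

lemma dconn_clopen:
  assumes "dconn k C" "DL S" "S \<subseteq> C" "\<And>t. t \<in> S \<Longrightarrow> near k t (\<lambda>t'. t' \<in> S)"
    "\<And>t. t \<in> C - S \<Longrightarrow> near k t (\<lambda>t'. t' \<in> C - S)"
  shows "S = {} \<or> S = C"
  using assms unfolding dconn_def by meson

lemma D_Union_dconn: "finite \<C> \<Longrightarrow> (\<And>C. C \<in> \<C> \<Longrightarrow> dconn k C) \<Longrightarrow> DL (\<Union>\<C>) \<and> \<Union>\<C> \<subseteq> Mn k"
  using L.D_Union_finite[of \<C> "\<lambda>C. C" k] dconnD(1,2)[of k] by (metis Sup_least image_ident)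

text \<open>The fibre cardinality is locally constant at good parameters, hence constant on each
  connected piece of the good set. There are finitely many pieces, so \<open>N\<close> is the
  maximum of the constants; what is left over is small.\<close>

lemma uniform_finiteness:
  assumes CD: "conn_decomp k"
    and A: "L.dpred (Suc k) (\<lambda>z. A (take k z) (z ! k))"
    and fin: "\<And>t. t \<in> Mn k \<Longrightarrow> finite {v. A t v}"
  shows "\<exists>N. small k {t \<in> Mn k. N < card {v. A t v}}"
proof -
  define D where "D = {t \<in> Mn k. good_at k A t}"
  have D: "DL D" "D \<subseteq> Mn k" using L_dpred_good[of k A, OF A fin] by (auto simp: D_def L.dpred_def)
  obtain \<C> where C: "finite \<C>" "\<And>C. C \<in> \<C> \<Longrightarrow> dconn k C" "\<And>C. C \<in> \<C> \<Longrightarrow> C \<subseteq> D" "small k (D - \<Union>\<C>)"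
    using CD[unfolded conn_decomp_def, rule_format, OF conjI[OF D]] by blast
  have const: "\<exists>n. \<forall>t\<in>C. card {v. A t v} = n" if "C \<in> \<C>" for C
  proof (cases "C = {}")
    case False
    then obtain t0 where t0: "t0 \<in> C" by blast
    define n where "n = card {v. A t0 v}"
    define S where "S = {t \<in> C. card {v. A t v} = n}"
    note dc = dconnD[OF C(2)[OF that]]
    have lc: "near k t (\<lambda>t'. t' \<in> C \<and> card {v. A t' v} = card {v. A t v})" if t: "t \<in> C" for t
    proof (rule near_conj[OF dc(3)[OF t]])
      have "t \<in> Mn k" "good_at k A t" using t C(3)[OF \<open>C \<in> \<C>\<close>] by (auto simp: D_def)
      then show "near k t (\<lambda>t'. card {v. A t' v} = card {v. A t v})" using good_card_locally_constant[of k A, OF A fin] by blast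
    qed
    have "S = {} \<or> S = C"
    proof (rule dconn_clopen[OF C(2)[OF that]])
      show "DL S" unfolding S_def by (rule L.D_Collect'[OF dc(1,2) L_dpred_card_eq[of k A, OF A fin]])
      show "S \<subseteq> C" by (auto simp: S_def)
      show "near k t (\<lambda>t'. t' \<in> S)" if "t \<in> S" for t
        by (rule near_mono[OF lc[of t]]) (use that in \<open>auto simp: S_def\<close>)
      show "near k t (\<lambda>t'. t' \<in> C - S)" if "t \<in> C - S" for t
        by (rule near_mono[OF lc[of t]]) (use that in \<open>auto simp: S_def\<close>)
    qed
    then have "S = C" using t0 by (auto simp: S_def n_def)
    then show ?thesis by (auto simp: S_def)
  qed auto
  then obtain n where n: "\<And>C t. C \<in> \<C> \<Longrightarrow> t \<in> C \<Longrightarrow> card {v. A t v} = n C" by metis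
  obtain N where N: "\<And>C. C \<in> \<C> \<Longrightarrow> n C \<le> N"
    using C(1) finite_nat_set_iff_bounded_le[of "n ` \<C>"] by auto
  have U: "DL (\<Union>\<C>)" using D_Union_dconn C by blast
  have "small k ({t \<in> Mn k. \<not> good_at k A t} \<union> (D - \<Union>\<C>))"
    by (rule small_Un[OF good_generic[of k A, OF A fin] C(4), where n=k])
      (use L.dpred_not[OF L_dpred_good[of k A, OF A fin]] D DL_DN L.D_Diff[OF D(1) U D(2)] D_Union_dconn[of \<C> k] C in \<open>auto simp: L.dpred_def\<close>)
  then have "small k {t \<in> Mn k. N < card {v. A t v}}"
  proof (rule small_subset[where n=k])
    show "DN {t \<in> Mn k. N < card {v. A t v}}"
      using L_dpred_card_ge[of k A, OF A fin, of "Suc N"] DL_DN by (simp add: L.dpred_def Suc_le_eq)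
    show "DN ({t \<in> Mn k. \<not> good_at k A t} \<union> (D - \<Union>\<C>))"
      by (intro DL_DN L.D_Un[where n=k]) 
        (use L.dpred_not[OF L_dpred_good[of k A, OF A fin]] D L.D_Diff[OF D(1) U D(2)] D_Union_dconn[of \<C> k] C in \<open>auto simp: L.dpred_def\<close>)
    show "{t \<in> Mn k. N < card {v. A t v}} \<subseteq> {t \<in> Mn k. \<not> good_at k A t} \<union> (D - \<Union>\<C>)"
    proof
      fix t assume t: "t \<in> {t \<in> Mn k. N < card {v. A t v}}"
      have "t \<notin> \<Union>\<C>" using t n N by (metis (mono_tags, lifting) UnionE leD mem_Collect_eq)
      then show "t \<in> {t \<in> Mn k. \<not> good_at k A t} \<union> (D - \<Union>\<C>)" using t by (auto simp: D_def)
    qed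
  qed (auto simp: D_def)
  then show ?thesis by blast
qed

lemma snoc_split: "z \<in> Mn (Suc k) \<Longrightarrow> z = take k z @ [z ! k]"
  using take_Suc_conv_app_nth[of k z] by (simp add: Mn_def)

text \<open>A clopen subset contains each fibre, which is convex, entirely or not at all, so it comes from a clopen subset of \<open>C\<close>.\<close>

lemma dconn_lift:
  assumes C: "dconn k C"
    and W: "L.dpred (Suc k) (\<lambda>z. W (take k z) (z ! k))"
    and ne: "\<And>t. t \<in> C \<Longrightarrow> \<exists>v. W t v"
    and convex: "\<And>t v v' w. t \<in> C \<Longrightarrow> W t v \<Longrightarrow> W t v' \<Longrightarrow> v \<le> w \<Longrightarrow> w \<le> v' \<Longrightarrow> W t w"
    and opn: "\<And>t v. t \<in> C \<Longrightarrow> W t v \<Longrightarrow> near (Suc k) (t @ [v]) (\<lambda>z. W (take k z) (z ! k))"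
  shows "dconn (Suc k) {z \<in> Mn (Suc k). take k z \<in> C \<and> W (take k z) (z ! k)}" (is "dconn _ ?C")
proof -
  note dc = dconnD[OF C]
  have near1: "near k (take k z) (\<lambda>t'. \<exists>v. P (t' @ [v]))" if P: "near (Suc k) z P" "z \<in> Mn (Suc k)" for P and z :: "'m list"
  proof -
    obtain c d where cd: "c < z ! k" "z ! k < d" "near k (take k z) (\<lambda>t'. \<forall>v. c < v \<and> v < d \<longrightarrow> P (t' @ [v]))"
      using near_split[OF P] by blast
    show ?thesis using cd(3) by (rule near_mono) (use cd in blast)
  qed
  show ?thesis unfolding dconn_def
  proof (intro conjI allI impI ballI)
    have "L.dpred (Suc k) (\<lambda>z. take k z \<in> C \<and> W (take k z) (z ! k))"
      by (intro L.dpred_logic W L.dpred_dmap[OF _ dc(1)] L.dmap_basic)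
    then show "DL ?C" by (simp add: L.dpred_def)
    show "?C \<subseteq> Mn (Suc k)" by blast
    fix z assume z: "z \<in> ?C"
    have zs: "z = take k z @ [z ! k]" using z snoc_split by blast
    obtain l u where lu: "l < z ! k" "z ! k < u" using lt_ex gt_ex by blast
    have "near k (take k z) (\<lambda>t'. t' \<in> C)" using z dc(3) by blast
    then have "near k (take k z) (\<lambda>t'. \<forall>v. l < v \<and> v < u \<longrightarrow> take k (t' @ [v]) \<in> C)"
      by (rule near_mono) (auto simp: Mn_def)
    from near_prod[OF this lu] have "near (Suc k) z (\<lambda>z. take k z \<in> C)" using zs by simp
    moreover have "near (Suc k) z (\<lambda>z. W (take k z) (z ! k))" using opn[of "take k z" "z ! k"] z zs by auto
    ultimately have "near (Suc k) z (\<lambda>z. take k z \<in> C \<and> W (take k z) (z ! k))" by (rule near_conj)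
    then show "near (Suc k) z (\<lambda>t'. t' \<in> ?C)" by (rule near_mono) blast
  next
    fix S assume S: "DL S \<and> S \<subseteq> ?C \<and> (\<forall>t\<in>S. near (Suc k) t (\<lambda>t'. t' \<in> S)) \<and> (\<forall>t\<in>?C - S. near (Suc k) t (\<lambda>t'. t' \<in> ?C - S))"
    define U where "U = {t \<in> C. \<exists>v. t @ [v] \<in> S}"
    have inC: "t \<in> C \<Longrightarrow> W t v \<Longrightarrow> t @ [v] \<in> ?C" for t v using dc(2) by (auto simp: Mn_def nth_append)
    \<comment> \<open>If one fibre met both \<open>S\<close> and its complement, a boundary point
      \<open>b\<close> of \<open>S\<close> would lie between, and convexity keeps it in the fibre.
      There \<open>S\<close> or \<open>?C - S\<close> is a neighbourhood, so \<open>b\<close> is no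
      boundary point.\<close>
    have whole: "t @ [v'] \<in> S" if t: "t \<in> C" "t @ [v] \<in> S" "W t v'" for t v v'
    proof (rule ccontr)
      assume n: "t @ [v'] \<notin> S"
      have tk: "t \<in> Mn k" using t dc(2) by blast
      have Wv: "W t v" using t(2) S tk by (auto simp: Mn_def nth_append)
      have P: "L.dpred 1 (\<lambda>x. t @ [x ! 0] \<in> S)"
        by (intro L.dpred_dmap[of _ _ S] L.dmap_basic) (use S in blast)
      have "v \<noteq> v'" using n t by blast
      then consider "v < v'" | "v' < v" by (meson linorder_neqE)
      then obtain b where b: "W t b" "bdry (\<lambda>x. t @ [x] \<in> S) b"
      proof cases
        case 1
        then show ?thesis using bdry_between[OF P 1] n t(2) convex[OF t(1) Wv t(3)] that by blast
      next
        case 2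
        then show ?thesis using bdry_between[OF P 2] n t(2) convex[OF t(1) t(3) Wv] that by blast
      qed
      have tb: "t @ [b] \<in> Mn (Suc k)" using tk by (simp add: Mn_def)
      have "near (Suc k) (t @ [b]) (\<lambda>z. z \<in> S) \<or> near (Suc k) (t @ [b]) (\<lambda>z. z \<in> ?C - S)"
        using S inC[OF t(1) b(1)] by blast
      then obtain Q where Q: "near (Suc k) (t @ [b]) Q" "(\<forall>z. Q z \<longrightarrow> z \<in> S) \<or> (\<forall>z. Q z \<longrightarrow> z \<notin> S)" by blast
      from near_split[OF Q(1) tb] tk obtain c d where cd: "c < b" "b < d" "near k t (\<lambda>t'. \<forall>v. c < v \<and> v < d \<longrightarrow> Q (t' @ [v]))"
        by (auto simp: Mn_def nth_append)
      from near_self[OF cd(3)] have "\<forall>v. c < v \<and> v < d \<longrightarrow> Q (t @ [v])" .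
      then show False using b(2) cd(1,2) Q(2) unfolding bdry_def by blast
    qed
    have SU: "S = {z \<in> ?C. take k z \<in> U}"
    proof
      show "S \<subseteq> {z \<in> ?C. take k z \<in> U}"
      proof
        fix z assume z: "z \<in> S"
        then have "z \<in> ?C" "z = take k z @ [z ! k]" using S snoc_split by blast+
        moreover from this(2) z have "take k z @ [z ! k] \<in> S" by metis
        ultimately show "z \<in> {z \<in> ?C. take k z \<in> U}" unfolding U_def by blast
      qed
      show "{z \<in> ?C. take k z \<in> U} \<subseteq> S"
      proof
        fix z assume z: "z \<in> {z \<in> ?C. take k z \<in> U}"
        then obtain v where "take k z \<in> C" "take k z @ [v] \<in> S" by (auto simp: U_def)
        from whole[OF this, of "z ! k"] show "z \<in> S" using z snoc_split[of z k] by auto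
      qed
    qed
    have "U = {} \<or> U = C"
    proof (rule dconn_clopen[OF C])
      show "DL U" unfolding U_def
        by (intro L.D_Collect'[OF dc(1,2)] L.dpred_ex1 L.dpred_dmap[of _ _ S] L.dmap_basic) (use S in blast)
      show "U \<subseteq> C" by (auto simp: U_def)
      show "near k t (\<lambda>t'. t' \<in> U)" if t: "t \<in> U" for t
      proof -
        obtain v where v: "t \<in> C" "t @ [v] \<in> S" using t by (auto simp: U_def)
        have tk: "t \<in> Mn k" using v dc(2) by blast
        have "near (Suc k) (t @ [v]) (\<lambda>z. z \<in> S)" using S v by blast
        from near1[OF this] have "near k t (\<lambda>t'. \<exists>v. t' @ [v] \<in> S)" using tk by (simp add: Mn_def)
        from near_conj[OF dc(3)[OF v(1)] this] show ?thesis by (rule near_mono) (auto simp: U_def)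
      qed
      show "near k t (\<lambda>t'. t' \<in> C - U)" if t: "t \<in> C - U" for t
      proof -
        obtain v where v: "W t v" using ne t by blast
        have tk: "t \<in> Mn k" using t dc(2) by blast
        have "t @ [v] \<in> ?C - S" using inC[of t v] v t by (auto simp: U_def)
        then have "near (Suc k) (t @ [v]) (\<lambda>z. z \<in> ?C - S)" using S by blast
        from near1[OF this] have "near k t (\<lambda>t'. \<exists>v. t' @ [v] \<in> ?C - S)" using tk by (simp add: Mn_def)
        from near_conj[OF dc(3) this, of] show ?thesis
        proof (rule near_mono)
          fix t' :: "'m list" assume t': "t' \<in> Mn k" "t' \<in> C \<and> (\<exists>v. t' @ [v] \<in> ?C - S)"
          then obtain w where w: "t' @ [w] \<in> ?C - S" by blast
          have "W t' w" using w t'(1) by (auto simp: Mn_def nth_append)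
          then have "t' \<notin> U" using whole[of t' _ w] w by (auto simp: U_def)
          then show "t' \<in> C - U" using t' by blast
        qed (use t in blast)
      qed
    qed
    then show "S = {} \<or> S = ?C"
    proof
      assume "U = {}" then have "S = {}" using SU by blast then show ?thesis ..
    next
      assume "U = C" then have "S = ?C" using SU by blast then show ?thesis ..
    qed
  qed
qed

section \<open>Induction on the ambient dimension\<close>

lemma conn_decomp_0: "conn_decomp 0"
  unfolding conn_decomp_def
proof (intro allI impI, elim conjE)
  fix D :: "'m list set" assume D: "DL D" "D \<subseteq> Mn 0"
  have M: "Mn 0 = {[] :: 'm list}" by (auto simp: Mn_def)
  have "near 0 t (\<lambda>t'. t' \<in> D)" if "t \<in> D" for t
    by (rule near_mono[OF near_True[of t 0]]) (use that D(2) in \<open>auto simp: Mn_def\<close>)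
  moreover have "S = {} \<or> S = D" if "S \<subseteq> D" for S using that D(2) unfolding M by blast
  ultimately have "dconn 0 D" using D unfolding dconn_def by blast
  then show "\<exists>\<C>. finite \<C> \<and> (\<forall>C\<in>\<C>. dconn 0 C \<and> C \<subseteq> D) \<and> small 0 (D - \<Union>\<C>)"
    using small_empty by (intro exI[of _ "{D}"]) auto
qed

text \<open>Each fibre of \<open>D\<close> is cut at its boundary points \<open>B t\<close>,
  generically at most \<open>N\<close> of them. \<open>W j\<close> collects the points of
  \<open>D\<close> with exactly \<open>j\<close> boundary points below and none at their own height;
  its fibres are convex and open, hence lift connected pieces of the base. Over generic parameters
  only boundary points are missed, which is a finite set in each fibre.\<close>

lemma conn_decomp_Suc:
  assumes CD: "conn_decomp k" shows "conn_decomp (Suc k)"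
  unfolding conn_decomp_def
proof (intro allI impI, elim conjE)
  fix D :: "'m list set" assume D: "DL D" "D \<subseteq> Mn (Suc k)"
  define P where "P t v \<longleftrightarrow> t @ [v] \<in> D" for t v
  have DP: "L.dpred (Suc k) (\<lambda>z. P (take k z) (z ! k))" unfolding P_def
    by (intro L.dpred_dmap[OF _ D(1)] L.dmap_basic)
  define B where "B t v \<longleftrightarrow> bdry (P t) v" for t v
  have DB: "L.dpred (Suc k) (\<lambda>z. B (take k z) (z ! k))" unfolding B_def by (rule L_dpred_bdry[OF DP])
  have fin: "finite {v. B t v}" if "t \<in> Mn k" for t unfolding B_def by (rule bdry_finite[OF L_fiber1[OF DP that]])
  have btw: "\<exists>b. x \<le> b \<and> b \<le> y \<and> B t b" if "t \<in> Mn k" "x < y" "P t x \<noteq> P t y" for t x y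
    unfolding B_def by (rule bdry_between[OF L_fiber1[OF DP that(1)] that(2,3)])
  obtain N where N: "small k {t \<in> Mn k. N < card {v. B t v}}" using uniform_finiteness[OF CD DB fin] by blast
  have flt: "finite {w. B t w \<and> w < v}" if "t \<in> Mn k" for t v
    using fin[OF that] by (rule rev_finite_subset) auto
  define W where "W j t v \<longleftrightarrow> P t v \<and> \<not> B t v \<and> card {w. B t w \<and> w < v} = j" for j t v
  have DW: "L.dpred (Suc k) (\<lambda>z. W j (take k z) (z ! k))" for j unfolding W_def
    by (intro L.dpred_logic DP DB L_dpred_rank_eq[OF DB fin])
  have convex: "W j t w" if h: "t \<in> Mn k" "W j t v" "W j t v'" "v \<le> w" "w \<le> v'" for j t v v' w
  proof -
    have "{x. B t x \<and> x < v} \<subseteq> {x. B t x \<and> x < v'}" using h by auto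
    then have eq: "{x. B t x \<and> x < v} = {x. B t x \<and> x < v'}"
      using card_subset_eq[OF flt[OF h(1)]] h(2,3) by (auto simp: W_def)
    have no: "\<not> B t b" if "v \<le> b" "b \<le> v'" for b
    proof
      assume "B t b"
      then have "b < v'" using that h(3) by (metis W_def le_neq_trans)
      then have "b \<in> {x. B t x \<and> x < v}" using \<open>B t b\<close> eq by blast
      then show False using that by auto
    qed
    have "P t w"
    proof (rule ccontr)
      assume "\<not> P t w"
      moreover have "P t v" using h(2) by (simp add: W_def)
      ultimately have ne: "P t v \<noteq> P t w" "v < w" using h(4) by (auto simp: order_less_le)
      then obtain b where b: "v \<le> b" "b \<le> w" "B t b" using btw[OF h(1) ne(2,1)] by blast
      then show False using no[OF b(1) order_trans[OF b(2) h(5)]] by blast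
    qed
    moreover have "x < w \<longleftrightarrow> x < v" if "B t x" for x
      using no[of x] that h(4,5) by (meson less_le_trans less_imp_le not_le)
    then have "{x. B t x \<and> x < w} = {x. B t x \<and> x < v}" by blast
    ultimately show ?thesis using no[OF h(4,5)] h(2) by (simp add: W_def)
  qed
  have opn1: "\<exists>c d. c < v \<and> v < d \<and> (\<forall>w. c < w \<and> w < d \<longrightarrow> W j t w)" if h: "t \<in> Mn k" "W j t v" for j t v
  proof -
    obtain c0 d0 where "c0 < v" "v < d0" using lt_ex gt_ex by blast
    then obtain c d where cd: "c < v" "v < d" "\<forall>b\<in>{b. B t b}. c < b \<and> b < d \<longrightarrow> b = v"
      using finite_isolate[OF fin[OF h(1)]] by blast
    have no: "\<not> B t b" if "c < b" "b < d" for b using cd(3) that h(2) by (auto simp: W_def)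
    have "W j t w" if w: "c < w" "w < d" for w
    proof -
      have "P t w = P t v"
      proof (rule ccontr)
        assume ne: "P t w \<noteq> P t v"
        then consider "w < v" | "v < w" by (metis linorder_neqE)
        then show False
        proof cases
          case 1
          then obtain b where "w \<le> b" "b \<le> v" "B t b" using btw[OF h(1) 1 ne] by blast
          then show False using no[of b] w cd by (meson le_less_trans less_le_trans)
        next
          case 2
          then obtain b where "v \<le> b" "b \<le> w" "B t b" using btw[OF h(1) 2] ne by blast
          then show False using no[of b] w cd by (meson le_less_trans less_le_trans)
        qed
      qed
      moreover have "{x. B t x \<and> x < w} = {x. B t x \<and> x < v}"
        using no w cd by (metis (no_types, lifting) less_trans linorder_neqE)
      ultimately show ?thesis using no[OF w] h(2) by (simp add: W_def)
    qed
    then show ?thesis using cd by blast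
  qed
  \<comment> \<open>Fibrewise openness of \<open>W j\<close> is not yet openness in the product.
    Treating the endpoints of a closed interval inside the fibre as a point of
    \<open>M\<^sup>2\<close>, genericity makes one such interval valid for all nearby
    parameters.\<close>
  define W2 where "W2 j t x \<longleftrightarrow> x ! 0 < x ! 1 \<and> (\<forall>w. x ! 0 \<le> w \<and> w \<le> x ! 1 \<longrightarrow> W j t w)" for j t x
  have DW2: "L.dpred (k + 2) (\<lambda>z. W2 j (take k z) (drop k z))" for j unfolding W2_def
    by (intro L.dpred_quant L.dpred_logic L.dpred_atoms L.dmap_basic L.dpred_scalar_comp[OF DW]) (auto simp: Mn_def)
  define E where "E j t \<longleftrightarrow> \<not> small 2 {x \<in> Mn 2. W2 j t x \<and> \<not> near k t (\<lambda>t'. W2 j t' x)}" for j t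
  have DE: "L.dpred k (E j)" for j unfolding E_def
    by (intro L.dpred_logic L_dpred_small L.dpred_near L.dpred_comp2[OF DW2] L.dmap_basic) (auto simp: Mn_def)
  have sE: "small k {t \<in> Mn k. E j t}" for j unfolding E_def by (rule generic_near[OF DW2])
  have opn: "near (Suc k) (t @ [v]) (\<lambda>z. W j (take k z) (z ! k))" if h: "t \<in> Mn k" "\<not> E j t" "W j t v" for j t v
  proof -
    obtain c d where cd: "c < v" "v < d" "\<And>w. c < w \<Longrightarrow> w < d \<Longrightarrow> W j t w" using opn1[OF h(1,3)] by blast
    have bx: "x \<in> box 2 [c, v] [v, d] \<longleftrightarrow> (\<exists>c' d'. x = [c', d'] \<and> c < c' \<and> c' < v \<and> v < d' \<and> d' < d)" for x
      by (auto simp: box_def Mn_def numeral_2_eq_2 length_Suc_conv less_Suc_eq)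
    have "\<exists>x\<in>box 2 [c, v] [v, d]. near k t (\<lambda>t'. W2 j t' x)"
    proof (rule generic_near_point[OF DW2 h(1)])
      show "small 2 {x \<in> Mn 2. W2 j t x \<and> \<not> near k t (\<lambda>t'. W2 j t' x)}" using h(2) by (simp add: E_def)
      show "box 2 [c, v] [v, d] \<noteq> {}" unfolding box_nonempty_iff
        using cd by (auto simp: numeral_2_eq_2 less_Suc_eq)
      show "W2 j t x" if "x \<in> box 2 [c, v] [v, d]" for x
        using that cd unfolding bx W2_def by (auto intro: less_trans)
    qed (auto simp: Mn_def)
    then obtain c' d' where c': "c' < v" "v < d'" "near k t (\<lambda>t'. W2 j t' [c', d'])" unfolding Bex_def bx by auto
    from c'(3) have "near k t (\<lambda>t'. \<forall>v. c' < v \<and> v < d' \<longrightarrow> W j (take k (t' @ [v])) ((t' @ [v]) ! k))"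
      by (rule near_mono) (auto simp: W2_def Mn_def less_imp_le)
    from near_prod[OF this c'(1,2)] show ?thesis .
  qed
  define Pj where "Pj j = {t \<in> Mn k. (\<exists>v. W j t v) \<and> \<not> E j t}" for j
  have DPj: "DL (Pj j)" "Pj j \<subseteq> Mn k" for j
  proof -
    have "L.dpred k (\<lambda>t. (\<exists>v. W j t v) \<and> \<not> E j t)" by (intro L.dpred_logic L.dpred_ex1 DW DE)
    then show "DL (Pj j)" "Pj j \<subseteq> Mn k" by (auto simp: Pj_def L.dpred_def)
  qed
  have "\<forall>j. \<exists>\<C>. finite \<C> \<and> (\<forall>C\<in>\<C>. dconn k C \<and> C \<subseteq> Pj j) \<and> small k (Pj j - \<Union>\<C>)"
    using CD DPj unfolding conn_decomp_def by blast
  then obtain \<C> where C: "\<And>j. finite (\<C> j)" "\<And>j C. C \<in> \<C> j \<Longrightarrow> dconn k C" "\<And>j C. C \<in> \<C> j \<Longrightarrow> C \<subseteq> Pj j"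
    "\<And>j. small k (Pj j - \<Union>(\<C> j))" by metis
  define lift where "lift j C = {z \<in> Mn (Suc k). take k z \<in> C \<and> W j (take k z) (z ! k)}" for j C
  define \<D> where "\<D> = (\<Union>j\<in>{..N}. lift j ` \<C> j)"
  have conn: "dconn (Suc k) (lift j C)" if "C \<in> \<C> j" for j C
    unfolding lift_def
  proof (rule dconn_lift[OF C(2)[OF that] DW])
    have s: "t \<in> Mn k \<and> (\<exists>v. W j t v) \<and> \<not> E j t" if "t \<in> C" for t using C(3)[OF \<open>C \<in> \<C> j\<close>] that by (auto simp: Pj_def)
    show "\<exists>v. W j t v" if "t \<in> C" for t using s[OF that] by blast
    show "W j t w" if "t \<in> C" "W j t v" "W j t v'" "v \<le> w" "w \<le> v'" for t v v' w
      using convex[of t j v v' w] s[OF that(1)] that by blast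
    show "near (Suc k) (t @ [v]) (\<lambda>z. W j (take k z) (z ! k))" if "t \<in> C" "W j t v" for t v
      using opn s that by blast
  qed
  have sub: "lift j C \<subseteq> D" for j C
  proof
    fix z assume "z \<in> lift j C"
    then have "z \<in> Mn (Suc k)" "P (take k z) (z ! k)" by (auto simp: lift_def W_def)
    then show "z \<in> D" using snoc_split[of z k] by (simp add: P_def)
  qed
  have finD: "finite \<D>" unfolding \<D>_def using C(1) by auto
  have cD: "dconn (Suc k) X" "X \<subseteq> D" if "X \<in> \<D>" for X using that conn sub unfolding \<D>_def by blast+
  have DU: "DL (\<Union>\<D>)" "\<Union>\<D> \<subseteq> Mn (Suc k)" using D_Union_dconn[OF finD cD(1)] by auto
  define R where "R t v \<longleftrightarrow> t @ [v] \<in> D - \<Union>\<D>" for t v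
  have DR: "L.dpred (Suc k) (\<lambda>z. R (take k z) (z ! k))" unfolding R_def Diff_iff
    by (intro L.dpred_logic L.dpred_dmap[OF _ D(1)] L.dpred_dmap[OF _ DU(1)] L.dmap_basic)
  have DC: "DL (Pj j - \<Union>(\<C> j))" "Pj j - \<Union>(\<C> j) \<subseteq> Mn k" for j
    using L.D_Diff[OF DPj(1), of "\<Union>(\<C> j)" j k] D_Union_dconn[of "\<C> j" k] C DPj(2)[of j] by blast+
  define X where "X = {t \<in> Mn k. N < card {v. B t v}} \<union> ((\<Union>j\<in>{..N}. {t \<in> Mn k. E j t}) \<union> (\<Union>j\<in>{..N}. Pj j - \<Union>(\<C> j)))"
  have DN1: "DN {t \<in> Mn k. N < card {v. B t v}}"
    using L_dpred_card_ge[OF DB fin, of "Suc N"] DL_DN by (simp add: L.dpred_def Suc_le_eq)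
  have DN2: "DN {t \<in> Mn k. E j t}" for j using DE[of j] DL_DN by (simp add: L.dpred_def)
  have DN23: "DN (\<Union>j\<in>{..N}. {t \<in> Mn k. E j t})" "DN (\<Union>j\<in>{..N}. Pj j - \<Union>(\<C> j))"
    by (rule N.D_Union_finite[where n=k]; use DN2 DC DL_DN in auto)+
  have subs: "(\<Union>j\<in>{..N}. {t \<in> Mn k. E j t}) \<subseteq> Mn k" "(\<Union>j\<in>{..N}. Pj j - \<Union>(\<C> j)) \<subseteq> Mn k" using DC(2) by auto
  have X: "DN X" "X \<subseteq> Mn k" "small k X"
  proof -
    show "DN X" unfolding X_def using DN1 DN23 subs by (intro N.D_Un[where n=k]) auto
    show "X \<subseteq> Mn k" unfolding X_def using subs by auto
    have "small k (\<Union>j\<in>{..N}. {t \<in> Mn k. E j t})" "small k (\<Union>j\<in>{..N}. Pj j - \<Union>(\<C> j))"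
      by (rule small_Union_finite[where n=k]; use DN2 DC DL_DN sE C(4) in auto)+
    then show "small k X" unfolding X_def using DN1 DN23 subs N by (intro small_Un[where n=k] N.D_Un[where n=k]) auto
  qed
  \<comment> \<open>Outside the small set \<open>X\<close>, a point of \<open>D\<close> over
    \<open>t\<close> off the boundary lies in a lifted piece, so the remainder of the fibre is
    contained in the finite set \<open>B t\<close>.\<close>
  have inX: "t \<in> X" if t: "t \<in> Mn k" "infinite {v. R t v}" for t
  proof (rule ccontr)
    assume no: "t \<notin> X"
    have "{v. R t v} \<subseteq> {v. B t v}"
    proof (rule subsetI, rule CollectI, rule ccontr)
      fix v assume v: "v \<in> {v. R t v}" and nB: "\<not> B t v"
      define j where "j = card {w. B t w \<and> w < v}"
      have "j \<le> card {w. B t w}" unfolding j_def by (intro card_mono fin t) auto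
      then have jN: "j \<le> N" using no t by (auto simp: X_def)
      have W: "W j t v" using v nB by (simp add: W_def j_def R_def P_def)
      have "\<not> E j t" using no jN t by (auto simp: X_def)
      then have "t \<in> Pj j" using W t by (auto simp: Pj_def)
      then obtain C' where C': "C' \<in> \<C> j" "t \<in> C'" using no jN by (auto simp: X_def)
      then have "t @ [v] \<in> lift j C'" using W t by (auto simp: lift_def Mn_def nth_append)
      then have "t @ [v] \<in> \<Union>\<D>" using C' jN unfolding \<D>_def by blast
      then show False using v by (simp add: R_def)
    qed
    then show False using fin[OF t(1)] t(2) finite_subset by blast
  qed
  have "small k {t \<in> Mn k. infinite {v. R t v}}"
    by (rule small_subset[OF X(3) _ X(1) _ X(2)])
      (use L.dpred_not[OF L_dpred_finite[OF DR]] DL_DN inX in \<open>auto simp: L.dpred_def\<close>)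
  then have "small (Suc k) {z \<in> Mn (Suc k). R (take k z) (z ! k)}" using small_Suc_iff[OF DR] by simp
  moreover have "{z \<in> Mn (Suc k). R (take k z) (z ! k)} = D - \<Union>\<D>"
  proof -
    have "R (take k z) (z ! k) \<longleftrightarrow> z \<in> D - \<Union>\<D>" if "z \<in> Mn (Suc k)" for z
      unfolding R_def using snoc_split[OF that] by simp
    then show ?thesis using D(2) by blast
  qed
  ultimately show "\<exists>\<C>. finite \<C> \<and> (\<forall>C\<in>\<C>. dconn (Suc k) C \<and> C \<subseteq> D) \<and> small (Suc k) (D - \<Union>\<C>)"
    using finD cD by (intro exI[of _ \<D>]) auto
qed

lemma conn_decomp: "conn_decomp k"
  by (induction k) (auto intro: conn_decomp_0 conn_decomp_Suc)

end

section \<open>Pieces of full dimension\<close>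

lemma nths_Mn: "x \<in> Mn n \<Longrightarrow> s \<subseteq> {..<n} \<Longrightarrow> nths x s \<in> Mn (card s)"
  using length_nths_card[of s x] by (simp add: Mn_def)

lemma nths_single: "i < length x \<Longrightarrow> nths x {i} = [x ! i]"
proof (induction x arbitrary: i)
  case (Cons a x)
  show ?case
  proof (cases i)
    case 0 then show ?thesis by (simp add: nths_Cons)
  next
    case (Suc j)
    then have "{j. Suc j \<in> {i}} = {j}" by auto
    then show ?thesis using Suc Cons by (simp add: nths_Cons)
  qed
qed simp

lemma rank_unique:
  fixes v v' :: "'m::linorder"
  assumes "finite {w. P w}" "P v" "P v'" "card {w. P w \<and> w < v} = card {w. P w \<and> w < v'}"
  shows "v = v'"
proof -
  have *: "card {w. P w \<and> w < x} < card {w. P w \<and> w < y}" if "x < y" "P x" for x y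
  proof (rule psubset_card_mono)
    show "finite {w. P w \<and> w < y}" using assms(1) by (rule rev_finite_subset) auto
    show "{w. P w \<and> w < x} \<subset> {w. P w \<and> w < y}" using that by (auto intro: less_trans)
  qed
  show ?thesis using *[of v v'] *[of v' v] assms by (metis less_irrefl linorder_neqE)
qed

context tame_pair begin

text \<open>An infinite set of tuples takes infinitely many values in some coordinate; these contain
  an interval, so that coordinate projection has interior.\<close>

lemma small_1_iff_finite:
  assumes X: "DL X" "X \<subseteq> Mn n"
  shows "small 1 X \<longleftrightarrow> finite X"
proof
  assume "finite X" then show "small 1 X" using X small_finite by blast
next
  assume s: "small 1 X"
  have fin: "finite {v. \<exists>x\<in>Mn n. x \<in> X \<and> x ! i = v}" if i: "i < n" for i
  proof (rule ccontr)
    assume inf: "infinite {v. \<exists>x\<in>Mn n. x \<in> X \<and> x ! i = v}"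
    have "L.dpred 1 (\<lambda>z. \<exists>x\<in>Mn n. x \<in> X \<and> x ! i = z ! 0)"
      by (intro L.dpred_ex L.dpred_logic L.dpred_atoms L.dpred_dmap[OF _ X(1)] L.dmap_basic)
    from infinite_has_interval[OF this inf] obtain c d where
      cd: "c < d" "\<forall>v. c < v \<and> v < d \<longrightarrow> (\<exists>x\<in>Mn n. x \<in> X \<and> x ! i = v)" by blast
    have "nonempty_interior (card {i}) ((\<lambda>x. nths x {i}) ` X)"
      unfolding nonempty_interior_iff
    proof (rule bexI[of _ "[c]"], rule bexI[of _ "[d]"], rule conjI)
      show "box (card {i}) [c] [d] \<noteq> {}" using dense[OF cd(1)] by (auto simp: box_1)
      show "box (card {i}) [c] [d] \<subseteq> (\<lambda>x. nths x {i}) ` X"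
      proof
        fix y assume "y \<in> box (card {i}) [c] [d]"
        then obtain v where v: "y = [v]" "c < v" "v < d" by (auto simp: box_1)
        then obtain x where "x \<in> Mn n" "x \<in> X" "x ! i = v" using cd by blast
        then show "y \<in> (\<lambda>x. nths x {i}) ` X"
          using v i nths_single[of i x] by (intro image_eqI[of _ _ x]) (auto simp: Mn_def)
      qed
    qed (auto simp: Mn_def)
    then show False using s odim_less_iff[OF X(2), of 1] i unfolding small_def dim_DL[OF X(1)] by force
  qed
  define U where "U = (\<Union>i\<in>{..<n}. {v. \<exists>x\<in>Mn n. x \<in> X \<and> x ! i = v})"
  have "X \<subseteq> {xs. set xs \<subseteq> U \<and> length xs = n}"
  proof
    fix x assume x: "x \<in> X"
    then have l: "length x = n" using X(2) by (auto simp: Mn_def)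
    then show "x \<in> {xs. set xs \<subseteq> U \<and> length xs = n}"
      using x unfolding U_def by (force simp: in_set_conv_nth Mn_def)
  qed
  moreover have "finite U" unfolding U_def using fin by auto
  ultimately show "finite X" using finite_lists_length_eq[of U n] finite_subset by blast
qed

text \<open>The injection \<open>\<phi>\<close> is the chart through which (D6), available only on
  full powers of \<open>M\<close>, reaches subsets of lower dimension.\<close>

definition piece :: "nat \<Rightarrow> nat \<Rightarrow> 'm list set \<Rightarrow> bool" where
  "piece d n W \<longleftrightarrow> DL W \<and> W \<subseteq> Mn n \<and> (\<exists>\<phi>. L.dmap n \<phi> \<and> (\<forall>x\<in>Mn n. \<phi> x \<in> Mn d) \<and> inj_on \<phi> W)"

text \<open>Finite fibres have dimension at most 0, so the upper Fubini estimate with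
  \<open>b = 0\<close> applies to the transposed graph of \<open>f\<close>.\<close>

lemma small_finite_fibers:
  assumes X: "DN X" "X \<subseteq> Mn n" and f: "N.dmap n f" "\<And>x. x \<in> Mn n \<Longrightarrow> f x \<in> Mn k"
    and E: "DN E" "E \<subseteq> Mn k" "small k E" and fE: "f ` X \<subseteq> E"
    and fin: "\<And>t. t \<in> E \<Longrightarrow> finite {x \<in> X. f x = t}"
  shows "small k X"
proof -
  define S where "S = (\<lambda>x. f x @ x) ` X"
  have dm: "N.dmap n (\<lambda>x. f x @ x)" by (intro N.dmap_append f N.dmap_id)
  have S: "DN S" "S \<subseteq> Mn (k + n)" using N.D_image[OF X dm] X(2) f(2) by (auto simp: S_def Mn_def)
  have fib: "fiber S t = {x \<in> X. f x = t}" if "t \<in> Mn k" for t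
    using that X(2) f(2) by (fastforce simp: S_def fiber_def Mn_def image_iff)
  have ne: "{t \<in> Mn k. fiber S t \<noteq> {}} \<subseteq> E"
  proof
    fix t assume "t \<in> {t \<in> Mn k. fiber S t \<noteq> {}}"
    then have "{x \<in> X. f x = t} \<noteq> {}" using fib[of t] by auto
    then show "t \<in> E" using fE by auto
  qed
  have Dne: "DN {t \<in> Mn k. fiber S t \<noteq> {}}"
    using N.dpred_not[OF dpred_fiber_small[OF S, of 0]] small_0_iff[OF N_fiber[OF S]]
    by (simp add: N.dpred_def cong: conj_cong)
  have e: "{t \<in> Mn k. \<not> small 0 (fiber S t)} = {t \<in> Mn k. fiber S t \<noteq> {}}"
    using small_0_iff[OF N_fiber[OF S]] by auto
  have s: "small k {t \<in> Mn k. fiber S t \<noteq> {}}" by (rule small_subset[OF E(3) Dne E(1) ne E(2)])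
  have "small (k + 0) S"
  proof (rule fubini_upper[OF S])
    show "small (Suc k) {t \<in> Mn k. fiber S t \<noteq> {}}" using s by (rule small_weaken) simp
    show "small k {t \<in> Mn k. \<not> small 0 (fiber S t)}" using s e by simp
    show "small (Suc 0) (fiber S t)" if t: "t \<in> Mn k" for t
    proof (cases "t \<in> E")
      case True then show ?thesis using fib[OF t] fin[OF True] X(2) small_finite[of "fiber S t" n] by auto
    next
      case False then have "fiber S t = {}" using ne t by blast
      then show ?thesis by (simp add: small_empty)
    qed
  qed
  then show ?thesis
    using small_inj[OF X dm, of S k "k + n"] S X(2) f(2) by (auto simp: S_def inj_on_def Mn_def subset_iff)
qed

text \<open>Almost every point of \<open>V\<close> has a finite fibre under some projection to
  \<open>k\<close> coordinates. Where the fibres of a projection are finite, uniform finiteness in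
  each remaining direction bounds the number of values, and their ranks separate the points of a
  fibre by finitely many labels.\<close>

lemma piece_decomposition:
  assumes V: "DL V" "V \<subseteq> Mn n" "small (Suc k) V"
  shows "\<exists>\<W>. finite \<W> \<and> (\<forall>W\<in>\<W>. piece k n W \<and> W \<subseteq> V) \<and> small k (V - \<Union>\<W>)"
proof -
  define I where "I = {s. s \<subseteq> {..<n} \<and> card s = k}"
  have fI: "finite I" unfolding I_def by auto
  have pr: "nths x s \<in> Mn k" if "s \<in> I" "x \<in> Mn n" for x s using that nths_Mn[of x n s] by (auto simp: I_def)
  have Dfib: "L.dpred (k + n) (\<lambda>z. drop k z \<in> V \<and> nths (drop k z) s = take k z)" for s
    by (intro L.dpred_logic L.dpred_atoms L.dpred_dmap[OF _ V(1)] L.dmap_basic)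
  \<comment> \<open>The parameters with infinite fibre. If they were not small for some
    \<open>s\<close>, the lower Fubini estimate would force dimension at least \<open>k + 1\<close>
    on \<open>V\<close>.\<close>
  define T where "T s t \<longleftrightarrow> \<not> small 1 {x \<in> Mn n. x \<in> V \<and> nths x s = t}" for s t
  have DT: "L.dpred k (T s)" for s unfolding T_def by (intro L.dpred_not L_dpred_small Dfib)
  have sT: "small k {t \<in> Mn k. T s t}" if s: "s \<in> I" for s
  proof (rule ccontr)
    assume ns: "\<not> ?thesis"
    define S where "S = {z \<in> Mn (k + n). drop k z \<in> V \<and> nths (drop k z) s = take k z}"
    have S: "DN S" "S \<subseteq> Mn (k + n)" using dpred_LN[OF Dfib[of s]] by (auto simp: S_def N.dpred_def)
    have "fiber S t = {x \<in> Mn n. x \<in> V \<and> nths x s = t}" if "t \<in> Mn k" for t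
      unfolding S_def using fiber_Collect[OF that, of n "\<lambda>t x. x \<in> V \<and> nths x s = t"] .
    then have "{t \<in> Mn k. \<not> small 1 (fiber S t)} = {t \<in> Mn k. T s t}" unfolding T_def by auto
    then have "\<not> small (k + 1) S" using fubini_lower[OF S, of k 1] ns by simp
    moreover have "small (Suc k) S"
    proof (rule small_inj[OF S _ _ _ V(3) DL_DN[OF V(1)] V(2), of "drop k"])
      show "inj_on (drop k) S" by (rule inj_onI) (auto simp: S_def, metis append_take_drop_id)
    qed (auto simp: S_def intro!: N.dmap_basic)
    ultimately show False by simp
  qed
  define B where "B s = {x \<in> V. \<not> T s (nths x s)}" for s
  have DB: "DL (B s)" "B s \<subseteq> Mn n" if "s \<in> I" for s unfolding B_def using that V(2)
    by (auto intro!: L.D_Collect'[OF V(1,2)] L.dpred_not L.dpred_comp[OF DT] L.dmap_basic simp: pr)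
  have finB: "finite {x \<in> B s. nths x s = t}" if "s \<in> I" "t \<in> Mn k" for s t
  proof (cases "T s t")
    case True then have "{x \<in> B s. nths x s = t} = {}" by (auto simp: B_def)
    then show ?thesis by (metis finite.emptyI)
  next
    case False
    have "L.dpred n (\<lambda>x. x \<in> V \<and> nths x s = t)"
      by (intro L.dpred_logic L.dpred_atoms L.D_dpred V(1) L.dmap_basic)
    then have "finite {x \<in> Mn n. x \<in> V \<and> nths x s = t}"
      using False small_1_iff_finite[of "{x \<in> Mn n. x \<in> V \<and> nths x s = t}" n] by (auto simp: T_def L.dpred_def)
    then show ?thesis by (rule rev_finite_subset) (use V(2) in \<open>auto simp: B_def\<close>)
  qed
  \<comment> \<open>The points that no \<open>B s\<close> contains. Every projection to
    \<open>k\<close> coordinates sends them into the small set \<open>T s\<close>, and larger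
    projections have no interior already on \<open>V\<close>, so \<open>V'\<close> is small.\<close>
  define V' where "V' = {x \<in> V. \<forall>s\<in>I. T s (nths x s)}"
  have V': "DL V'" "V' \<subseteq> Mn n" unfolding V'_def using V(2)
    by (auto intro!: L.D_Collect'[OF V(1,2)] L.dpred_all_finite fI L.dpred_comp[OF DT] L.dmap_basic simp: pr)
  have sV': "small k V'" unfolding small_def dim_DL[OF V'(1)] odim_less_iff[OF V'(2)]
  proof (intro allI impI notI)
    fix s assume s: "s \<subseteq> {..<n}" "k \<le> card s" "nonempty_interior (card s) ((\<lambda>x. nths x s) ` V')"
    show False
    proof (cases "card s = k")
      case True
      then have "s \<in> I" using s by (simp add: I_def)
      then have "(\<lambda>x. nths x s) ` V' \<subseteq> {t \<in> Mn k. T s t}" using pr V'(2) by (auto simp: V'_def)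
      then have "nonempty_interior k {t \<in> Mn k. T s t}" using s(3) True nonempty_interior_mono by blast
      then show False using sT[OF \<open>s \<in> I\<close>] small_full_iff[of "{t \<in> Mn k. T s t}" k] DT[of s] by (auto simp: L.dpred_def)
    next
      case False
      then have "Suc k \<le> card s" using s by simp
      then have "\<not> nonempty_interior (card s) ((\<lambda>x. nths x s) ` V)"
        using V(3) s(1) unfolding small_def dim_DL[OF V(1)] odim_less_iff[OF V(2)] by blast
      moreover have "(\<lambda>x. nths x s) ` V' \<subseteq> (\<lambda>x. nths x s) ` V" by (auto simp: V'_def)
      ultimately show False using s(3) nonempty_interior_mono by blast
    qed
  qed
  have step: "\<exists>\<W>. finite \<W> \<and> (\<forall>W\<in>\<W>. piece k n W \<and> W \<subseteq> V) \<and> small k (B s - \<Union>\<W>)" if s: "s \<in> I" for s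
  proof -
    define A where "A i t v \<longleftrightarrow> (\<exists>x\<in>Mn n. x \<in> B s \<and> nths x s = t \<and> x ! i = v)" for i :: nat and t v
    have DA: "L.dpred (Suc k) (\<lambda>z. A i (take k z) (z ! k))" for i unfolding A_def
      by (intro L.dpred_ex L.dpred_logic L.dpred_atoms L.dpred_dmap[OF _ DB(1)[OF s]] L.dmap_basic)
    have finA: "finite {v. A i t v}" if "t \<in> Mn k" for i t
    proof -
      have "{v. A i t v} \<subseteq> (\<lambda>x. x ! i) ` {x \<in> B s. nths x s = t}" by (auto simp: A_def)
      then show ?thesis using finB[OF s that] finite_surj by blast
    qed
    have "\<forall>i. \<exists>N. small k {t \<in> Mn k. N < card {v. A i t v}}"
      using uniform_finiteness[OF conn_decomp DA finA] by blast
    then obtain Nf where Nf: "\<And>i. small k {t \<in> Mn k. Nf i < card {v. A i t v}}" by metis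
    obtain N where N: "\<And>i. i < n \<Longrightarrow> Nf i \<le> N"
      using finite_nat_set_iff_bounded_le[of "Nf ` {..<n}"] by auto
    define E where "E = (\<Union>i\<in>{..<n}. {t \<in> Mn k. Nf i < card {v. A i t v}})"
    have DEi: "DL {t \<in> Mn k. Nf i < card {v. A i t v}}" for i
      using L_dpred_card_ge[of k "A i", OF DA finA, of "Suc (Nf i)"] by (simp add: L.dpred_def Suc_le_eq)
    have E: "DL E" "E \<subseteq> Mn k" "small k E"
      unfolding E_def using DEi DL_DN Nf
      by (auto intro!: L.D_Union_finite[where n=k] small_Union_finite[where n=k])
    define J where "J = {js. set js \<subseteq> {..N} \<and> length js = n}"
    have fJ: "finite J" unfolding J_def by (intro finite_lists_length_eq) simp
    \<comment> \<open>The label \<open>js\<close> prescribes the rank of each coordinate of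
      \<open>x\<close> among the values of that coordinate in its fibre. Projection and label
      together determine \<open>x\<close>, which makes the projection injective on
      \<open>W js\<close>.\<close>
    define W where "W js = {x \<in> B s. \<forall>i<n. card {w. A i (nths x s) w \<and> w < x ! i} = js ! i}" for js
    have DW: "DL (W js)" for js unfolding W_def
    proof (intro L.D_Collect'[OF DB[OF s]] L.dpred_all_less)
      fix i assume "i < n"
      show "L.dpred n (\<lambda>x. card {w. A i (nths x s) w \<and> w < x ! i} = js ! i)"
        by (rule L.dpred_scalar_comp[where P = "\<lambda>t v. card {w. A i t w \<and> w < v} = js ! i", OF L_dpred_rank_eq[of k "A i", OF DA finA]])
         (auto intro!: L.dmap_basic pr s)
    qed
    have pW: "piece k n (W js)" for js unfolding piece_def
    proof (intro conjI exI[of _ "\<lambda>x. nths x s"])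
      show "W js \<subseteq> Mn n" using DB(2)[OF s] by (auto simp: W_def)
      show "inj_on (\<lambda>x. nths x s) (W js)"
      proof (rule inj_onI)
        fix x y assume xy: "x \<in> W js" "y \<in> W js" "nths x s = nths y s"
        have m: "x \<in> Mn n" "y \<in> Mn n" "x \<in> B s" "y \<in> B s" using xy DB(2)[OF s] by (auto simp: W_def)
        have "x ! i = y ! i" if "i < n" for i
        proof (rule rank_unique[of "A i (nths x s)"])
          show "finite {w. A i (nths x s) w}" using finA pr[OF s m(1)] by blast
          show "A i (nths x s) (x ! i)" "A i (nths x s) (y ! i)" using m xy(3) by (auto simp: A_def)
          show "card {w. A i (nths x s) w \<and> w < x ! i} = card {w. A i (nths x s) w \<and> w < y ! i}"
            using xy that by (auto simp: W_def)
        qed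
        then show "x = y" using m by (auto simp: Mn_def list_eq_iff_nth_eq)
      qed
    qed (auto intro!: DW L.dmap_basic pr s)
    have cover: "B s - \<Union>(W ` J) \<subseteq> {x \<in> B s. nths x s \<in> E}"
    proof
      fix x assume x: "x \<in> B s - \<Union>(W ` J)"
      then have xn: "x \<in> Mn n" and xB: "x \<in> B s" using DB(2)[OF s] by auto
      define js where "js = map (\<lambda>i. card {w. A i (nths x s) w \<and> w < x ! i}) [0..<n]"
      have "nths x s \<in> E"
      proof (rule ccontr)
        assume nE: "nths x s \<notin> E"
        have "card {w. A i (nths x s) w \<and> w < x ! i} \<le> N" if "i < n" for i
        proof -
          have "card {w. A i (nths x s) w \<and> w < x ! i} \<le> card {w. A i (nths x s) w}"
            by (intro card_mono finA pr s xn) auto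
          also have "\<dots> \<le> Nf i" using nE that pr[OF s xn] unfolding E_def by (simp add: not_less)
          finally show ?thesis using N[OF that] by simp
        qed
        then have "js \<in> J" by (auto simp: J_def js_def)
        moreover have "x \<in> W js" using xB by (auto simp: W_def js_def)
        ultimately show False using x by blast
      qed
      then show "x \<in> {x \<in> B s. nths x s \<in> E}" using xB by blast
    qed
    have R: "DL {x \<in> B s. nths x s \<in> E}"
      by (intro L.D_Collect'[OF DB[OF s]] L.dpred_dmap[OF _ E(1)] L.dmap_basic)
    have sR: "small k {x \<in> B s. nths x s \<in> E}"
    proof (rule small_finite_fibers[OF DL_DN[OF R] _ _ _ DL_DN[OF E(1)] E(2,3), of n "\<lambda>x. nths x s"])
      show "finite {x \<in> {x \<in> B s. nths x s \<in> E}. nths x s = t}" if "t \<in> E" for t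
        using finB[OF s, of t] E(2) that by (auto elim!: rev_finite_subset)
    qed (use DB(2)[OF s] in \<open>auto intro!: N.dmap_basic pr s\<close>)
    have DU: "DL (\<Union>(W ` J))" "\<Union>(W ` J) \<subseteq> Mn n"
      using L.D_Union_finite[OF fJ, of W n] pW by (auto simp: piece_def)
    have "small k (B s - \<Union>(W ` J))"
      by (rule small_subset[OF sR DL_DN[OF L.D_Diff[OF DB(1)[OF s] DU(1) DB(2)[OF s] DU(2)]] DL_DN[OF R] cover, of n])
        (use DB(2)[OF s] in auto)
    moreover have "W js \<subseteq> V" for js by (auto simp: W_def B_def)
    ultimately show ?thesis using fJ pW by (intro exI[of _ "W ` J"]) auto
  qed
  then obtain \<W> where w: "\<And>s. s \<in> I \<Longrightarrow> finite (\<W> s)" "\<And>s W. s \<in> I \<Longrightarrow> W \<in> \<W> s \<Longrightarrow> piece k n W \<and> W \<subseteq> V"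
    "\<And>s. s \<in> I \<Longrightarrow> small k (B s - \<Union>(\<W> s))" by metis
  define \<U> where "\<U> = (\<Union>s\<in>I. \<W> s)"
  have fU: "finite \<U>" using fI w(1) by (auto simp: \<U>_def)
  have pU: "\<And>W. W \<in> \<U> \<Longrightarrow> piece k n W \<and> W \<subseteq> V" using w(2) by (auto simp: \<U>_def)
  have DUs: "DL (\<Union>\<U>)" "\<Union>\<U> \<subseteq> Mn n"
    using L.D_Union_finite[OF fU, of "\<lambda>W. W" n] pU by (auto simp: piece_def)
  have DWs: "DL (\<Union>(\<W> s))" "\<Union>(\<W> s) \<subseteq> Mn n" if "s \<in> I" for s
    using L.D_Union_finite[OF w(1)[OF that], of "\<lambda>W. W" n] w(2)[OF that] unfolding piece_def by (simp, blast)
  have Dd: "DN (B s - \<Union>(\<W> s))" "B s - \<Union>(\<W> s) \<subseteq> Mn n" if "s \<in> I" for s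
    using DL_DN[OF L.D_Diff[OF DB(1)[OF that] DWs(1)[OF that] DB(2)[OF that] DWs(2)[OF that]]] DB(2)[OF that] by auto
  have "small k (\<Union>s\<in>I. B s - \<Union>(\<W> s))" by (rule small_Union_finite[OF fI, of _ n]) (use Dd w(3) in auto)
  moreover have DI: "DN (\<Union>s\<in>I. B s - \<Union>(\<W> s))" by (rule N.D_Union_finite[OF fI, of _ n]) (use Dd in auto)
  moreover have subI: "(\<Union>s\<in>I. B s - \<Union>(\<W> s)) \<subseteq> Mn n" using Dd by auto
  ultimately have "small k (V' \<union> (\<Union>s\<in>I. B s - \<Union>(\<W> s)))" "DN (V' \<union> (\<Union>s\<in>I. B s - \<Union>(\<W> s)))"
    using sV' V' DL_DN by (auto intro!: small_Un[where n=n] N.D_Un[where n=n])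
  moreover have "V - \<Union>\<U> \<subseteq> V' \<union> (\<Union>s\<in>I. B s - \<Union>(\<W> s))"
    unfolding V'_def B_def \<U>_def by blast
  moreover have "DN (V - \<Union>\<U>)" by (intro DL_DN L.D_Diff[where n=n] V DUs)
  ultimately have "small k (V - \<Union>\<U>)" using small_subset[of k _ "V - \<Union>\<U>" n] V'(2) subI by blast
  then show ?thesis using fU pU by blast
qed

text \<open>To meet the form of (D6), \<open>f\<close> is transported along the inverse of
  \<open>\<phi>\<close> and extended by a constant to a function \<open>g\<close> on
  \<open>Mn d\<close>. The o-minimal approximation of \<open>g\<close> is pulled back along
  \<open>\<phi>\<close>, which embeds the set of failures into a small set.\<close>

lemma approx_piece:
  assumes W: "piece d m W" and f: "N.dmap m (\<lambda>x. [f x])"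
  shows "\<exists>F. L.dmap m (\<lambda>x. [F x]) \<and> small d {x \<in> W. f x \<noteq> F x}"
proof -
  obtain \<phi> where p: "DL W" "W \<subseteq> Mn m" "L.dmap m \<phi>" "\<And>x. x \<in> Mn m \<Longrightarrow> \<phi> x \<in> Mn d" "inj_on \<phi> W"
    using W by (auto simp: piece_def)
  define c0 :: 'm where "c0 = undefined"
  define g where "g y = (if \<exists>x\<in>Mn m. x \<in> W \<and> \<phi> x = y then f (inv_into W \<phi> y) else c0)" for y
  have inv: "inv_into W \<phi> (\<phi> x) = x" if "x \<in> W" for x using that p(5) by simp
  have Dex: "N.dpred d (\<lambda>y. \<exists>x\<in>Mn m. x \<in> W \<and> \<phi> x = y)"
    by (intro N.dpred_ex N.dpred_logic N.dpred_atoms N.dpred_dmap[OF _ DL_DN[OF p(1)]] N.dmap_basic N.dmap_comp[OF dmap_LN[OF p(3)]]) (auto simp: Mn_def)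
  have g: "N.dmap d (\<lambda>y. [g y])"
  proof (rule N.dmapI[where m = 1 and R = "\<lambda>y v. (\<exists>x\<in>Mn m. (x \<in> W \<and> \<phi> x = y) \<and> v = [f x]) \<or> \<not> (\<exists>x\<in>Mn m. x \<in> W \<and> \<phi> x = y) \<and> v = [c0]"])
    show "N.dpred (d + 1) (\<lambda>z. (\<exists>x\<in>Mn m. (x \<in> W \<and> \<phi> x = take d z) \<and> drop d z = [f x]) \<or> \<not> (\<exists>x\<in>Mn m. x \<in> W \<and> \<phi> x = take d z) \<and> drop d z = [c0])"
      by (intro N.dpred_ex N.dpred_logic N.dpred_eq N.dpred_comp[OF Dex] N.dpred_dmap[OF _ DL_DN[OF p(1)]] N.dmap_basic
          N.dmap_comp[OF dmap_LN[OF p(3)]] N.dmap_comp[OF f]) (auto simp: Mn_def)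
    fix y v :: "'m list" assume "y \<in> Mn d" "v \<in> Mn 1"
    show "(v = [g y]) = ((\<exists>x\<in>Mn m. (x \<in> W \<and> \<phi> x = y) \<and> v = [f x]) \<or> \<not> (\<exists>x\<in>Mn m. x \<in> W \<and> \<phi> x = y) \<and> v = [c0])"
    proof (cases "\<exists>x\<in>Mn m. x \<in> W \<and> \<phi> x = y")
      case True
      then obtain x where x: "x \<in> Mn m" "x \<in> W" "\<phi> x = y" by blast
      have u: "x' = x" if "x' \<in> W" "\<phi> x' = y" for x'
        using inj_onD[OF p(5), of x' x] that x by simp
      have "inv_into W \<phi> y = x" using inv[OF x(2)] unfolding x(3) .
      then have "g y = f x" unfolding g_def using True by simp
      moreover have "(\<exists>x'\<in>Mn m. (x' \<in> W \<and> \<phi> x' = y) \<and> v = [f x']) \<longleftrightarrow> v = [f x]"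
        using u x by blast
      ultimately show ?thesis using True by simp
    qed (auto simp: g_def)
  qed (auto simp: Mn_def)
  obtain F E where F: "L.dmap d (\<lambda>y. [F y])" "DN E" "E \<subseteq> Mn d" "small d E" "\<And>y. y \<in> Mn d - E \<Longrightarrow> g y = F y"
    using dim_approx[OF g] unfolding small_def by blast
  have DF: "L.dmap m (\<lambda>x. [F (\<phi> x)])" using L.dmap_comp[OF F(1) p(3,4)] .
  have "DN {x \<in> W. f x \<noteq> F (\<phi> x)}"
    by (intro N.D_Collect'[OF DL_DN[OF p(1)] p(2)] N.dpred_not N.dpred_eq1 f dmap_LN[OF DF])
  then have "small d {x \<in> W. f x \<noteq> F (\<phi> x)}"
  proof (rule small_inj[OF _ _ dmap_LN[OF p(3)] _ _ F(4,2,3)])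
    show "inj_on \<phi> {x \<in> W. f x \<noteq> F (\<phi> x)}" using p(5) by (rule inj_on_subset) auto
    show "\<phi> ` {x \<in> W. f x \<noteq> F (\<phi> x)} \<subseteq> E"
    proof (rule image_subsetI, rule ccontr)
      fix x assume x: "x \<in> {x \<in> W. f x \<noteq> F (\<phi> x)}" "\<phi> x \<notin> E"
      then have "g (\<phi> x) = F (\<phi> x)" using F(5) p(2,4) by blast
      moreover have "g (\<phi> x) = f x" using x inv p(2) unfolding g_def by auto
      ultimately show False using x by simp
    qed
  qed (use p(2) in auto)
  then show ?thesis using DF by (intro exI[of _ "\<lambda>x. F (\<phi> x)"]) auto
qed

lemma approx_pieces:
  assumes "finite \<W>" "\<And>W. W \<in> \<W> \<Longrightarrow> piece d m W" and f: "N.dmap m (\<lambda>x. [f x])"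
  shows "\<exists>F. L.dmap m (\<lambda>x. [F x]) \<and> small d {x \<in> \<Union>\<W>. f x \<noteq> F x}"
  using assms(1,2)
proof (induction \<W> rule: finite_induct)
  case empty
  then show ?case using small_empty by (intro exI[of _ "\<lambda>_. undefined"]) (auto intro: L.dmap_const)
next
  case (insert W \<W>)
  then obtain F1 where F1: "L.dmap m (\<lambda>x. [F1 x])" "small d {x \<in> \<Union>\<W>. f x \<noteq> F1 x}" by blast
  obtain F2 where F2: "L.dmap m (\<lambda>x. [F2 x])" "small d {x \<in> W. f x \<noteq> F2 x}"
    using approx_piece[OF _ f, of d W] insert by blast
  have W: "DL W" "W \<subseteq> Mn m" using insert by (auto simp: piece_def)
  have U: "DL (\<Union>\<W>)" "\<Union>\<W> \<subseteq> Mn m"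
    using L.D_Union_finite[OF insert(1), of "\<lambda>W. W" m] insert unfolding piece_def by (simp, blast)
  have D: "DN {x \<in> \<Union>\<W>. f x \<noteq> F1 x}" "DN {x \<in> W. f x \<noteq> F2 x}"
    by (intro N.D_Collect'[OF DL_DN[OF U(1)] U(2)] N.D_Collect'[OF DL_DN[OF W(1)] W(2)] N.dpred_not N.dpred_eq1 f dmap_LN F1(1) F2(1))+
  \<comment> \<open>Pieces may overlap. Giving \<open>W\<close> priority is harmless, since
    \<open>F2\<close> matches \<open>f\<close> on \<open>W\<close> up to a small set.\<close>
  define F where "F x = (if x \<in> W then F2 x else F1 x)" for x
  have DF: "L.dmap m (\<lambda>x. [F x])" unfolding F_def
    by (intro L.dmap_if1 L.D_dpred W F1(1) F2(1))
  have "DN {x \<in> \<Union>(insert W \<W>). f x \<noteq> F x}"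
    by (rule N.D_Collect'[of _ m]) (use L.D_Un[OF W(1) U(1) W(2) U(2)] W U DL_DN in \<open>auto intro!: N.dpred_not N.dpred_eq1 f dmap_LN DF\<close>)
  moreover have "small d ({x \<in> \<Union>\<W>. f x \<noteq> F1 x} \<union> {x \<in> W. f x \<noteq> F2 x})"
    by (rule small_Un[OF F1(2) F2(2) D, of m]) (use W U in auto)
  moreover have "DN ({x \<in> \<Union>\<W>. f x \<noteq> F1 x} \<union> {x \<in> W. f x \<noteq> F2 x})"
    by (rule N.D_Un[OF D, of m]) (use W U in auto)
  ultimately have "small d {x \<in> \<Union>(insert W \<W>). f x \<noteq> F x}"
    by (rule_tac small_subset[of d "{x \<in> \<Union>\<W>. f x \<noteq> F1 x} \<union> {x \<in> W. f x \<noteq> F2 x}" _ m]) (use W U in \<open>auto simp: F_def\<close>)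
  then show ?case using DF by blast
qed

lemma approx_map:
  assumes W: "finite \<W>" "\<And>W. W \<in> \<W> \<Longrightarrow> piece d m W"
    and f: "N.dmap m f" "\<And>x. x \<in> Mn m \<Longrightarrow> f x \<in> Mn n"
  shows "\<exists>F. L.dmap m F \<and> (\<forall>x\<in>Mn m. F x \<in> Mn n) \<and> small d {x \<in> \<Union>\<W>. f x \<noteq> F x}"
  using f
proof (induction n arbitrary: f)
  case 0
  have U: "\<Union>\<W> \<subseteq> Mn m" using W(2) by (auto simp: piece_def)
  have "{x \<in> \<Union>\<W>. f x \<noteq> []} = {}" using 0(2) U by (auto simp: Mn_def)
  then have "small d {x \<in> \<Union>\<W>. f x \<noteq> []}" by (simp only: small_empty)
  moreover have "\<forall>x\<in>Mn m. [] \<in> Mn 0" by (simp add: Mn_def)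
  ultimately show ?case using L.dmap_const[of m "[]"] by (intro exI[of _ "\<lambda>_. []"]) blast
next
  case (Suc n)
  have U: "DL (\<Union>\<W>)" "\<Union>\<W> \<subseteq> Mn m"
    using L.D_Union_finite[OF W(1), of "\<lambda>W. W" m] W(2) unfolding piece_def by (simp, blast)
  have "N.dmap m (\<lambda>x. take n (f x))" by (intro N.dmap_take Suc.prems)
  from Suc.IH[OF this] Suc.prems(2) obtain F1 where F1: "L.dmap m F1" "\<And>x. x \<in> Mn m \<Longrightarrow> F1 x \<in> Mn n"
    "small d {x \<in> \<Union>\<W>. take n (f x) \<noteq> F1 x}" by (force simp: Mn_def)
  have fn: "N.dmap m (\<lambda>x. [f x ! n])" by (intro N.dmap_nth Suc.prems)
  obtain F2 where F2: "L.dmap m (\<lambda>x. [F2 x])" "small d {x \<in> \<Union>\<W>. f x ! n \<noteq> F2 x}"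
    using approx_pieces[OF W fn] by blast
  have DF: "L.dmap m (\<lambda>x. F1 x @ [F2 x])" by (intro L.dmap_append F1 F2)
  have D: "DN {x \<in> \<Union>\<W>. take n (f x) \<noteq> F1 x}" "DN {x \<in> \<Union>\<W>. f x ! n \<noteq> F2 x}" "DN {x \<in> \<Union>\<W>. f x \<noteq> F1 x @ [F2 x]}"
    by (intro N.D_Collect'[OF DL_DN[OF U(1)] U(2)] N.dpred_not N.dpred_eq N.dpred_eq1 fn N.dmap_take Suc.prems dmap_LN F1(1) F2(1) DF)+
  have "small d ({x \<in> \<Union>\<W>. take n (f x) \<noteq> F1 x} \<union> {x \<in> \<Union>\<W>. f x ! n \<noteq> F2 x})"
    by (rule small_Un[OF F1(3) F2(2) D(1,2), of m]) (use U in auto)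
  moreover have "DN ({x \<in> \<Union>\<W>. take n (f x) \<noteq> F1 x} \<union> {x \<in> \<Union>\<W>. f x ! n \<noteq> F2 x})"
    by (rule N.D_Un[OF D(1,2), of m]) (use U in auto)
  moreover have "{x \<in> \<Union>\<W>. f x \<noteq> F1 x @ [F2 x]} \<subseteq> {x \<in> \<Union>\<W>. take n (f x) \<noteq> F1 x} \<union> {x \<in> \<Union>\<W>. f x ! n \<noteq> F2 x}"
  proof
    fix x assume x: "x \<in> {x \<in> \<Union>\<W>. f x \<noteq> F1 x @ [F2 x]}"
    then have "f x \<in> Mn (Suc n)" using Suc.prems(2) U(2) by blast
    then show "x \<in> {x \<in> \<Union>\<W>. take n (f x) \<noteq> F1 x} \<union> {x \<in> \<Union>\<W>. f x ! n \<noteq> F2 x}"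
      using x snoc_split[of "f x" n] by auto
  qed
  moreover have "{x \<in> \<Union>\<W>. take n (f x) \<noteq> F1 x} \<union> {x \<in> \<Union>\<W>. f x ! n \<noteq> F2 x} \<subseteq> Mn m" using U(2) by auto
  ultimately have "small d {x \<in> \<Union>\<W>. f x \<noteq> F1 x @ [F2 x]}"
    using small_subset[OF _ D(3)] by simp
  moreover have "\<forall>x\<in>Mn m. F1 x @ [F2 x] \<in> Mn (Suc n)" using F1(2) by (simp add: Mn_def)
  ultimately show ?case using DF by blast
qed

text \<open>Charts of the factors are placed side by side. In this way (D6) in \<open>d + e\<close>
  variables applies to functions of two arguments.\<close>

lemma piece_product:
  assumes "piece d n W" "piece e n W'"
  shows "piece (d + e) (n + n) {x @ y | x y. x \<in> W \<and> y \<in> W'}"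
proof -
  obtain \<phi> where p: "DL W" "W \<subseteq> Mn n" "L.dmap n \<phi>" "\<And>x. x \<in> Mn n \<Longrightarrow> \<phi> x \<in> Mn d" "inj_on \<phi> W"
    using assms(1) by (auto simp: piece_def)
  obtain \<psi> where q: "DL W'" "W' \<subseteq> Mn n" "L.dmap n \<psi>" "\<And>x. x \<in> Mn n \<Longrightarrow> \<psi> x \<in> Mn e" "inj_on \<psi> W'"
    using assms(2) by (auto simp: piece_def)
  have eq: "{x @ y | x y. x \<in> W \<and> y \<in> W'} = {z \<in> Mn (n + n). take n z \<in> W \<and> drop n z \<in> W'}" (is "?P = ?Q")
  proof
    show "?P \<subseteq> ?Q" using p(2) q(2) by (fastforce simp: Mn_def)
    show "?Q \<subseteq> ?P"
    proof
      fix z assume "z \<in> ?Q"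
      then have "take n z \<in> W" "drop n z \<in> W'" "z = take n z @ drop n z" by auto
      then show "z \<in> ?P" by blast
    qed
  qed
  have "L.dpred (n + n) (\<lambda>z. take n z \<in> W \<and> drop n z \<in> W')"
    by (intro L.dpred_logic L.dpred_dmap[OF _ p(1)] L.dpred_dmap[OF _ q(1)] L.dmap_basic)
  moreover have "L.dmap (n + n) (\<lambda>z. \<phi> (take n z) @ \<psi> (drop n z))"
    by (intro L.dmap_append L.dmap_comp[OF p(3)] L.dmap_comp[OF q(3)] L.dmap_basic) (auto simp: Mn_def)
  moreover have "inj_on (\<lambda>z. \<phi> (take n z) @ \<psi> (drop n z)) ?Q"
  proof (rule inj_onI)
    fix z w assume h: "z \<in> ?Q" "w \<in> ?Q" "\<phi> (take n z) @ \<psi> (drop n z) = \<phi> (take n w) @ \<psi> (drop n w)"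
    have "length (\<phi> (take n z)) = d" "length (\<phi> (take n w)) = d" using h(1,2) p(2,4) by (auto simp: Mn_def)
    then have "\<phi> (take n z) = \<phi> (take n w)" "\<psi> (drop n z) = \<psi> (drop n w)" using h(3) by auto
    then have "take n z = take n w" "drop n z = drop n w" using h p(5) q(5) by (auto dest: inj_onD)
    then show "z = w" by (metis append_take_drop_id)
  qed
  moreover have "\<forall>z\<in>Mn (n + n). \<phi> (take n z) @ \<psi> (drop n z) \<in> Mn (d + e)"
    using p(4) q(4) by (auto simp: Mn_def)
  ultimately show ?thesis unfolding eq piece_def by (auto simp: L.dpred_def)
qed

end

section \<open>Almost-everywhere quantifiers and the group\<close>

context tame_pair begin

definition ae :: "nat \<Rightarrow> nat \<Rightarrow> 'm list set \<Rightarrow> ('m list \<Rightarrow> bool) \<Rightarrow> bool" where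
  "ae k n Y P \<longleftrightarrow> small k {u \<in> Mn n. u \<in> Y \<and> \<not> P u}"

lemma N_dpred_ae:
  assumes "DN Y" "N.dpred (q + n) (\<lambda>z. P (take q z) (drop q z))"
  shows "N.dpred q (\<lambda>x. ae k n Y (P x))"
  unfolding ae_def
  by (intro N_dpred_small N.dpred_logic assms(2) N.dpred_dmap[OF _ assms(1)] N.dmap_basic)

text \<open>Over an o-minimally definable set the almost-everywhere quantifier does not leave the
  o-minimal structure. This is what makes it possible to cut down \<open>X\<close> by generic
  conditions.\<close>

lemma L_dpred_ae:
  assumes "DL Y" "L.dpred (q + n) (\<lambda>z. P (take q z) (drop q z))"
  shows "L.dpred q (\<lambda>x. ae k n Y (P x))"
  unfolding ae_def
  by (intro L_dpred_small L.dpred_logic assms(2) L.dpred_dmap[OF _ assms(1)] L.dmap_basic)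

lemma ae_conj:
  assumes Y: "DN Y" and PQ: "N.dpred n P" "N.dpred n Q" and "ae k n Y P" "ae k n Y Q"
  shows "ae k n Y (\<lambda>u. P u \<and> Q u)"
proof -
  have D: "N.dpred n (\<lambda>u. u \<in> Y \<and> \<not> P u)" "N.dpred n (\<lambda>u. u \<in> Y \<and> \<not> Q u)"
    by (intro N.dpred_logic N.D_dpred Y PQ)+
  have "small k {u \<in> Mn n. (u \<in> Y \<and> \<not> P u) \<or> (u \<in> Y \<and> \<not> Q u)}"
    using assms(4,5) D unfolding ae_def by (intro small_Collect_disj)
  then show ?thesis unfolding ae_def by (rule back_subst[of "small k"]) blast
qed

lemma ae_mono:
  assumes Y: "DN Y" and PQ: "N.dpred n P" "N.dpred n Q" and P: "ae k n Y P"
    and i: "\<And>u. u \<in> Mn n \<Longrightarrow> u \<in> Y \<Longrightarrow> P u \<Longrightarrow> Q u"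
  shows "ae k n Y Q"
  using P unfolding ae_def
  by (rule small_Collect_mono) (use i in \<open>auto intro!: N.dpred_conj N.dpred_not N.D_dpred Y PQ\<close>)

lemma ae_always: "(\<And>u. u \<in> Mn n \<Longrightarrow> u \<in> Y \<Longrightarrow> P u) \<Longrightarrow> ae k n Y P"
proof -
  assume "\<And>u. u \<in> Mn n \<Longrightarrow> u \<in> Y \<Longrightarrow> P u"
  then have "{u \<in> Mn n. u \<in> Y \<and> \<not> P u} = {}" by blast
  then show ?thesis unfolding ae_def by (simp only: small_empty)
qed

lemma ae_ex:
  assumes Y: "Y \<subseteq> Mn n" "\<not> small k Y" and P: "ae k n Y P"
  shows "\<exists>u\<in>Y. P u"
proof (rule ccontr)
  assume "\<not> ?thesis"
  then have "{u \<in> Mn n. u \<in> Y \<and> \<not> P u} = Y" using Y(1) by blast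
  then show False using P Y(2) by (simp add: ae_def)
qed

lemma ae_transfer:
  assumes Y: "DN Y" "DN Y'" "Y \<subseteq> Mn n" "Y' \<subseteq> Mn n" "small k (Y' - Y)"
    and P: "N.dpred n P" "ae k n Y P"
  shows "ae k n Y' P"
proof -
  have D: "DN {u \<in> Mn n. u \<in> Y \<and> \<not> P u}" "DN {u \<in> Mn n. u \<in> Y' \<and> \<not> P u}"
    unfolding N.dpred_def[symmetric] by (intro N.dpred_logic N.D_dpred Y P)+
  have D': "DN (Y' - Y)" by (rule N.D_Diff[OF Y(2,1,4,3)])
  have s: "small k (Y' - Y \<union> {u \<in> Mn n. u \<in> Y \<and> \<not> P u})" "DN (Y' - Y \<union> {u \<in> Mn n. u \<in> Y \<and> \<not> P u})"
    using P(2) Y(4,5) D D' by (auto simp: ae_def intro!: small_Un[where n=n] N.D_Un[where n=n])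
  show ?thesis unfolding ae_def
    by (rule small_subset[OF s(1) D(2) s(2), of n]) (use Y(4) in auto)
qed

lemma fiber_pairs:
  "t \<in> Mn n \<Longrightarrow> fiber {z \<in> Mn (n + n). take n z \<in> Y \<and> drop n z \<in> Y \<and> \<not> P (take n z) (drop n z)} t
    = {u \<in> Mn n. t \<in> Y \<and> u \<in> Y \<and> \<not> P t u}"
  using fiber_Collect[of t n n "\<lambda>t u. t \<in> Y \<and> u \<in> Y \<and> \<not> P t u"] by simp

lemma D_pairs:
  assumes "DN Y" "N.dpred (n + n) (\<lambda>z. P (take n z) (drop n z))"
  shows "DN {z \<in> Mn (n + n). take n z \<in> Y \<and> drop n z \<in> Y \<and> \<not> P (take n z) (drop n z)}"
  unfolding N.dpred_def[symmetric]
  by (intro N.dpred_logic assms(2) N.dpred_dmap[OF _ assms(1)] N.dmap_basic)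

text \<open>Both Fubini estimates at once; \<open>small (Suc k) Y\<close> bounds base and fibres in
  the upper one.\<close>

lemma ae_fubini:
  assumes Y: "DN Y" "Y \<subseteq> Mn n" "small (Suc k) Y"
    and P: "N.dpred (n + n) (\<lambda>z. P (take n z) (drop n z))"
  shows "small (k + k) {z \<in> Mn (n + n). take n z \<in> Y \<and> drop n z \<in> Y \<and> \<not> P (take n z) (drop n z)}
    \<longleftrightarrow> ae k n Y (\<lambda>x. ae k n Y (P x))" (is "small _ ?S \<longleftrightarrow> _")
proof -
  have S: "DN ?S" "?S \<subseteq> Mn (n + n)" using D_pairs[OF Y(1) P] by auto
  have fe: "{u \<in> Mn n. c \<and> Q u} = (if c then {u \<in> Mn n. Q u} else {})" for c and Q :: "'m list \<Rightarrow> bool" by auto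
  have e: "{t \<in> Mn n. \<not> small k (fiber ?S t)} = {t \<in> Mn n. t \<in> Y \<and> \<not> ae k n Y (P t)}"
    using fiber_pairs[of _ n Y P] by (auto simp: ae_def fe small_empty split: if_splits)
  show ?thesis
  proof
    assume "small (k + k) ?S"
    then have "small k {t \<in> Mn n. \<not> small k (fiber ?S t)}" using fubini_lower[OF S, of k k] by blast
    then show "ae k n Y (\<lambda>x. ae k n Y (P x))" unfolding e ae_def[of k n Y "\<lambda>x. ae k n Y (P x)"] .
  next
    assume a: "ae k n Y (\<lambda>x. ae k n Y (P x))"
    show "small (k + k) ?S"
    proof (rule fubini_upper[OF S])
      show "small k {t \<in> Mn n. \<not> small k (fiber ?S t)}" using a unfolding e ae_def[of k n Y "\<lambda>x. ae k n Y (P x)"] .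
      have "DN {t \<in> Mn n. fiber ?S t \<noteq> {}}"
        using N.dpred_not[OF dpred_fiber_small[OF S, of 0]] small_0_iff[OF N_fiber[OF S]]
        by (simp add: N.dpred_def cong: conj_cong)
      then show "small (Suc k) {t \<in> Mn n. fiber ?S t \<noteq> {}}"
        by (rule small_subset[OF Y(3) _ Y(1) _ Y(2)]) (use fiber_pairs[of _ n Y P] in auto)
      show "small (Suc k) (fiber ?S t)" if t: "t \<in> Mn n" for t
        by (rule small_subset[OF Y(3) N_fiber[OF S t] Y(1) _ Y(2)]) (use fiber_pairs[OF t, of Y P] in auto)
    qed
  qed
qed

text \<open>Exceptional pairs for the two orders correspond under exchanging the coordinates, which
  is definable and injective; \<open>ae_fubini\<close> translates on either side.\<close>

lemma ae_swap:
  assumes Y: "DN Y" "Y \<subseteq> Mn n" "small (Suc k) Y"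
    and P: "N.dpred (n + n) (\<lambda>z. P (take n z) (drop n z))"
    and a: "ae k n Y (\<lambda>x. ae k n Y (\<lambda>y. P x y))"
  shows "ae k n Y (\<lambda>y. ae k n Y (\<lambda>x. P x y))"
proof -
  have P': "N.dpred (n + n) (\<lambda>z. P (drop n z) (take n z))"
    by (rule N.dpred_comp2[OF P]) (auto intro!: N.dmap_basic simp: Mn_def)
  have "small (k + k) {z \<in> Mn (n + n). take n z \<in> Y \<and> drop n z \<in> Y \<and> \<not> P (drop n z) (take n z)}"
  proof (rule small_inj[OF D_pairs[OF Y(1), of n "\<lambda>x y. P y x"], of "n + n" "\<lambda>z. drop n z @ take n z" _ _ "n + n"])
    show "small (k + k) {z \<in> Mn (n + n). take n z \<in> Y \<and> drop n z \<in> Y \<and> \<not> P (take n z) (drop n z)}"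
      using ae_fubini[OF Y P] a by simp
    show "inj_on (\<lambda>z. drop n z @ take n z) {z \<in> Mn (n + n). take n z \<in> Y \<and> drop n z \<in> Y \<and> \<not> P (drop n z) (take n z)}"
    proof (rule inj_onI)
      fix z w assume "z \<in> {z \<in> Mn (n + n). take n z \<in> Y \<and> drop n z \<in> Y \<and> \<not> P (drop n z) (take n z)}"
        "w \<in> {z \<in> Mn (n + n). take n z \<in> Y \<and> drop n z \<in> Y \<and> \<not> P (drop n z) (take n z)}"
        "drop n z @ take n z = drop n w @ take n w"
      then have "drop n z = drop n w" "take n z = take n w" by (auto simp: Mn_def)
      then show "z = w" by (metis append_take_drop_id)
    qed
  qed (use D_pairs[OF Y(1) P] P' in \<open>auto simp: Mn_def intro!: N.dmap_basic\<close>)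
  then show ?thesis using ae_fubini[OF Y P'] by simp
qed

end

section \<open>Definable groups and translation invariance\<close>

locale tame_group = tame_pair DL DN dimf
  for DL DN :: "('m::{dense_linorder, no_top, no_bot}) list set \<Rightarrow> bool" and dimf +
  fixes G :: "('m list, 'b) monoid_scheme" and n k :: nat
  assumes dgroup: "definable_group DN n G"
    and dimG: "dimf (carrier G) = ereal (real k)"
begin

sublocale group G using dgroup by (simp add: definable_group_def)

lemma G_Mn: "carrier G \<subseteq> Mn n" and G_DN: "DN (carrier G)"
  and G_graph: "DN {x @ y @ (x \<otimes>\<^bsub>G\<^esub> y) | x y. x \<in> carrier G \<and> y \<in> carrier G}"
  using dgroup by (auto simp: definable_group_def)

lemma G_length: "x \<in> carrier G \<Longrightarrow> length x = n"
  using G_Mn by (auto simp: Mn_def)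

lemma G_nonsmall: "\<not> small k (carrier G)" and G_small_Suc: "small (Suc k) (carrier G)"
  by (simp_all add: small_def dimG)

text \<open>The group operations, totalised on all of \<open>M\<^sup>n\<close> by the junk value \<open>\<one>\<close>.\<close>

definition mul :: "'m list \<Rightarrow> 'm list \<Rightarrow> 'm list" (infixl "\<bullet>" 70) where
  "x \<bullet> y = (if x \<in> carrier G \<and> y \<in> carrier G then x \<otimes>\<^bsub>G\<^esub> y else \<one>\<^bsub>G\<^esub>)"

definition iv :: "'m list \<Rightarrow> 'm list" where
  "iv x = (if x \<in> carrier G then inv\<^bsub>G\<^esub> x else \<one>\<^bsub>G\<^esub>)"

lemma mul_closed [simp]: "x \<bullet> y \<in> carrier G" and iv_closed [simp]: "iv x \<in> carrier G"
  by (auto simp: mul_def iv_def)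

lemma mul_length [simp]: "length (x \<bullet> y) = n" and iv_length [simp]: "length (iv x) = n"
  using G_length by auto

lemma mul_assoc: "x \<in> carrier G \<Longrightarrow> y \<in> carrier G \<Longrightarrow> z \<in> carrier G \<Longrightarrow> x \<bullet> y \<bullet> z = x \<bullet> (y \<bullet> z)"
  by (simp add: mul_def m_assoc)

lemma iv_mul [simp]: "x \<in> carrier G \<Longrightarrow> y \<in> carrier G \<Longrightarrow> iv x \<bullet> (x \<bullet> y) = y"
  by (simp add: mul_def iv_def m_assoc[symmetric])

lemma mul_iv [simp]: "x \<in> carrier G \<Longrightarrow> y \<in> carrier G \<Longrightarrow> x \<bullet> (iv x \<bullet> y) = y"
  by (simp add: mul_def iv_def m_assoc[symmetric])

lemma mul_right_iv [simp]: "x \<in> carrier G \<Longrightarrow> y \<in> carrier G \<Longrightarrow> x \<bullet> y \<bullet> iv y = x"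
  by (simp add: mul_def iv_def m_assoc)

lemma mul_right_cancel: "x \<in> carrier G \<Longrightarrow> y \<in> carrier G \<Longrightarrow> u \<in> carrier G \<Longrightarrow> x \<bullet> u = y \<bullet> u \<longleftrightarrow> x = y"
  by (simp add: mul_def)

lemma mul_left_cancel: "x \<in> carrier G \<Longrightarrow> y \<in> carrier G \<Longrightarrow> u \<in> carrier G \<Longrightarrow> u \<bullet> x = u \<bullet> y \<longleftrightarrow> x = y"
  by (simp add: mul_def)

lemma graph_mem:
  assumes "length x = n" "length y = n"
  shows "x @ y @ w \<in> {x @ y @ (x \<otimes>\<^bsub>G\<^esub> y) | x y. x \<in> carrier G \<and> y \<in> carrier G} \<longleftrightarrow>
    x \<in> carrier G \<and> y \<in> carrier G \<and> w = x \<otimes>\<^bsub>G\<^esub> y"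
proof
  assume "x @ y @ w \<in> {x @ y @ (x \<otimes>\<^bsub>G\<^esub> y) | x y. x \<in> carrier G \<and> y \<in> carrier G}"
  then obtain x' y' where h: "x @ y @ w = x' @ y' @ (x' \<otimes>\<^bsub>G\<^esub> y')" "x' \<in> carrier G" "y' \<in> carrier G" by blast
  then have "x = x'" "y = y'" "w = x' \<otimes>\<^bsub>G\<^esub> y'" using assms G_length by simp_all
  then show "x \<in> carrier G \<and> y \<in> carrier G \<and> w = x \<otimes>\<^bsub>G\<^esub> y" using h by simp
qed blast

lemma dmap_mul:
  assumes "N.dmap q f" "N.dmap q g" "\<And>x. x \<in> Mn q \<Longrightarrow> length (f x) = n" "\<And>x. x \<in> Mn q \<Longrightarrow> length (g x) = n"
  shows "N.dmap q (\<lambda>x. f x \<bullet> g x)"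
proof (rule N.dmapI[where m = n and R = "\<lambda>x w. (f x @ g x @ w \<in> {x @ y @ (x \<otimes>\<^bsub>G\<^esub> y) | x y. x \<in> carrier G \<and> y \<in> carrier G}) \<or>
    \<not> (f x \<in> carrier G \<and> g x \<in> carrier G) \<and> w = \<one>\<^bsub>G\<^esub>"])
  show "N.dpred (q + n) (\<lambda>z. (f (take q z) @ g (take q z) @ drop q z \<in> {x @ y @ (x \<otimes>\<^bsub>G\<^esub> y) | x y. x \<in> carrier G \<and> y \<in> carrier G}) \<or>
    \<not> (f (take q z) \<in> carrier G \<and> g (take q z) \<in> carrier G) \<and> drop q z = \<one>\<^bsub>G\<^esub>)"
    by (intro N.dpred_disj N.dpred_conj N.dpred_not N.dpred_eq N.dpred_dmap[OF _ G_graph] N.dpred_dmap[OF _ G_DN] N.dmap_append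
        N.dmap_comp[OF assms(1)] N.dmap_comp[OF assms(2)] N.dmap_take N.dmap_drop N.dmap_id N.dmap_const)
      (auto simp: Mn_def)
  show "(w = f x \<bullet> g x) = ((f x @ g x @ w \<in> {x @ y @ (x \<otimes>\<^bsub>G\<^esub> y) | x y. x \<in> carrier G \<and> y \<in> carrier G}) \<or>
    \<not> (f x \<in> carrier G \<and> g x \<in> carrier G) \<and> w = \<one>\<^bsub>G\<^esub>)" if "x \<in> Mn q" for x w
    unfolding graph_mem[OF assms(3,4)[OF that]] mul_def by auto
qed (simp add: Mn_def)

lemma dmap_iv:
  assumes "N.dmap q f" "\<And>x. x \<in> Mn q \<Longrightarrow> length (f x) = n"
  shows "N.dmap q (\<lambda>x. iv (f x))"
proof (rule N.dmapI[where m = n and R = "\<lambda>x w. (f x \<in> carrier G \<and> w \<in> carrier G \<and> f x \<bullet> w = \<one>\<^bsub>G\<^esub>) \<or>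
    \<not> (f x \<in> carrier G) \<and> w = \<one>\<^bsub>G\<^esub>"])
  show "N.dpred (q + n) (\<lambda>z. (f (take q z) \<in> carrier G \<and> drop q z \<in> carrier G \<and> f (take q z) \<bullet> drop q z = \<one>\<^bsub>G\<^esub>) \<or>
    \<not> (f (take q z) \<in> carrier G) \<and> drop q z = \<one>\<^bsub>G\<^esub>)"
    by (intro N.dpred_disj N.dpred_conj N.dpred_not N.dpred_eq N.dpred_dmap[OF _ G_DN] dmap_mul
        N.dmap_comp[OF assms(1)] N.dmap_take N.dmap_drop N.dmap_id N.dmap_const)
      (use assms(2) in \<open>auto simp: Mn_def\<close>)
  show "(w = iv (f x)) = ((f x \<in> carrier G \<and> w \<in> carrier G \<and> f x \<bullet> w = \<one>\<^bsub>G\<^esub>) \<or>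
    \<not> (f x \<in> carrier G) \<and> w = \<one>\<^bsub>G\<^esub>)" if "x \<in> Mn q" for x w
    unfolding iv_def mul_def using inv_equality[of w "f x"] inv_comm[of "f x" w] by (auto simp: r_inv)
qed (simp add: Mn_def)

abbreviation aeG :: "('m list \<Rightarrow> bool) \<Rightarrow> bool" where "aeG \<equiv> ae k n (carrier G)"

lemma aeG_conj: "N.dpred n P \<Longrightarrow> N.dpred n Q \<Longrightarrow> aeG P \<Longrightarrow> aeG Q \<Longrightarrow> aeG (\<lambda>u. P u \<and> Q u)"
  by (rule ae_conj[OF G_DN])

lemma aeG_ex: "aeG P \<Longrightarrow> \<exists>u\<in>carrier G. P u"
  by (rule ae_ex[OF G_Mn G_nonsmall])

text \<open>Left translation by \<open>g\<close> is definable and injective, and it carries the new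
  exceptional set into the old one.\<close>

lemma aeG_left:
  assumes g: "g \<in> carrier G" and P: "N.dpred n P" "aeG P"
  shows "aeG (\<lambda>u. P (g \<bullet> u))"
proof -
  have f: "N.dmap n (\<lambda>u. g \<bullet> u)" by (intro dmap_mul N.dmap_basic) (use g G_length in \<open>auto simp: Mn_def\<close>)
  show ?thesis unfolding ae_def
  proof (rule small_inj[OF _ _ f, of _ "{u \<in> Mn n. u \<in> carrier G \<and> \<not> P u}" _ n])
    show "DN {u \<in> Mn n. u \<in> carrier G \<and> \<not> P (g \<bullet> u)}" "DN {u \<in> Mn n. u \<in> carrier G \<and> \<not> P u}"
      unfolding N.dpred_def[symmetric]
      by (intro N.dpred_logic N.D_dpred G_DN N.dpred_comp[OF P(1) f] P; simp add: Mn_def)+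
    show "inj_on ((\<bullet>) g) {u \<in> Mn n. u \<in> carrier G \<and> \<not> P (g \<bullet> u)}"
      by (rule inj_onI) (use mul_left_cancel g in auto)
    show "small k {u \<in> Mn n. u \<in> carrier G \<and> \<not> P u}" using P(2) by (simp add: ae_def)
  qed (auto simp: Mn_def)
qed

lemma aeG_right:
  assumes g: "g \<in> carrier G" and P: "N.dpred n P" "aeG P"
  shows "aeG (\<lambda>u. P (u \<bullet> g))"
proof -
  have f: "N.dmap n (\<lambda>u. u \<bullet> g)" by (intro dmap_mul N.dmap_basic) (use g G_length in \<open>auto simp: Mn_def\<close>)
  show ?thesis unfolding ae_def
  proof (rule small_inj[OF _ _ f, of _ "{u \<in> Mn n. u \<in> carrier G \<and> \<not> P u}" _ n])
    show "DN {u \<in> Mn n. u \<in> carrier G \<and> \<not> P (u \<bullet> g)}" "DN {u \<in> Mn n. u \<in> carrier G \<and> \<not> P u}"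
      unfolding N.dpred_def[symmetric]
      by (intro N.dpred_logic N.D_dpred G_DN N.dpred_comp[OF P(1) f] P; simp add: Mn_def)+
    show "inj_on (\<lambda>u. u \<bullet> g) {u \<in> Mn n. u \<in> carrier G \<and> \<not> P (u \<bullet> g)}"
      by (rule inj_onI) (use mul_right_cancel g in auto)
    show "small k {u \<in> Mn n. u \<in> carrier G \<and> \<not> P u}" using P(2) by (simp add: ae_def)
  qed (auto simp: Mn_def)
qed

end

section \<open>The group chunk\<close>

text \<open>\<open>Q\<close> and \<open>R\<close> recover a factor from the generic product:
  \<open>Q (x @ F (x @ y))\<close> should be \<open>y\<close> and \<open>R (F (x @ y) @ y)\<close>
  should be \<open>x\<close>. The first makes \<open>F (x @ _)\<close> generically injective, the
  second will make \<open>h\<close> injective.\<close>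

locale group_chunk = tame_group DL DN dimf G n k
  for DL DN :: "('m::{dense_linorder, no_top, no_bot}) list set \<Rightarrow> bool" and dimf
    and G :: "('m list, 'b) monoid_scheme" and n k +
  fixes X :: "'m list set" and F Q R :: "'m list \<Rightarrow> 'm list"
  assumes X_DL: "DL X" and X_Mn: "X \<subseteq> Mn n"
    and XG: "small k (X - carrier G)" and GX: "small k (carrier G - X)"
    and F_dmap: "L.dmap (n + n) F" and F_Mn: "\<And>z. z \<in> Mn (n + n) \<Longrightarrow> F z \<in> Mn n"
    and Q_dmap: "L.dmap (n + n) Q" and Q_Mn: "\<And>z. z \<in> Mn (n + n) \<Longrightarrow> Q z \<in> Mn n"
    and R_dmap: "L.dmap (n + n) R" and R_Mn: "\<And>z. z \<in> Mn (n + n) \<Longrightarrow> R z \<in> Mn n"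
    and F_ae: "aeG (\<lambda>x. aeG (\<lambda>y. F (x @ y) = x \<bullet> y))"
    and Q_ae: "aeG (\<lambda>x. aeG (\<lambda>y. Q (x @ y) = iv x \<bullet> y))"
    and R_ae: "aeG (\<lambda>x. aeG (\<lambda>y. R (x @ y) = x \<bullet> iv y))"
begin

lemma F_length: "length z = n + n \<Longrightarrow> length (F z) = n"
  and Q_length: "length z = n + n \<Longrightarrow> length (Q z) = n"
  and R_length: "length z = n + n \<Longrightarrow> length (R z) = n"
  using F_Mn Q_Mn R_Mn by (auto simp: Mn_def)

lemmas FQR_length = F_length Q_length R_length

lemma L_dmap_F: "L.dmap q f \<Longrightarrow> L.dmap q g \<Longrightarrow> (\<And>x. x \<in> Mn q \<Longrightarrow> length (f x) = n \<and> length (g x) = n) \<Longrightarrow> L.dmap q (\<lambda>x. F (f x @ g x))"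
  and L_dmap_Q: "L.dmap q f \<Longrightarrow> L.dmap q g \<Longrightarrow> (\<And>x. x \<in> Mn q \<Longrightarrow> length (f x) = n \<and> length (g x) = n) \<Longrightarrow> L.dmap q (\<lambda>x. Q (f x @ g x))"
  and L_dmap_R: "L.dmap q f \<Longrightarrow> L.dmap q g \<Longrightarrow> (\<And>x. x \<in> Mn q \<Longrightarrow> length (f x) = n \<and> length (g x) = n) \<Longrightarrow> L.dmap q (\<lambda>x. R (f x @ g x))"
  by (rule L.dmap_comp[OF F_dmap L.dmap_append] L.dmap_comp[OF Q_dmap L.dmap_append] L.dmap_comp[OF R_dmap L.dmap_append];
      simp add: Mn_def)+

lemma N_dmap_F: "N.dmap q f \<Longrightarrow> N.dmap q g \<Longrightarrow> (\<And>x. x \<in> Mn q \<Longrightarrow> length (f x) = n \<and> length (g x) = n) \<Longrightarrow> N.dmap q (\<lambda>x. F (f x @ g x))"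
  and N_dmap_Q: "N.dmap q f \<Longrightarrow> N.dmap q g \<Longrightarrow> (\<And>x. x \<in> Mn q \<Longrightarrow> length (f x) = n \<and> length (g x) = n) \<Longrightarrow> N.dmap q (\<lambda>x. Q (f x @ g x))"
  and N_dmap_R: "N.dmap q f \<Longrightarrow> N.dmap q g \<Longrightarrow> (\<And>x. x \<in> Mn q \<Longrightarrow> length (f x) = n \<and> length (g x) = n) \<Longrightarrow> N.dmap q (\<lambda>x. R (f x @ g x))"
  by (rule N.dmap_comp[OF dmap_LN[OF F_dmap] N.dmap_append] N.dmap_comp[OF dmap_LN[OF Q_dmap] N.dmap_append] N.dmap_comp[OF dmap_LN[OF R_dmap] N.dmap_append];
      simp add: Mn_def)+

lemmas X_DN = DL_DN[OF X_DL]
lemmas N_dp = N.dpred_logic N.dpred_eq N_dpred_ae[OF G_DN] N_dpred_ae[OF X_DN] N.dpred_dmap[OF _ G_DN] N.dpred_dmap[OF _ X_DN]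
  N_dmap_F N_dmap_Q N_dmap_R dmap_mul dmap_iv N.dmap_id N.dmap_take N.dmap_drop N.dmap_const
lemmas L_dp = L.dpred_logic L.dpred_eq L_dpred_ae[OF X_DL] L.dpred_dmap[OF _ X_DL]
  L_dmap_F L_dmap_Q L_dmap_R L.dmap_id L.dmap_take L.dmap_drop L.dmap_const

abbreviation aeX :: "('m list \<Rightarrow> bool) \<Rightarrow> bool" where "aeX \<equiv> ae k n X"

text \<open>The bridge of the whole argument: quantification over \<open>X\<close> is o-minimally
  definable, quantification over \<open>G\<close> is translation invariant, and the two agree
  because \<open>X\<close> and \<open>G\<close> differ by small sets.\<close>

lemma aeX_iff: "N.dpred n P \<Longrightarrow> aeX P \<longleftrightarrow> aeG P"
  using ae_transfer[OF G_DN X_DN G_Mn X_Mn XG] ae_transfer[OF X_DN G_DN X_Mn G_Mn GX] by blast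

lemma aeX_aeX_iff:
  assumes P: "N.dpred (n + n) (\<lambda>z. P (take n z) (drop n z))"
  shows "aeX (\<lambda>x. aeX (P x)) \<longleftrightarrow> aeG (\<lambda>x. aeG (P x))"
proof -
  have Pt: "N.dpred n (P t)" if "t \<in> Mn n" for t
    by (rule N.dpred_comp2[OF P, of n "\<lambda>_. t" "\<lambda>x. x"]) (use that in \<open>auto intro!: N.dmap_basic\<close>)
  have "{u \<in> Mn n. u \<in> X \<and> \<not> aeX (P u)} = {u \<in> Mn n. u \<in> X \<and> \<not> aeG (P u)}"
    using aeX_iff[OF Pt] by blast
  then have "aeX (\<lambda>x. aeX (P x)) \<longleftrightarrow> aeX (\<lambda>x. aeG (P x))" unfolding ae_def[of k n X "\<lambda>x. aeX (P x)"] ae_def[of k n X "\<lambda>x. aeG (P x)"] by simp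
  also have "\<dots> \<longleftrightarrow> aeG (\<lambda>x. aeG (P x))" by (intro aeX_iff N_dpred_ae[OF G_DN] P)
  finally show ?thesis .
qed

definition prodF :: "'m list \<Rightarrow> bool" where
  "prodF x \<longleftrightarrow> aeG (\<lambda>y. F (x @ y) = x \<bullet> y)"

lemma N_dpred_prodF: "N.dpred n prodF"
  unfolding prodF_def by (intro N_dp) (auto simp: Mn_def)

lemma aeG_prodF: "aeG prodF"
  using F_ae by (simp add: prodF_def[abs_def])

text \<open>The conditions hold for almost all group elements, are definable in the o-minimal structure, and
  make \<open>F (x @ _)\<close> behave like left translation by a group element.\<close>

definition gen :: "'m list \<Rightarrow> bool" where
  "gen x \<longleftrightarrow> x \<in> X \<and> aeX (\<lambda>y. F (x @ y) \<in> X) \<and> aeX (\<lambda>y. Q (x @ F (x @ y)) = y) \<and>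
     aeX (\<lambda>y. R (F (x @ y) @ y) = x) \<and> aeX (\<lambda>y. aeX (\<lambda>z. F (F (x @ y) @ z) = F (x @ F (y @ z))))"

definition X' :: "'m list set" where "X' = {x \<in> Mn n. gen x}"

lemma L_dpred_gen: "L.dpred n gen"
  unfolding gen_def by (intro L_dp) (auto simp: Mn_def FQR_length)

lemma X'_DL: "DL X'" and X'_Mn: "X' \<subseteq> Mn n" and X'_X: "X' \<subseteq> X"
  using L_dpred_gen by (auto simp: X'_def L.dpred_def gen_def)

lemmas X'_DN = DL_DN[OF X'_DL]

lemma X'_length: "x \<in> X' \<Longrightarrow> length x = n"
  using X'_Mn by (auto simp: Mn_def)

lemma dpred_F_eq_mul: "length x = n \<Longrightarrow> length g = n \<Longrightarrow> N.dpred n (\<lambda>y. F (x @ y) = g \<bullet> y)"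
  by (intro N_dp) (auto simp: Mn_def)

lemma aeG_in_X: "aeG (\<lambda>u. u \<in> X)"
proof -
  have "{u \<in> Mn n. u \<in> carrier G \<and> u \<notin> X} = carrier G - X" using G_Mn by blast
  then show ?thesis using GX by (simp add: ae_def)
qed

text \<open>For a fixed second argument \<open>y\<close>, right translation replaces
  \<open>x\<close> by the product of \<open>x\<close> and \<open>y\<close>. The two swaps move
  \<open>y\<close> outward for this step and back again.\<close>

lemma R_ae': "aeG (\<lambda>x. aeG (\<lambda>y. R ((x \<bullet> y) @ y) = x))"
proof -
  have 1: "aeG (\<lambda>y. aeG (\<lambda>x. R (x @ y) = x \<bullet> iv y))"
    by (rule ae_swap[OF G_DN G_Mn G_small_Suc _ R_ae]) (intro N_dp, auto simp: Mn_def)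
  have "aeG (\<lambda>y. aeG (\<lambda>x. R ((x \<bullet> y) @ y) = x))"
  proof (rule ae_mono[OF G_DN _ _ 1])
    show "N.dpred n (\<lambda>y. aeG (\<lambda>x. R (x @ y) = x \<bullet> iv y))" "N.dpred n (\<lambda>y. aeG (\<lambda>x. R ((x \<bullet> y) @ y) = x))"
      by (intro N_dp; auto simp: Mn_def)+
    fix y assume y: "y \<in> Mn n" "y \<in> carrier G" "aeG (\<lambda>x. R (x @ y) = x \<bullet> iv y)"
    have "aeG (\<lambda>x. R ((x \<bullet> y) @ y) = x \<bullet> y \<bullet> iv y)"
      by (rule aeG_right[OF y(2) _ y(3)]) (intro N_dp, use y in \<open>auto simp: Mn_def\<close>)
    then show "aeG (\<lambda>x. R ((x \<bullet> y) @ y) = x)"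
      by (rule ae_mono[OF G_DN, rotated 2]) (use y in \<open>auto simp: Mn_def intro!: N_dp\<close>)
  qed
  then show ?thesis
    by (rule ae_swap[OF G_DN G_Mn G_small_Suc, rotated]) (intro N_dp, auto simp: Mn_def)
qed

text \<open>For such a group element, \<open>F (x @ _)\<close> is almost everywhere the actual left
  translation, so every clause of \<open>gen\<close> becomes a group identity once exceptional sets
  have been translated.\<close>

lemma gen_if:
  assumes x: "x \<in> carrier G" "x \<in> X" "prodF x" "aeG (\<lambda>y. Q (x @ y) = iv x \<bullet> y)" "aeG (\<lambda>y. R ((x \<bullet> y) @ y) = x)"
  shows "gen x"
proof -
  have l: "length x = n" using x(1) G_length by simp
  have pf: "aeG (\<lambda>y. F (x @ y) = x \<bullet> y)" using x(3) by (simp add: prodF_def)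
  have D0: "N.dpred n (\<lambda>y. F (x @ y) = x \<bullet> y)" by (rule dpred_F_eq_mul[OF l l])
  have "aeG (\<lambda>y. F (x @ y) \<in> X)"
  proof (rule ae_mono[OF G_DN _ _ aeG_conj[OF D0 _ pf aeG_left[OF x(1) _ aeG_in_X]]])
  qed (use l in \<open>auto simp: Mn_def intro!: N_dp\<close>)
  moreover have "aeG (\<lambda>y. Q (x @ F (x @ y)) = y)"
  proof (rule ae_mono[OF G_DN _ _ aeG_conj[OF D0 _ pf aeG_left[OF x(1) _ x(4)]]])
  qed (use l x(1) in \<open>auto simp: Mn_def FQR_length intro!: N_dp\<close>)
  moreover have "aeG (\<lambda>y. R (F (x @ y) @ y) = x)"
  proof (rule ae_mono[OF G_DN _ _ aeG_conj[OF D0 _ pf x(5)]])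
  qed (use l in \<open>auto simp: Mn_def FQR_length intro!: N_dp\<close>)
  \<comment> \<open>Associativity needs \<open>F\<close> to be the product at four places: at
    \<open>x, y\<close>; at the product of these two with \<open>z\<close>; at \<open>y, z\<close>;
    and at \<open>x\<close> with the product of \<open>y, z\<close>. The last follows by translating
    the exceptional set of \<open>prodF x\<close> by \<open>y\<close>.\<close>
  moreover have "aeG (\<lambda>y. aeG (\<lambda>z. F (F (x @ y) @ z) = F (x @ F (y @ z))))"
  proof (rule ae_mono[OF G_DN _ _ aeG_conj[OF D0 _ pf aeG_conj[OF _ _ aeG_left[OF x(1) N_dpred_prodF aeG_prodF] aeG_prodF]]])
    show "N.dpred n (\<lambda>y. prodF (x \<bullet> y))" "N.dpred n prodF"
      "N.dpred n (\<lambda>y. prodF (x \<bullet> y) \<and> prodF y)" "N.dpred n (\<lambda>y. F (x @ y) = x \<bullet> y \<and> prodF (x \<bullet> y) \<and> prodF y)"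
      by (intro N.dpred_conj D0 N_dpred_prodF N.dpred_comp[OF N_dpred_prodF] N_dp; use l in \<open>auto simp: Mn_def\<close>)+
    show "N.dpred n (\<lambda>y. aeG (\<lambda>z. F (F (x @ y) @ z) = F (x @ F (y @ z))))"
      by (intro N_dp) (use l in \<open>auto simp: Mn_def FQR_length\<close>)
    fix y assume y: "y \<in> Mn n" "y \<in> carrier G" "F (x @ y) = x \<bullet> y \<and> prodF (x \<bullet> y) \<and> prodF y"
    have ly: "length y = n" using y by (simp add: Mn_def)
    have a: "aeG (\<lambda>z. F ((x \<bullet> y) @ z) = x \<bullet> y \<bullet> z)" "aeG (\<lambda>z. F (y @ z) = y \<bullet> z)" using y(3) by (auto simp: prodF_def)
    have b: "aeG (\<lambda>z. F (x @ (y \<bullet> z)) = x \<bullet> (y \<bullet> z))" by (rule aeG_left[OF y(2) D0 pf])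
    have D: "N.dpred n (\<lambda>z. F ((x \<bullet> y) @ z) = x \<bullet> y \<bullet> z)" "N.dpred n (\<lambda>z. F (y @ z) = y \<bullet> z)"
      "N.dpred n (\<lambda>z. F (x @ (y \<bullet> z)) = x \<bullet> (y \<bullet> z))" "N.dpred n (\<lambda>z. F (F (x @ y) @ z) = F (x @ F (y @ z)))"
      by (intro N_dp; use l ly in \<open>auto simp: Mn_def FQR_length\<close>)+
    show "aeG (\<lambda>z. F (F (x @ y) @ z) = F (x @ F (y @ z)))"
    proof (rule ae_mono[OF G_DN _ D(4) aeG_conj[OF D(1) _ a(1) aeG_conj[OF D(2,3) a(2) b]]])
      show "F (F (x @ y) @ z) = F (x @ F (y @ z))" if "z \<in> carrier G"
        "F ((x \<bullet> y) @ z) = x \<bullet> y \<bullet> z \<and> F (y @ z) = y \<bullet> z \<and> F (x @ (y \<bullet> z)) = x \<bullet> (y \<bullet> z)" for z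
        using that y x(1) by (simp add: mul_assoc)
    qed (intro N.dpred_conj D)+
  qed
  moreover have "N.dpred n (\<lambda>y. F (x @ y) \<in> X)" "N.dpred n (\<lambda>y. Q (x @ F (x @ y)) = y)" "N.dpred n (\<lambda>y. R (F (x @ y) @ y) = x)"
    "N.dpred (n + n) (\<lambda>z. F (F (x @ take n z) @ drop n z) = F (x @ F (take n z @ drop n z)))"
    by (intro N_dp; use l in \<open>auto simp: Mn_def FQR_length\<close>)+
  ultimately show ?thesis unfolding gen_def
    using x(2) aeX_iff aeX_aeX_iff[of "\<lambda>y z. F (F (x @ y) @ z) = F (x @ F (y @ z))"] by simp
qed

lemma aeG_gen: "aeG (\<lambda>x. gen x \<and> prodF x)"
proof -
  have D: "N.dpred n (\<lambda>x. x \<in> X)" "N.dpred n (\<lambda>x. aeG (\<lambda>y. Q (x @ y) = iv x \<bullet> y))" "N.dpred n (\<lambda>x. aeG (\<lambda>y. R ((x \<bullet> y) @ y) = x))"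
    by (intro N_dp; auto simp: Mn_def)+
  show ?thesis
    by (rule ae_mono[OF G_DN _ _ aeG_conj[OF D(1) _ aeG_in_X aeG_conj[OF N_dpred_prodF _ aeG_prodF aeG_conj[OF D(2,3) Q_ae R_ae']]]])
      (auto intro!: N.dpred_conj D N_dpred_prodF dpred_LN[OF L_dpred_gen] gen_if)
qed

lemma gen_pullback:
  assumes x: "x \<in> X'" and S: "N.dpred n S" "aeG S"
  shows "aeG (\<lambda>b. F (x @ b) \<in> carrier G \<and> S (F (x @ b)))"
proof -
  have l: "length x = n" using x X'_length by blast
  have fm: "N.dmap n (\<lambda>b. F (x @ b))" by (intro N_dp) (use l in \<open>auto simp: Mn_def\<close>)
  have fM: "F (x @ b) \<in> Mn n" if "b \<in> Mn n" for b using that l FQR_length by (simp add: Mn_def)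
  have D: "N.dpred n (\<lambda>b. F (x @ b) \<in> X)" "N.dpred n (\<lambda>b. Q (x @ F (x @ b)) = b)"
    by (intro N_dp; use l in \<open>auto simp: Mn_def FQR_length\<close>)+
  have a: "aeG (\<lambda>b. F (x @ b) \<in> X)" "aeG (\<lambda>b. Q (x @ F (x @ b)) = b)"
    using x aeX_iff[OF D(1)] aeX_iff[OF D(2)] by (auto simp: X'_def gen_def)
  define B where "B = {w \<in> Mn n. w \<in> X \<and> \<not> (w \<in> carrier G \<and> S w)}"
  have "aeX (\<lambda>w. w \<in> carrier G \<and> S w)"
  proof -
    have "aeG (\<lambda>w. w \<in> carrier G \<and> S w)"
      by (rule aeG_conj[OF N.D_dpred[OF G_DN] S(1) _ S(2)]) (rule ae_always)
    then show ?thesis using aeX_iff[OF N.dpred_conj[OF N.D_dpred[OF G_DN] S(1)]] by simp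
  qed
  then have B: "small k B" "DN B" "B \<subseteq> Mn n"
    unfolding B_def ae_def N.dpred_def[symmetric] by (auto intro!: N.dpred_logic N.D_dpred G_DN X_DN S)
  define C where "C = {b \<in> Mn n. b \<in> carrier G \<and> Q (x @ F (x @ b)) = b \<and> F (x @ b) \<in> B}"
  have DC: "DN C" unfolding C_def N.dpred_def[symmetric]
    by (intro N.dpred_logic N.D_dpred G_DN D N.dpred_dmap[OF fm B(2)])
  have "small k C"
  proof (rule small_inj[OF DC _ fm _ _ B])
    show "inj_on (\<lambda>b. F (x @ b)) C" 
    proof (rule inj_onI)
      fix b c assume "b \<in> C" "c \<in> C" "F (x @ b) = F (x @ c)"
      then have "b = Q (x @ F (x @ b))" "c = Q (x @ F (x @ b))" by (simp_all add: C_def)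
      then show "b = c" by simp
    qed
  qed (auto simp: C_def)
  moreover have "{b \<in> Mn n. b \<in> carrier G \<and> \<not> \<not> (Q (x @ F (x @ b)) = b \<and> F (x @ b) \<in> B)} = C" by (auto simp: C_def)
  ultimately have c: "aeG (\<lambda>b. \<not> (Q (x @ F (x @ b)) = b \<and> F (x @ b) \<in> B))" by (simp only: ae_def)
  have Dc: "N.dpred n (\<lambda>b. \<not> (Q (x @ F (x @ b)) = b \<and> F (x @ b) \<in> B))"
    by (intro N.dpred_logic D N.dpred_dmap[OF fm B(2)])
  show ?thesis
  proof (rule ae_mono[OF G_DN _ _ aeG_conj[OF Dc _ c aeG_conj[OF D a]]])
    show "N.dpred n (\<lambda>b. F (x @ b) \<in> carrier G \<and> S (F (x @ b)))"
      by (intro N.dpred_conj N.dpred_dmap[OF fm G_DN] N.dpred_comp[OF S(1) fm fM])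
    fix b assume b: "b \<in> Mn n"
      "\<not> (Q (x @ F (x @ b)) = b \<and> F (x @ b) \<in> B) \<and> F (x @ b) \<in> X \<and> Q (x @ F (x @ b)) = b"
    then show "F (x @ b) \<in> carrier G \<and> S (F (x @ b))" using fM[OF b(1)] by (auto simp: B_def)
  qed (intro N.dpred_conj Dc D)+
qed

text \<open>Take a generic \<open>b\<close> in \<open>G\<close> for which
  \<open>d = F (x @ b)\<close> lies in \<open>G\<close> and satisfies \<open>prodF\<close>. Generic
  associativity gives \<open>F (x @ (b \<bullet> c)) = d \<bullet> c\<close> for almost all
  \<open>c\<close>; substituting \<open>iv b \<bullet> u\<close> for \<open>c\<close> shows that the
  translating element is \<open>d \<bullet> iv b\<close>.\<close>

lemma translation_exists:
  assumes x: "x \<in> X'"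
  shows "\<exists>c\<in>carrier G. aeG (\<lambda>u. F (x @ u) = c \<bullet> u)"
proof -
  have l: "length x = n" using x X'_length by blast
  have fm: "N.dmap n (\<lambda>b. F (x @ b))" by (intro N_dp) (use l in \<open>auto simp: Mn_def\<close>)
  have fM: "F (x @ b) \<in> Mn n" if "b \<in> Mn n" for b using that l FQR_length by (simp add: Mn_def)
  define A where "A b \<longleftrightarrow> aeG (\<lambda>c. F (F (x @ b) @ c) = F (x @ F (b @ c)))" for b
  have DA: "N.dpred n A" unfolding A_def by (intro N_dp) (use l in \<open>auto simp: Mn_def FQR_length\<close>)
  have "aeX (\<lambda>b. aeX (\<lambda>c. F (F (x @ b) @ c) = F (x @ F (b @ c))))" using x by (simp add: X'_def gen_def)
  then have a: "aeG A" unfolding A_def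
    by (subst (asm) aeX_aeX_iff) (intro N_dp, use l in \<open>auto simp: Mn_def FQR_length\<close>)
  have DP: "N.dpred n (\<lambda>b. F (x @ b) \<in> carrier G \<and> prodF (F (x @ b)))"
    by (intro N.dpred_conj N.dpred_dmap[OF fm G_DN] N.dpred_comp[OF N_dpred_prodF fm fM])
  have "aeG (\<lambda>b. A b \<and> (F (x @ b) \<in> carrier G \<and> prodF (F (x @ b))) \<and> prodF b)"
    by (intro aeG_conj DA a DP N_dpred_prodF aeG_prodF N.dpred_conj gen_pullback[OF x])
  then obtain b where b: "b \<in> carrier G" "A b" "F (x @ b) \<in> carrier G" "prodF (F (x @ b))" "prodF b"
    using aeG_ex by blast
  define d where "d = F (x @ b)"
  have lb: "length b = n" "length d = n" using b G_length by (auto simp: d_def)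
  have D: "N.dpred n (\<lambda>c. F (d @ c) = F (x @ F (b @ c)))" "N.dpred n (\<lambda>c. F (d @ c) = d \<bullet> c)" "N.dpred n (\<lambda>c. F (b @ c) = b \<bullet> c)"
    "N.dpred n (\<lambda>c. F (x @ (b \<bullet> c)) = d \<bullet> c)"
    by (intro N_dp; use l lb in \<open>auto simp: Mn_def FQR_length\<close>)+
  have "aeG (\<lambda>c. F (d @ c) = F (x @ F (b @ c)) \<and> F (d @ c) = d \<bullet> c \<and> F (b @ c) = b \<bullet> c)"
    using b unfolding A_def prodF_def d_def[symmetric] by (intro aeG_conj D N.dpred_conj)
  then have "aeG (\<lambda>c. F (x @ (b \<bullet> c)) = d \<bullet> c)"
    by (rule ae_mono[OF G_DN, rotated 2]) (auto intro!: N.dpred_conj D)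
  from aeG_left[OF iv_closed D(4) this, of b]
  have "aeG (\<lambda>u. F (x @ u) = (d \<bullet> iv b) \<bullet> u)"
  proof (rule ae_mono[OF G_DN, rotated 2])
    show "N.dpred n (\<lambda>u. F (x @ (b \<bullet> (iv b \<bullet> u))) = d \<bullet> (iv b \<bullet> u))" "N.dpred n (\<lambda>u. F (x @ u) = (d \<bullet> iv b) \<bullet> u)"
      by (intro N_dp; use l lb in \<open>auto simp: Mn_def FQR_length\<close>)+
    show "F (x @ u) = (d \<bullet> iv b) \<bullet> u" if "u \<in> carrier G" "F (x @ (b \<bullet> (iv b \<bullet> u))) = d \<bullet> (iv b \<bullet> u)" for u
      using that b(1,3) by (simp add: mul_assoc d_def)
  qed
  then show ?thesis by (intro bexI[of _ "d \<bullet> iv b"]) auto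
qed

lemma translation_unique:
  assumes "length x = n" "c \<in> carrier G" "c' \<in> carrier G" "aeG (\<lambda>u. F (x @ u) = c \<bullet> u)" "aeG (\<lambda>u. F (x @ u) = c' \<bullet> u)"
  shows "c = c'"
proof -
  have "aeG (\<lambda>u. F (x @ u) = c \<bullet> u \<and> F (x @ u) = c' \<bullet> u)"
    using assms G_length by (intro aeG_conj dpred_F_eq_mul) auto
  from aeG_ex[OF this] obtain u where "u \<in> carrier G" "c \<bullet> u = c' \<bullet> u" by auto
  then show ?thesis using mul_right_cancel assms by blast
qed

definition h :: "'m list \<Rightarrow> 'm list" where
  "h x = (THE c. c \<in> carrier G \<and> aeG (\<lambda>u. F (x @ u) = c \<bullet> u))"

lemma h_eqI: "length x = n \<Longrightarrow> c \<in> carrier G \<Longrightarrow> aeG (\<lambda>u. F (x @ u) = c \<bullet> u) \<Longrightarrow> h x = c"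
  unfolding h_def by (rule the_equality) (use translation_unique in blast)+

lemma h_closed: "x \<in> X' \<Longrightarrow> h x \<in> carrier G" and h_ae: "x \<in> X' \<Longrightarrow> aeG (\<lambda>u. F (x @ u) = h x \<bullet> u)"
proof -
  assume x: "x \<in> X'"
  obtain c where c: "c \<in> carrier G" "aeG (\<lambda>u. F (x @ u) = c \<bullet> u)" using translation_exists[OF x] by blast
  with h_eqI[OF X'_length[OF x]] have "h x = c" by blast
  then show "h x \<in> carrier G" "aeG (\<lambda>u. F (x @ u) = h x \<bullet> u)" using c by simp_all
qed

lemma h_length: "x \<in> X' \<Longrightarrow> length (h x) = n"
  using h_closed G_length by blast

text \<open>The value of \<open>h\<close> is characterised by an almost-everywhere condition over
  \<open>G\<close>, which is definable in the expansion by (D3).\<close>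

lemma h_graph: "DN {x @ h x | x. x \<in> X'}"
proof -
  have "{x @ h x | x. x \<in> X'} = {z \<in> Mn (n + n). take n z \<in> X' \<and> drop n z \<in> carrier G \<and>
      aeG (\<lambda>u. F (take n z @ u) = drop n z \<bullet> u)}" (is "?L = ?R")
  proof
    show "?L \<subseteq> ?R"
    proof
      fix z assume "z \<in> ?L"
      then obtain x where x: "x \<in> X'" "z = x @ h x" by blast
      then show "z \<in> ?R" using h_closed[OF x(1)] h_ae[OF x(1)] h_length[OF x(1)] X'_length[OF x(1)] by (simp add: Mn_def)
    qed
    show "?R \<subseteq> ?L"
    proof
      fix z assume z: "z \<in> ?R"
      then have "drop n z = h (take n z)" using h_eqI[of "take n z" "drop n z"] by (simp add: Mn_def)
      then have "z = take n z @ h (take n z)" by (metis append_take_drop_id)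
      then show "z \<in> ?L" using z by blast
    qed
  qed
  moreover have "N.dpred (n + n) (\<lambda>z. take n z \<in> X' \<and> drop n z \<in> carrier G \<and> aeG (\<lambda>u. F (take n z @ u) = drop n z \<bullet> u))"
    by (intro N_dp N.dpred_dmap[OF _ X'_DN]) (auto simp: Mn_def)
  ultimately show ?thesis by (simp add: N.dpred_def)
qed

lemma h_inj: "inj_on h X'"
proof (rule inj_onI)
  fix x x' assume x: "x \<in> X'" "x' \<in> X'" "h x = h x'"
  have l: "length x = n" "length x' = n" "length (h x) = n" using x X'_length h_length by auto
  have D: "N.dpred n (\<lambda>u. R (F (x @ u) @ u) = x)" "N.dpred n (\<lambda>u. R (F (x' @ u) @ u) = x')"
    by (intro N_dp; use l in \<open>auto simp: Mn_def FQR_length\<close>)+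
  have D': "N.dpred n (\<lambda>u. F (x @ u) = h x \<bullet> u)" "N.dpred n (\<lambda>u. F (x' @ u) = h x \<bullet> u)"
    by (rule dpred_F_eq_mul; use l in simp)+
  have "aeG (\<lambda>u. R (F (x @ u) @ u) = x)" "aeG (\<lambda>u. R (F (x' @ u) @ u) = x')"
    using x aeX_iff[OF D(1)] aeX_iff[OF D(2)] by (auto simp: X'_def gen_def)
  moreover have "aeG (\<lambda>u. F (x @ u) = h x \<bullet> u)" "aeG (\<lambda>u. F (x' @ u) = h x \<bullet> u)"
    using h_ae[OF x(1)] h_ae[OF x(2)] x(3) by auto
  ultimately have "aeG (\<lambda>u. (R (F (x @ u) @ u) = x \<and> R (F (x' @ u) @ u) = x') \<and> F (x @ u) = h x \<bullet> u \<and> F (x' @ u) = h x \<bullet> u)"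
    by (intro aeG_conj D D' N.dpred_conj)
  then obtain u where "R (F (x @ u) @ u) = x" "R (F (x' @ u) @ u) = x'" "F (x @ u) = h x \<bullet> u" "F (x' @ u) = h x \<bullet> u"
    using aeG_ex by blast
  then show "x = x'" by metis
qed

lemma h_image_large: "small k (carrier G - h ` X')"
proof -
  have s: "small k {x \<in> Mn n. x \<in> carrier G \<and> \<not> (gen x \<and> prodF x)}" using aeG_gen by (simp add: ae_def)
  have Dh: "DN (h ` X')"
  proof -
    have "N.dpred n (\<lambda>w. \<exists>x\<in>Mn n. x @ w \<in> {x @ h x | x. x \<in> X'})"
      by (intro N.dpred_ex N.dpred_dmap[OF _ h_graph] N.dmap_basic)
    moreover have "{w \<in> Mn n. \<exists>x\<in>Mn n. x @ w \<in> {x @ h x | x. x \<in> X'}} = h ` X'"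
    proof
      show "h ` X' \<subseteq> {w \<in> Mn n. \<exists>x\<in>Mn n. x @ w \<in> {x @ h x | x. x \<in> X'}}"
        using h_length X'_Mn by (auto simp: Mn_def)
      show "{w \<in> Mn n. \<exists>x\<in>Mn n. x @ w \<in> {x @ h x | x. x \<in> X'}} \<subseteq> h ` X'"
      proof
        fix w assume "w \<in> {w \<in> Mn n. \<exists>x\<in>Mn n. x @ w \<in> {x @ h x | x. x \<in> X'}}"
        then obtain x x' where "x \<in> Mn n" "x @ w = x' @ h x'" "x' \<in> X'" by blast
        then have "w = h x'" using X'_length[of x'] by (simp add: Mn_def)
        then show "w \<in> h ` X'" using \<open>x' \<in> X'\<close> by blast
      qed
    qed
    ultimately show ?thesis by (simp add: N.dpred_def)
  qed
  have hM: "h ` X' \<subseteq> Mn n" using h_length by (auto simp: Mn_def)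
  show ?thesis
  proof (rule small_subset[OF s N.D_Diff[OF G_DN Dh G_Mn hM], of n])
    show "DN {x \<in> Mn n. x \<in> carrier G \<and> \<not> (gen x \<and> prodF x)}" unfolding N.dpred_def[symmetric]
      by (intro N.dpred_logic N.D_dpred G_DN N_dpred_prodF dpred_LN[OF L_dpred_gen])
    show "carrier G - h ` X' \<subseteq> {x \<in> Mn n. x \<in> carrier G \<and> \<not> (gen x \<and> prodF x)}"
    proof
      fix a assume a: "a \<in> carrier G - h ` X'"
      have "\<not> (gen a \<and> prodF a)"
      proof
        assume g: "gen a \<and> prodF a"
        then have "a \<in> X'" using a G_Mn by (auto simp: X'_def)
        moreover have "h a = a" using g a G_length by (intro h_eqI) (auto simp: prodF_def)
        ultimately show False using a by (metis DiffD2 image_eqI)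
      qed
      then show "a \<in> {x \<in> Mn n. x \<in> carrier G \<and> \<not> (gen x \<and> prodF x)}" using a G_Mn by blast
    qed
  qed auto
qed

text \<open>The pairs at which generic associativity holds. For almost all \<open>y\<close> this is
  part of \<open>gen\<close>, but the homomorphism property needs it at the given pair. Quantifying
  \<open>w\<close> over \<open>X\<close> rather than over \<open>G\<close> keeps \<open>Z\<close>
  o-minimally definable.\<close>

definition Z :: "'m list set" where
  "Z = {z \<in> Mn (n + n). take n z \<in> X' \<and> drop n z \<in> X' \<and> F (take n z @ drop n z) \<in> X' \<and>
     aeX (\<lambda>w. F (F (take n z @ drop n z) @ w) = F (take n z @ F (drop n z @ w)))}"

lemma L_dpred_Z: "L.dpred (n + n) (\<lambda>z. take n z \<in> X' \<and> drop n z \<in> X' \<and> F (take n z @ drop n z) \<in> X' \<and>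
     aeX (\<lambda>w. F (F (take n z @ drop n z) @ w) = F (take n z @ F (drop n z @ w))))"
  by (intro L_dp L.dpred_dmap[OF _ X'_DL]) (auto simp: Mn_def FQR_length)

lemma Z_DL: "DL Z"
  using L_dpred_Z by (simp add: Z_def L.dpred_def)

lemma sq_X': "sq X' = {z \<in> Mn (n + n). take n z \<in> X' \<and> drop n z \<in> X'}"
proof
  show "sq X' \<subseteq> {z \<in> Mn (n + n). take n z \<in> X' \<and> drop n z \<in> X'}" using X'_length by (auto simp: sq_def Mn_def)
  show "{z \<in> Mn (n + n). take n z \<in> X' \<and> drop n z \<in> X'} \<subseteq> sq X'"
  proof
    fix z assume "z \<in> {z \<in> Mn (n + n). take n z \<in> X' \<and> drop n z \<in> X'}"
    then have "take n z \<in> X'" "drop n z \<in> X'" "z = take n z @ drop n z" by auto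
    then show "z \<in> sq X'" unfolding sq_def by blast
  qed
qed

text \<open>For generic \<open>x\<close> and \<open>y\<close> in \<open>G\<close> the value
  \<open>F (x @ y)\<close> is the group product, and it is again generic by translation invariance.
  The statement is then moved from \<open>G\<close> to \<open>X\<close> and turned into a dimension
  bound by \<open>ae_fubini\<close>.\<close>

lemma Z_large: "small (k + k) (sq X' - Z)"
proof -
  \<comment> \<open>The implication makes \<open>P\<close> hold trivially off \<open>sq X'\<close>,
    so that it can be quantified over \<open>G\<close> and over \<open>X\<close>.\<close>
  define P where "P x y \<longleftrightarrow> (x \<in> X' \<longrightarrow> y \<in> X' \<longrightarrow> x @ y \<in> Z)" for x y
  have DP: "N.dpred (n + n) (\<lambda>z. P (take n z) (drop n z))" unfolding P_def
    by (intro N.dpred_logic N.dpred_dmap[OF _ X'_DN] N.dpred_dmap[OF _ DL_DN[OF Z_DL]] N.dmap_basic)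
  have "aeG (\<lambda>x. aeG (P x))"
  proof (rule ae_mono[OF G_DN _ _ aeG_gen])
    show "N.dpred n (\<lambda>x. gen x \<and> prodF x)" by (intro N.dpred_conj N_dpred_prodF dpred_LN[OF L_dpred_gen])
    show "N.dpred n (\<lambda>x. aeG (P x))" by (intro N_dpred_ae[OF G_DN] DP)
    fix x assume x: "x \<in> Mn n" "x \<in> carrier G" "gen x \<and> prodF x"
    have l: "length x = n" using x by (simp add: Mn_def)
    define A where "A y \<longleftrightarrow> aeX (\<lambda>w. F (F (x @ y) @ w) = F (x @ F (y @ w)))" for y
    have D: "N.dpred n A" "N.dpred n (\<lambda>y. F (x @ y) = x \<bullet> y)" unfolding A_def
      by (intro N_dp; use l in \<open>auto simp: Mn_def FQR_length\<close>)+
    have Dg: "N.dpred n (\<lambda>y. gen (x \<bullet> y))"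
      by (rule N.dpred_comp[OF dpred_LN[OF L_dpred_gen]]) (use l in \<open>auto simp: Mn_def intro!: N_dp\<close>)
    have "aeX A" using x by (simp add: gen_def A_def[abs_def])
    then have "aeG A" using aeX_iff[OF D(1)] by simp
    moreover have "aeG (\<lambda>y. F (x @ y) = x \<bullet> y)" using x by (simp add: prodF_def)
    moreover have "aeG gen"
      by (rule ae_mono[OF G_DN _ _ aeG_gen]) (auto intro!: N.dpred_conj N_dpred_prodF dpred_LN[OF L_dpred_gen])
    then have "aeG (\<lambda>y. gen (x \<bullet> y))" by (intro aeG_left x dpred_LN[OF L_dpred_gen])
    ultimately have "aeG (\<lambda>y. A y \<and> F (x @ y) = x \<bullet> y \<and> gen (x \<bullet> y))"
      by (intro aeG_conj D Dg N.dpred_conj)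
    then show "aeG (P x)"
    proof (rule ae_mono[OF G_DN, rotated 2])
      show "N.dpred n (\<lambda>y. A y \<and> F (x @ y) = x \<bullet> y \<and> gen (x \<bullet> y))" by (intro D Dg N.dpred_conj)
      show "N.dpred n (P x)" using N.dpred_comp2[OF DP, of n "\<lambda>_. x" "\<lambda>y. y"] x(1) by (auto intro!: N.dmap_basic)
      fix y assume y: "y \<in> Mn n" "A y \<and> F (x @ y) = x \<bullet> y \<and> gen (x \<bullet> y)"
      then have "F (x @ y) \<in> X'" by (simp add: X'_def Mn_def)
      moreover have "aeX (\<lambda>w. F (F (x @ y) @ w) = F (x @ F (y @ w)))" using y unfolding A_def by blast
      moreover have "take n (x @ y) = x" "drop n (x @ y) = y" "x @ y \<in> Mn (n + n)" using y l by (auto simp: Mn_def)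
      ultimately show "P x y" unfolding P_def Z_def by (simp only: mem_Collect_eq) blast
    qed
  qed
  then have "aeX (\<lambda>x. aeX (P x))" using aeX_aeX_iff[OF DP] by simp
  moreover have "small (Suc k) X"
  proof -
    have "small (Suc k) (X - carrier G \<union> carrier G)"
      by (rule small_Un[OF small_weaken[OF XG] G_small_Suc, of n]) (use N.D_Diff[OF X_DN G_DN X_Mn G_Mn] G_DN X_Mn G_Mn in auto)
    moreover have "DN (X - carrier G \<union> carrier G)"
      by (rule N.D_Un[of _ _ n]) (use N.D_Diff[OF X_DN G_DN X_Mn G_Mn] G_DN X_Mn G_Mn in auto)
    ultimately show ?thesis using small_subset[of "Suc k" "X - carrier G \<union> carrier G" X n] X_DN X_Mn G_Mn by blast
  qed
  ultimately have s: "small (k + k) {z \<in> Mn (n + n). take n z \<in> X \<and> drop n z \<in> X \<and> \<not> P (take n z) (drop n z)}"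
    using ae_fubini[OF X_DN X_Mn _ DP] by simp
  have "DN (sq X' - Z)"
  proof -
    have "N.dpred (n + n) (\<lambda>z. (take n z \<in> X' \<and> drop n z \<in> X') \<and> z \<notin> Z)"
      by (intro N.dpred_logic N.dpred_dmap[OF _ X'_DN] N.dpred_dmap[OF _ DL_DN[OF Z_DL]] N.dmap_basic)
    moreover have "{z \<in> Mn (n + n). (take n z \<in> X' \<and> drop n z \<in> X') \<and> z \<notin> Z} = sq X' - Z" unfolding sq_X' by blast
    ultimately show ?thesis by (simp only: N.dpred_def)
  qed
  then show ?thesis
    by (rule small_subset[OF s _ D_pairs[OF X_DN DP], of _ "n + n"]) (use X'_X in \<open>auto simp: sq_X' P_def\<close>)
qed

text \<open>Both sides act on a generic \<open>w\<close> in the same way: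
  \<open>F (F (x @ y) @ w)\<close> is translation by \<open>h (F (x @ y))\<close>, while
  \<open>F (x @ F (y @ w))\<close> is translation by \<open>h y\<close> followed by
  \<open>h x\<close>. Cancelling \<open>w\<close> gives the identity.\<close>

lemma h_hom:
  assumes x: "x \<in> X'" "y \<in> X'" "x @ y \<in> Z"
  shows "h x \<otimes>\<^bsub>G\<^esub> h y = h (F (x @ y))"
proof -
  have l: "length x = n" "length y = n" using x X'_length by auto
  have lh: "length (h x) = n" "length (h y) = n" using x h_length by auto
  have fX: "F (x @ y) \<in> X'" and a: "aeX (\<lambda>w. F (F (x @ y) @ w) = F (x @ F (y @ w)))"
    using x(3) l by (auto simp: Z_def)
  have D: "N.dpred n (\<lambda>w. F (F (x @ y) @ w) = F (x @ F (y @ w)))" "N.dpred n (\<lambda>w. F (F (x @ y) @ w) = h (F (x @ y)) \<bullet> w)"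
    "N.dpred n (\<lambda>w. F (y @ w) = h y \<bullet> w)" "N.dpred n (\<lambda>w. F (x @ (h y \<bullet> w)) = h x \<bullet> (h y \<bullet> w))"
    by (intro N_dp; use l lh h_length[OF fX] in \<open>auto simp: Mn_def FQR_length\<close>)+
  have "aeG (\<lambda>w. F (F (x @ y) @ w) = F (x @ F (y @ w)))" using a aeX_iff[OF D(1)] by simp
  moreover have "aeG (\<lambda>w. F (F (x @ y) @ w) = h (F (x @ y)) \<bullet> w)" by (rule h_ae[OF fX])
  moreover have "aeG (\<lambda>w. F (y @ w) = h y \<bullet> w)" by (rule h_ae[OF x(2)])
  moreover have "aeG (\<lambda>w. F (x @ (h y \<bullet> w)) = h x \<bullet> (h y \<bullet> w))"
    using aeG_left[OF h_closed[OF x(2)] dpred_F_eq_mul[OF l(1) lh(1)] h_ae[OF x(1)]] .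
  ultimately have "aeG (\<lambda>w. (F (F (x @ y) @ w) = F (x @ F (y @ w)) \<and> F (F (x @ y) @ w) = h (F (x @ y)) \<bullet> w) \<and>
      F (y @ w) = h y \<bullet> w \<and> F (x @ (h y \<bullet> w)) = h x \<bullet> (h y \<bullet> w))"
    by (intro aeG_conj D N.dpred_conj)
  from aeG_ex[OF this] obtain w where w: "w \<in> carrier G" "h (F (x @ y)) \<bullet> w = h x \<bullet> (h y \<bullet> w)" by auto
  then have "h (F (x @ y)) \<bullet> w = h x \<bullet> h y \<bullet> w" using mul_assoc h_closed x by simp
  then have "h (F (x @ y)) = h x \<bullet> h y" using mul_right_cancel w(1) h_closed fX by simp
  then show ?thesis using h_closed x by (simp add: mul_def)
qed

lemma group_chunk_definable:
  "\<exists>m X Z h F.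
           DL X \<and> X \<subseteq> Mn m \<and> DL Z \<and> Z \<subseteq> sq X \<and>
           dimf (sq X - Z) < ereal (real (2 * k)) \<and>
           DN {x @ h x | x. x \<in> X} \<and> inj_on h X \<and> h ` X \<subseteq> carrier G \<and>
           dimf (carrier G - h ` X) < ereal (real k) \<and>
           DL {z @ F z | z. z \<in> sq X} \<and> F ` sq X \<subseteq> X \<and>
           (\<forall>x\<in>X. \<forall>y\<in>X. x @ y \<in> Z \<longrightarrow> h x \<otimes>\<^bsub>G\<^esub> h y = h (F (x @ y)))"
proof -
  obtain x0 where "x0 \<in> carrier G" "gen x0" using aeG_ex[OF aeG_gen] by blast
  then have x0: "x0 \<in> X'" using G_Mn by (auto simp: X'_def)
  \<comment> \<open>Off \<open>Z\<close> the value of \<open>F\<close> may leave \<open>X'\<close>,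
    so it is redirected to a fixed point \<open>x0\<close>, which exists because generic group
    elements do. On \<open>Z\<close> nothing changes.\<close>
  define F' where "F' z = (if F z \<in> X' then F z else x0)" for z
  have DF': "L.dmap (n + n) F'" unfolding F'_def
    by (intro L.dmap_if L.dpred_dmap[OF F_dmap X'_DL] F_dmap L.dmap_const) (use X'_length[OF x0] F_length in \<open>auto simp: Mn_def\<close>)
  have Dsq: "DL (sq X')"
  proof -
    have "L.dpred (n + n) (\<lambda>z. take n z \<in> X' \<and> drop n z \<in> X')"
      by (intro L.dpred_logic L.dpred_dmap[OF _ X'_DL] L.dmap_basic)
    then show ?thesis by (simp add: sq_X' L.dpred_def)
  qed
  have sqM: "sq X' \<subseteq> Mn (n + n)" by (auto simp: sq_X')
  have "DL {z @ F' z | z. z \<in> sq X'}" by (rule L.D_graph[OF Dsq sqM DF'])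
  moreover have "F' ` sq X' \<subseteq> X'" using x0 by (auto simp: F'_def)
  moreover have "Z \<subseteq> sq X'" by (auto simp: Z_def sq_X')
  moreover have "\<forall>x\<in>X'. \<forall>y\<in>X'. x @ y \<in> Z \<longrightarrow> h x \<otimes>\<^bsub>G\<^esub> h y = h (F' (x @ y))"
  proof (intro ballI impI)
    fix x y assume xy: "x \<in> X'" "y \<in> X'" "x @ y \<in> Z"
    then have "F (x @ y) \<in> X'" using X'_length by (auto simp: Z_def)
    then show "h x \<otimes>\<^bsub>G\<^esub> h y = h (F' (x @ y))" using h_hom[OF xy] by (simp add: F'_def)
  qed
  moreover have "h ` X' \<subseteq> carrier G" using h_closed by blast
  moreover have "dimf (sq X' - Z) < ereal (real (2 * k))" "dimf (carrier G - h ` X') < ereal (real k)"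
    using Z_large h_image_large unfolding small_def mult_2 by auto
  ultimately show ?thesis using X'_DL X'_Mn Z_DL h_graph h_inj by blast
qed

end

section \<open>Existence of the chunk data\<close>

context tame_group begin

text \<open>The complement \<open>U\<close> of the closure is open and definable. Here the
  hypothesis on open definable sets enters.\<close>

lemma closure_DL: "DL (cl n (carrier G))" "cl n (carrier G) \<subseteq> Mn n" "carrier G \<subseteq> cl n (carrier G)"
proof -
  define U where "U = {x \<in> Mn n. \<exists>a\<in>Mn n. \<exists>b\<in>Mn n. x \<in> box n a b \<and> (\<forall>y\<in>Mn n. y \<in> box n a b \<longrightarrow> y \<notin> carrier G)}"
  have "N.dpred n (\<lambda>x. \<exists>a\<in>Mn n. \<exists>b\<in>Mn n. x \<in> box n a b \<and> (\<forall>y\<in>Mn n. y \<in> box n a b \<longrightarrow> y \<notin> carrier G))"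
    by (intro N.dpred_quant N.dpred_logic N.dpred_atoms N.dpred_dmap[OF _ G_DN] N.dmap_basic)
  then have "DN U" by (simp add: U_def N.dpred_def)
  moreover have "open_n n U" unfolding open_n_near
  proof (intro conjI ballI)
    fix t assume "t \<in> U"
    then obtain a b where ab: "a \<in> Mn n" "b \<in> Mn n" "t \<in> box n a b" "\<forall>y\<in>Mn n. y \<in> box n a b \<longrightarrow> y \<notin> carrier G"
      by (auto simp: U_def)
    show "near n t (\<lambda>t'. t' \<in> U)"
      using near_in_box[OF ab(1-3)] by (rule near_mono) (use ab in \<open>auto simp: U_def\<close>)
  qed (auto simp: U_def)
  ultimately have U: "DL U" by (rule open_DL)
  have e: "cl n (carrier G) = Mn n - U"
  proof -
    have "box n a b \<inter> carrier G \<noteq> {} \<longleftrightarrow> (\<exists>y\<in>Mn n. y \<in> box n a b \<and> y \<in> carrier G)" for a b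
      using G_Mn by blast
    then have "x \<in> cl n (carrier G) \<longleftrightarrow> x \<in> Mn n - U" for x
      unfolding cl_def U_def Mn_def by simp blast
    then show ?thesis by blast
  qed
  show "DL (cl n (carrier G))" unfolding e by (rule L.D_Diff[OF L.D_Mn U, of n n]) (auto simp: U_def)
  show "cl n (carrier G) \<subseteq> Mn n" unfolding e by blast
  show "carrier G \<subseteq> cl n (carrier G)" unfolding e using G_Mn by (auto simp: U_def)
qed

lemma approx_ae:
  assumes V: "DN V" "V \<subseteq> Mn n" "small k (carrier G - V)"
    and f: "N.dmap (n + n) f" and F: "L.dmap (n + n) F"
    and s: "small (k + k) {z \<in> sq V. f z \<noteq> F z}"
  shows "aeG (\<lambda>x. aeG (\<lambda>y. F (x @ y) = f (x @ y)))"
proof -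
  \<comment> \<open>Agreement of \<open>F\<close> and \<open>f\<close> is controlled on
    \<open>sq V\<close> only, so \<open>P\<close> asks for nothing elsewhere. The premises about
    \<open>V\<close> are discharged at the end, almost all of \<open>G\<close> being in
    \<open>V\<close>.\<close>
  define P where "P x y \<longleftrightarrow> (x \<in> V \<and> y \<in> V \<longrightarrow> F (x @ y) = f (x @ y))" for x y
  have Df: "N.dpred (n + n) (\<lambda>z. F (take n z @ drop n z) = f (take n z @ drop n z))"
    using N.dpred_eq[OF dmap_LN[OF F] f] by simp
  have DP: "N.dpred (n + n) (\<lambda>z. P (take n z) (drop n z))" unfolding P_def
    by (intro N.dpred_logic Df N.dpred_dmap[OF _ V(1)] N.dmap_basic)
  have sqV: "sq V = {z \<in> Mn (n + n). take n z \<in> V \<and> drop n z \<in> V}" (is "_ = ?S")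
  proof
    show "sq V \<subseteq> ?S"
    proof
      fix z assume "z \<in> sq V"
      then obtain x y where xy: "x \<in> V" "y \<in> V" "z = x @ y" unfolding sq_def by blast
      then have "length x = n" "length y = n" using V(2) by (auto simp: Mn_def)
      then show "z \<in> ?S" using xy by (simp add: Mn_def)
    qed
    show "?S \<subseteq> sq V"
    proof
      fix z assume "z \<in> ?S"
      then have "take n z \<in> V" "drop n z \<in> V" "z = take n z @ drop n z" by auto
      then show "z \<in> sq V" unfolding sq_def by blast
    qed
  qed
  have "N.dpred (n + n) (\<lambda>z. (take n z \<in> V \<and> drop n z \<in> V) \<and> \<not> f z = F z)"
    by (intro N.dpred_logic N.dpred_dmap[OF _ V(1)] N.dpred_eq f dmap_LN[OF F] N.dmap_basic)
  then have Ds: "DN {z \<in> sq V. f z \<noteq> F z}" unfolding sqV by (simp add: N.dpred_def conj_assoc)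
  have "small (k + k) {z \<in> Mn (n + n). take n z \<in> carrier G \<and> drop n z \<in> carrier G \<and> \<not> P (take n z) (drop n z)}"
    by (rule small_subset[OF s D_pairs[OF G_DN DP] Ds, of "n + n"]) (auto simp: P_def sqV)
  then have a: "aeG (\<lambda>x. aeG (P x))" using ae_fubini[OF G_DN G_Mn G_small_Suc DP] by simp
  have aV: "aeG (\<lambda>x. x \<in> V)"
  proof -
    have "{u \<in> Mn n. u \<in> carrier G \<and> u \<notin> V} = carrier G - V" using G_Mn by blast
    then show ?thesis using V(3) by (simp add: ae_def)
  qed
  have DV: "N.dpred n (\<lambda>x. x \<in> V)" by (rule N.D_dpred[OF V(1)])
  have D1: "N.dpred n (\<lambda>x. aeG (P x))" by (intro N_dpred_ae[OF G_DN] DP)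
  show ?thesis
  proof (rule ae_mono[OF G_DN _ _ aeG_conj[OF DV D1 aV a]])
    show "N.dpred n (\<lambda>x. x \<in> V \<and> aeG (P x))" by (intro N.dpred_conj DV D1)
    show "N.dpred n (\<lambda>x. aeG (\<lambda>y. F (x @ y) = f (x @ y)))" by (intro N_dpred_ae[OF G_DN] Df)
    fix x assume x: "x \<in> Mn n" "x \<in> V \<and> aeG (P x)"
    have D2: "N.dpred n (P x)" by (rule N.dpred_comp2[OF DP, of n "\<lambda>_. x" "\<lambda>y. y"]) (use x in \<open>auto intro!: N.dmap_basic\<close>)
    have D3: "N.dpred n (\<lambda>y. F (x @ y) = f (x @ y))"
      by (rule N.dpred_comp2[OF Df, of n "\<lambda>_. x" "\<lambda>y. y"]) (use x in \<open>auto intro!: N.dmap_basic\<close>)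
    show "aeG (\<lambda>y. F (x @ y) = f (x @ y))"
    proof (rule ae_mono[OF G_DN N.dpred_conj[OF DV D2] D3 aeG_conj[OF DV D2 aV]])
      show "aeG (P x)" using x by blast
    qed (use x in \<open>auto simp: P_def\<close>)
  qed
qed

lemma group_chunk_exists:
  assumes sl: "strongly_large dimf n (carrier G)"
  shows "\<exists>X F Q R. group_chunk DL DN dimf G n k X F Q R"
proof -
  define V where "V = cl n (carrier G)"
  have V: "DL V" "V \<subseteq> Mn n" "carrier G \<subseteq> V" unfolding V_def by (rule closure_DL)+
  \<comment> \<open>Strong largeness is used here: the closure has dimension \<open>k\<close> like
    \<open>G\<close>, so it decomposes into pieces with charts into
    \<open>M\<^sup>k\<close>.\<close>
  have sV: "small (Suc k) V" using sl G_small_Suc by (simp add: small_def strongly_large_def V_def)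
  obtain \<W> where W: "finite \<W>" "\<And>W. W \<in> \<W> \<Longrightarrow> piece k n W \<and> W \<subseteq> V" "small k (V - \<Union>\<W>)"
    using piece_decomposition[OF V(1,2) sV] by meson
  define V0 where "V0 = \<Union>\<W>"
  have V0: "DL V0" "V0 \<subseteq> Mn n"
    using L.D_Union_finite[OF W(1), of "\<lambda>W. W" n] W(2) unfolding piece_def V0_def by (simp, blast)
  note V0N = DL_DN[OF V0(1)]
  have GV0: "small k (carrier G - V0)"
    by (rule small_subset[OF W(3)[folded V0_def] N.D_Diff[OF G_DN V0N G_Mn V0(2)] DL_DN[OF L.D_Diff[OF V(1) V0(1) V(2) V0(2)]], of n]) (use V in auto)
  define c1 :: 'm where "c1 = undefined"
  obtain c2 where c12: "c1 < c2" using gt_ex by blast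
  \<comment> \<open>A characteristic function of \<open>G\<close> with two distinct scalars as
    values. An o-minimal approximation \<open>H\<close> of it on the pieces yields \<open>X\<close>
    as the level set of \<open>c1\<close>, equal to \<open>G\<close> up to small sets.\<close>
  define f where "f x = (if x \<in> carrier G then c1 else c2)" for x
  have f: "N.dmap n (\<lambda>x. [f x])" unfolding f_def by (intro N.dmap_if1 N.D_dpred G_DN N.dmap_const)
  obtain H where H: "L.dmap n (\<lambda>x. [H x])" "small k {x \<in> V0. f x \<noteq> H x}"
    using approx_pieces[OF W(1) _ f] W(2) unfolding V0_def by blast
  define X where "X = {x \<in> V0. H x = c1}"
  have X: "DL X" "X \<subseteq> Mn n" unfolding X_def using V0(2)
    by (auto intro!: L.D_Collect'[OF V0] L.dpred_eq1 H L.dmap_const)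
  have Dd: "DN {x \<in> V0. f x \<noteq> H x}" by (intro N.D_Collect'[OF V0N V0(2)] N.dpred_not N.dpred_eq1 f dmap_LN H)
  have XG: "small k (X - carrier G)"
    by (rule small_subset[OF H(2) N.D_Diff[OF DL_DN[OF X(1)] G_DN X(2) G_Mn] Dd, of n]) (use V0 c12 in \<open>auto simp: X_def f_def\<close>)
  have "small k ((carrier G - V0) \<union> {x \<in> V0. f x \<noteq> H x})" "DN ((carrier G - V0) \<union> {x \<in> V0. f x \<noteq> H x})"
    using N.D_Diff[OF G_DN V0N G_Mn V0(2)] G_Mn V0(2) Dd GV0 H(2) by (auto intro!: small_Un[where n=n] N.D_Un[where n=n])
  then have GX: "small k (carrier G - X)"
    by (rule small_subset[OF _ N.D_Diff[OF G_DN DL_DN[OF X(1)] G_Mn X(2)], where n=n]) (use G_Mn V0(2) in \<open>auto simp: X_def f_def\<close>)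
  \<comment> \<open>Products of pairs of pieces cover \<open>sq V0\<close>, and their charts into
    \<open>M\<close> to the power \<open>k + k\<close> allow approximation of binary operations up
    to dimension below \<open>2 k\<close>.\<close>
  define \<W>2 where "\<W>2 = (\<lambda>(W, W'). {x @ y | x y. x \<in> W \<and> y \<in> W'}) ` (\<W> \<times> \<W>)"
  have W2: "finite \<W>2" "\<And>W. W \<in> \<W>2 \<Longrightarrow> piece (k + k) (n + n) W"
    unfolding \<W>2_def using W(1,2) piece_product by auto
  have U2: "\<Union>\<W>2 = sq V0" unfolding \<W>2_def V0_def sq_def by blast
  have ex: "\<exists>F. L.dmap (n + n) F \<and> (\<forall>z\<in>Mn (n + n). F z \<in> Mn n) \<and> aeG (\<lambda>x. aeG (\<lambda>y. F (x @ y) = f (x @ y)))"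
    if f: "N.dmap (n + n) f" "\<And>z. z \<in> Mn (n + n) \<Longrightarrow> f z \<in> Mn n" for f
    using approx_map[OF W2 f] approx_ae[OF V0N V0(2) GV0 f(1)] unfolding U2 by blast
  have ae_cong: "aeG (\<lambda>x. aeG (\<lambda>y. P x y)) \<longleftrightarrow> aeG (\<lambda>x. aeG (\<lambda>y. P' x y))"
    if "\<And>x y. x \<in> carrier G \<Longrightarrow> y \<in> carrier G \<Longrightarrow> P x y = P' x y" for P P'
    unfolding ae_def using that by (smt (verit) Collect_cong)
  have cg: "aeG (\<lambda>x. aeG (\<lambda>y. F (x @ y) = g (take n (x @ y)) (drop n (x @ y)))) \<longleftrightarrow> aeG (\<lambda>x. aeG (\<lambda>y. F (x @ y) = g x y))" for F g
    by (rule ae_cong) (simp add: G_length)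
  have ex2: "\<exists>F. L.dmap (n + n) F \<and> (\<forall>z\<in>Mn (n + n). F z \<in> Mn n) \<and> aeG (\<lambda>x. aeG (\<lambda>y. F (x @ y) = g x y))"
    if "N.dmap (n + n) (\<lambda>z. g (take n z) (drop n z))" "\<And>x y. length (g x y) = n" for g
    using ex[OF that(1)] that(2) unfolding cg[of _ g] by (simp add: Mn_def)
  have "N.dmap (n + n) (\<lambda>z. take n z \<bullet> drop n z)" "N.dmap (n + n) (\<lambda>z. iv (take n z) \<bullet> drop n z)"
    "N.dmap (n + n) (\<lambda>z. take n z \<bullet> iv (drop n z))"
    by (intro dmap_mul dmap_iv N.dmap_take N.dmap_drop N.dmap_id; simp add: Mn_def)+
  note dm = this
  obtain F where F: "L.dmap (n + n) F" "\<forall>z\<in>Mn (n + n). F z \<in> Mn n" "aeG (\<lambda>x. aeG (\<lambda>y. F (x @ y) = x \<bullet> y))"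
    using ex2[of mul, OF dm(1) mul_length] by (elim exE conjE)
  obtain Q where Q: "L.dmap (n + n) Q" "\<forall>z\<in>Mn (n + n). Q z \<in> Mn n" "aeG (\<lambda>x. aeG (\<lambda>y. Q (x @ y) = iv x \<bullet> y))"
    using ex2[of "\<lambda>x y. iv x \<bullet> y", OF dm(2) mul_length] by (elim exE conjE)
  obtain R where R: "L.dmap (n + n) R" "\<forall>z\<in>Mn (n + n). R z \<in> Mn n" "aeG (\<lambda>x. aeG (\<lambda>y. R (x @ y) = x \<bullet> iv y))"
    using ex2[of "\<lambda>x y. x \<bullet> iv y", OF dm(3) mul_length] by (elim exE conjE)
  have "group_chunk DL DN dimf G n k X F Q R"
    by unfold_locales (use X XG GX F Q R in auto)
  then show ?thesis by blast
qed

end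

theorem theorem5p1:
  fixes DL DN :: "('m::{dense_linorder, no_top, no_bot}) list set \<Rightarrow> bool"
    and dimf :: "'m list set \<Rightarrow> ereal"
    and G :: "('m list, 'b) monoid_scheme"
    and n k :: nat
  assumes "o_minimal DL"
    and "expansion DL DN"
    and "\<forall>p U. DN U \<and> open_n p U \<longrightarrow> DL U"
    and "dimension_function DL DN dimf"
    and "definable_group DN n G"
    and "strongly_large dimf n (carrier G)"
    and "dimf (carrier G) = ereal (real k)"
  shows "\<exists>m X Z h F.
           DL X \<and> X \<subseteq> Mn m \<and> DL Z \<and> Z \<subseteq> sq X \<and>
           dimf (sq X - Z) < ereal (real (2 * k)) \<and>
           DN {x @ h x | x. x \<in> X} \<and> inj_on h X \<and> h ` X \<subseteq> carrier G \<and>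
           dimf (carrier G - h ` X) < ereal (real k) \<and>
           DL {z @ F z | z. z \<in> sq X} \<and> F ` sq X \<subseteq> X \<and>
           (\<forall>x\<in>X. \<forall>y\<in>X. x @ y \<in> Z \<longrightarrow> h x \<otimes>\<^bsub>G\<^esub> h y = h (F (x @ y)))"
proof -
  interpret tame_group DL DN dimf G n k
    by unfold_locales (use assms in \<open>auto simp: o_minimal_def expansion_def\<close>)
  obtain X F Q R where "group_chunk DL DN dimf G n k X F Q R"
    using group_chunk_exists[OF assms(6)] by blast
  then show ?thesis by (rule group_chunk.group_chunk_definable)
qed

end
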